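(* Let $M$ be a complex manifold of real dimension $2m$, let $N=\mathbf{R}\times M$, and let ${}^{k}N$ be the $k$-th order extension of $N$. Let $Z$ be a vector field on $N$ given locally by $Z=\frac{\partial}{\partial t}+Z^{0i}\frac{\partial}{\partial z^{0i}}+\overline{Z}^{0i}\frac{\partial}{\partial\overline{z}^{0i}}$ with $Z^{0i},\overline{Z}^{0i}\in\mathcal{F}(M)$. Then the vertical lift of order $k$ of $Z$ to ${}^{k}N$ is $$Z^{v^{k}}=\frac{\partial}{\partial t}+(Z^{0i})^{v^{k}}\frac{\partial}{\partial z^{ki}}+(\overline{Z}^{0i})^{v^{k}}\frac{\partial}{\partial\overline{z}^{ki}}.$$
   Context: All objects are of class $C^\infty$; sums are taken over repeated indices, with $1\le i\le m$. Extensions. $M={}^{0}M$ is a complex manifold of real dimension $2m$ with local complex coordinates $z^{0i}$. ${}^{k}M$ is its $k$-th order extended complex manifold, arising from a sequence ${}^{0}M\leftarrow{}^{1}M\leftarrow{}^{2}M\leftarrow\cdots$ in which ${}^{1}M=TM$ and each ${}^{k}M$ is imbedded in the tangent bundle $T({}^{k-1}M)$ compatibly with the projections. It has local coordinates $(z^{ri},\overline{z}^{ri})$, $0\le r\le k$, $1\le i\le m$, where $\dot z^{ri}=z^{r+1,i}$ and $\dot{\overline z}^{ri}=\overline{z}^{r+1,i}$ for $0\le r\le k-1$ are the velocity coordinates coming from $T({}^{k-1}M)$. The $k$-th order extension of the product manifold $N={}^{0}N=\mathbf{R}\times M$ is ${}^{k}N=\mathbf{R}\times{}^{k}M$, with local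 coordinates $(t,z^{ri},\overline{z}^{ri})$, $0\le r\le k$, and natural projection $\tau_{{}^{k-1}N}:{}^{k}N\to{}^{k-1}N$. $\mathcal{F}(M)$ is the set of (smooth) functions on $M$, regarded also as functions on $N$. Lifts of functions. For a function $\tilde f$ on ${}^{k-1}N$, its vertical lift to ${}^{k}N$ is $\tilde f^{v}=\tilde f\circ\tau_{{}^{k-1}N}$, and its complete lift to ${}^{k}N$ is $$\tilde f^{c}=t\Big(\frac{\partial\tilde f}{\partial t}\Big)^{v}+\dot z^{ri}\Big(\frac{\partial\tilde f}{\partial z^{ri}}\Big)^{v}+\dot{\overline z}^{ri}\Big(\frac{\partial\tilde f}{\partial\overline z^{ri}}\Big)^{v}\qquad(0\le r\le k-1).$$ For $f$ on $N$, $f^{v^{k}}$ and $f^{c^{k}}$ denote the functions on ${}^{k}N$ obtained by applying the vertical, respectively complete, lift $k$ times. Vertical lift of vector fields. The vertical lift of order $k$ of a vector field $Z$ on $N$ is the vector field $Z^{v^{k}}$ on ${}^{k}N$ given by $Z^{v^{k}}(f^{c^{k}})=(Zf)^{v^{k}}$ for every function $f$ on $N$.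
   Formalization: For k ≥ 1 no vector field satisfies the defining identity for every function f on N (f = t and f = t² conflict); the equivalence is proved with the identity required only for f = at + g, a constant and g in F(M), where it is consistent and determines the lift. *)

theory Defs
  imports "HOL-Analysis.Analysis"
begin

section \<open>Partial derivatives and smoothness in coordinates\<close>

text \<open>
  The number of coordinates of the extensions depends on the order k, so coordinate spaces are not
  given by a Euclidean type. A coordinate direction is a shift \<open>\<sigma>\<close>: \<open>\<sigma> h p\<close> is the point p with
  one real coordinate increased by h. A function is of class C-infinity iff its iterated partial
  derivatives of all orders exist and are continuous.
\<close>

definition partial :: "(real \<Rightarrow> 'p \<Rightarrow> 'p) \<Rightarrow> ('p \<Rightarrow> complex) \<Rightarrow> 'p \<Rightarrow> complex" where
  "partial \<sigma> H p = vector_derivative (\<lambda>h. H (\<sigma> h p)) (at 0)"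

definition smooth_along ::
  "(real \<Rightarrow> 'p \<Rightarrow> 'p) set \<Rightarrow> 'p::topological_space set \<Rightarrow> ('p \<Rightarrow> complex) \<Rightarrow> bool" where
  "smooth_along \<Sigma> S H \<longleftrightarrow>
     (\<forall>\<sigma>s. set \<sigma>s \<subseteq> \<Sigma> \<longrightarrow>
        continuous_on S (fold partial \<sigma>s H) \<and>
        (\<forall>\<sigma>\<in>\<Sigma>. \<forall>p\<in>S. (\<lambda>h. fold partial \<sigma>s H (\<sigma> h p)) differentiable (at 0)))"

text \<open>
  Wirtinger derivatives; \<open>\<sigma> 1\<close> and \<open>\<sigma> \<i>\<close> are the shifts of the real and of the imaginary part of
  one complex coordinate.
\<close>

definition wirt :: "(complex \<Rightarrow> real \<Rightarrow> 'p \<Rightarrow> 'p) \<Rightarrow> ('p \<Rightarrow> complex) \<Rightarrow> 'p \<Rightarrow> complex" where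
  "wirt \<sigma> H p = (partial (\<sigma> 1) H p - \<i> * partial (\<sigma> \<i>) H p) / 2"

definition wirt_bar :: "(complex \<Rightarrow> real \<Rightarrow> 'p \<Rightarrow> 'p) \<Rightarrow> ('p \<Rightarrow> complex) \<Rightarrow> 'p \<Rightarrow> complex" where
  "wirt_bar \<sigma> H p = (partial (\<sigma> 1) H p + \<i> * partial (\<sigma> \<i>) H p) / 2"

section \<open>Complex manifolds\<close>

type_synonym ('a, 'm) chart = "'a set \<times> ('a \<Rightarrow> complex ^ 'm)"

definition shift_vec :: "'m \<Rightarrow> complex \<Rightarrow> real \<Rightarrow> complex ^ 'm \<Rightarrow> complex ^ 'm" where
  "shift_vec i w h x = x + axis i (w * of_real h)"

definition holomorphic_map :: "(complex ^ 'm) set \<Rightarrow> (complex ^ 'm \<Rightarrow> complex ^ 'm) \<Rightarrow> bool" where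
  "holomorphic_map S g \<longleftrightarrow>
     (\<forall>j. smooth_along {shift_vec i w |i w. w \<in> {1, \<i>}} S (\<lambda>x. g x $ j) \<and>
          (\<forall>i. \<forall>x\<in>S. wirt_bar (shift_vec i) (\<lambda>x. g x $ j) x = 0))"

text \<open>The whole type \<open>'a\<close> is the manifold; its complex dimension is \<open>CARD('m)\<close>.\<close>

definition complex_atlas :: "('a::topological_space, 'm::finite) chart set \<Rightarrow> bool" where
  "complex_atlas A \<longleftrightarrow>
     (\<Union>(U, \<phi>)\<in>A. U) = UNIV \<and>
     (\<forall>(U, \<phi>)\<in>A. open U \<and> open (\<phi> ` U) \<and> homeomorphism U (\<phi> ` U) \<phi> (the_inv_into U \<phi>)) \<and>
     (\<forall>(U, \<phi>)\<in>A. \<forall>(V, \<psi>)\<in>A. holomorphic_map (\<phi> ` (U \<inter> V)) (\<psi> \<circ> the_inv_into U \<phi>))"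

section \<open>The extended manifolds\<close>

text \<open>
  The k-th order extension of M is realised as the manifold of k-jets at 0 of smooth curves in M,
  so that order 0 gives M (a 0-jet consists of all curves through one point) and order 1 gives TM.
  The jet of order k of \<open>\<gamma>\<close> is embedded in the tangent bundle of the extension of order k-1 as the
  velocity at 0 of the curve sending s to the (k-1)-jet of \<open>\<lambda>u. \<gamma> (s + u)\<close>. With
  \<open>z\<^sup>r\<^sup>i\<close> = the r-th derivative of the i-th coordinate of \<open>\<gamma>\<close> at 0, the velocity coordinate
  belonging to \<open>z\<^sup>r\<^sup>i\<close> is therefore the coordinate with r+1 in place of r.
\<close>

definition nderiv :: "nat \<Rightarrow> (real \<Rightarrow> 'v::real_normed_vector) \<Rightarrow> real \<Rightarrow> 'v" where
  "nderiv n g = ((\<lambda>g s. vector_derivative g (at s)) ^^ n) g"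

definition smooth_germ :: "('a, 'm::finite) chart set \<Rightarrow> (real \<Rightarrow> 'a) \<Rightarrow> bool" where
  "smooth_germ A \<gamma> \<longleftrightarrow>
     (\<forall>(U, \<phi>)\<in>A. \<gamma> 0 \<in> U \<longrightarrow>
        (\<exists>\<epsilon>>0. \<forall>s. \<bar>s\<bar> < \<epsilon> \<longrightarrow> \<gamma> s \<in> U \<and> (\<forall>n. nderiv n (\<phi> \<circ> \<gamma>) differentiable (at s))))"

type_synonym 'a jet = "(real \<Rightarrow> 'a) set"

definition jet :: "('a, 'm::finite) chart set \<Rightarrow> nat \<Rightarrow> (real \<Rightarrow> 'a) \<Rightarrow> 'a jet" where
  "jet A k \<gamma> = {\<delta>. smooth_germ A \<delta> \<and> \<delta> 0 = \<gamma> 0 \<and>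
     (\<forall>(U, \<phi>)\<in>A. \<gamma> 0 \<in> U \<longrightarrow> (\<forall>r\<le>k. nderiv r (\<phi> \<circ> \<delta>) 0 = nderiv r (\<phi> \<circ> \<gamma>) 0))}"

definition ext :: "('a, 'm::finite) chart set \<Rightarrow> nat \<Rightarrow> 'a jet set" where
  "ext A k = {jet A k \<gamma> |\<gamma>. smooth_germ A \<gamma>}"

definition rep :: "'a jet \<Rightarrow> real \<Rightarrow> 'a" where
  "rep J = (SOME \<gamma>. \<gamma> \<in> J)"

text \<open>\<open>proj A k\<close> is the projection from order k+1 to order k.\<close>

definition proj :: "('a, 'm::finite) chart set \<Rightarrow> nat \<Rightarrow> 'a jet \<Rightarrow> 'a jet" where
  "proj A k J = jet A k (rep J)"

definition chart_dom :: "('a, 'm::finite) chart set \<Rightarrow> nat \<Rightarrow> ('a, 'm) chart \<Rightarrow> 'a jet set" where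
  "chart_dom A k c = {J \<in> ext A k. rep J 0 \<in> fst c}"

text \<open>\<open>coord c k J r $ i\<close> is the coordinate \<open>z\<^sup>r\<^sup>i\<close>; the entries with r > k are filled with 0.\<close>

definition coord :: "('a, 'm::finite) chart \<Rightarrow> nat \<Rightarrow> 'a jet \<Rightarrow> nat \<Rightarrow> complex ^ 'm" where
  "coord c k J = (\<lambda>r. if r \<le> k then nderiv r (snd c \<circ> rep J) 0 else 0)"

section \<open>Functions on the extensions of \<open>N = R \<times> M\<close>\<close>

text \<open>
  Functions on the k-th order extension of N are functions of \<open>(t, J)\<close>; only their values for
  \<open>J \<in> ext A k\<close> matter. In particular a function on N itself is a function on
  \<open>R \<times> ext A 0\<close>.
\<close>

definition local_expr :: "('a, 'm::finite) chart set \<Rightarrow> nat \<Rightarrow> ('a, 'm) chart \<Rightarrow>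
    (real \<times> 'a jet \<Rightarrow> complex) \<Rightarrow> real \<times> (nat \<Rightarrow> complex ^ 'm) \<Rightarrow> complex" where
  "local_expr A k c F = (\<lambda>(t, \<zeta>). F (t, the_inv_into (chart_dom A k c) (coord c k) \<zeta>))"

definition shift_t :: "real \<Rightarrow> real \<times> (nat \<Rightarrow> complex ^ 'm) \<Rightarrow> real \<times> (nat \<Rightarrow> complex ^ 'm)" where
  "shift_t h = (\<lambda>(t, \<zeta>). (t + h, \<zeta>))"

definition shift_z :: "nat \<Rightarrow> 'm::finite \<Rightarrow> complex \<Rightarrow> real \<Rightarrow>
    real \<times> (nat \<Rightarrow> complex ^ 'm) \<Rightarrow> real \<times> (nat \<Rightarrow> complex ^ 'm)" where
  "shift_z r i w h = (\<lambda>(t, \<zeta>). (t, \<zeta>(r := shift_vec i w h (\<zeta> r))))"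

definition smooth_in_chart :: "('a, 'm::finite) chart set \<Rightarrow> nat \<Rightarrow> ('a, 'm) chart \<Rightarrow>
    (real \<times> 'a jet \<Rightarrow> complex) \<Rightarrow> bool" where
  "smooth_in_chart A k c F \<longleftrightarrow>
     smooth_along (insert shift_t {shift_z r i w |r i w. r \<le> k \<and> w \<in> {1, \<i>}})
       (UNIV \<times> coord c k ` chart_dom A k c) (local_expr A k c F)"

definition smooth_fun :: "('a, 'm::finite) chart set \<Rightarrow> nat \<Rightarrow> (real \<times> 'a jet \<Rightarrow> complex) \<Rightarrow> bool"
  where "smooth_fun A k F \<longleftrightarrow> (\<forall>c\<in>A. smooth_in_chart A k c F)"

definition d_t :: "('a, 'm::finite) chart set \<Rightarrow> nat \<Rightarrow> ('a, 'm) chart \<Rightarrow>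
    (real \<times> 'a jet \<Rightarrow> complex) \<Rightarrow> real \<times> 'a jet \<Rightarrow> complex" where
  "d_t A k c F = (\<lambda>(t, J). partial shift_t (local_expr A k c F) (t, coord c k J))"

definition d_z :: "('a, 'm::finite) chart set \<Rightarrow> nat \<Rightarrow> ('a, 'm) chart \<Rightarrow> nat \<Rightarrow> 'm \<Rightarrow>
    (real \<times> 'a jet \<Rightarrow> complex) \<Rightarrow> real \<times> 'a jet \<Rightarrow> complex" where
  "d_z A k c r i F = (\<lambda>(t, J). wirt (shift_z r i) (local_expr A k c F) (t, coord c k J))"

definition d_zbar :: "('a, 'm::finite) chart set \<Rightarrow> nat \<Rightarrow> ('a, 'm) chart \<Rightarrow> nat \<Rightarrow> 'm \<Rightarrow>
    (real \<times> 'a jet \<Rightarrow> complex) \<Rightarrow> real \<times> 'a jet \<Rightarrow> complex" where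
  "d_zbar A k c r i F = (\<lambda>(t, J). wirt_bar (shift_z r i) (local_expr A k c F) (t, coord c k J))"

section \<open>Lifts of functions\<close>

definition vlift :: "('a, 'm::finite) chart set \<Rightarrow> nat \<Rightarrow>
    (real \<times> 'a jet \<Rightarrow> complex) \<Rightarrow> real \<times> 'a jet \<Rightarrow> complex" where
  "vlift A k F = (\<lambda>(t, J). F (t, proj A k J))"

text \<open>
  The complete lift from order k to order k+1. The defining expression is the sum of t times the
  t-derivative and of the derivative in the direction of the velocity of J, so it does not depend
  on the chart around J, and an arbitrary one is chosen.
\<close>

definition clift :: "('a, 'm::finite) chart set \<Rightarrow> nat \<Rightarrow>
    (real \<times> 'a jet \<Rightarrow> complex) \<Rightarrow> real \<times> 'a jet \<Rightarrow> complex" where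
  "clift A k F = (\<lambda>(t, J).
     let c = (SOME c. c \<in> A \<and> J \<in> chart_dom A (Suc k) c);
         zdot = (\<lambda>r i. coord c (Suc k) J (Suc r) $ i)
     in of_real t * vlift A k (d_t A k c F) (t, J)
        + (\<Sum>r\<le>k. \<Sum>i\<in>UNIV. zdot r i * vlift A k (d_z A k c r i F) (t, J)
                         + cnj (zdot r i) * vlift A k (d_zbar A k c r i F) (t, J)))"

primrec vlift_iter :: "('a, 'm::finite) chart set \<Rightarrow> nat \<Rightarrow>
    (real \<times> 'a jet \<Rightarrow> complex) \<Rightarrow> real \<times> 'a jet \<Rightarrow> complex" where
  "vlift_iter A 0 f = f"
| "vlift_iter A (Suc k) f = vlift A k (vlift_iter A k f)"

primrec clift_iter :: "('a, 'm::finite) chart set \<Rightarrow> nat \<Rightarrow>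
    (real \<times> 'a jet \<Rightarrow> complex) \<Rightarrow> real \<times> 'a jet \<Rightarrow> complex" where
  "clift_iter A 0 f = f"
| "clift_iter A (Suc k) f = clift A k (clift_iter A k f)"

section \<open>Vector fields and their vertical lifts\<close>

text \<open>
  A (complexified) vector field is an operator on smooth functions which in every chart is a first
  order differential operator with smooth coefficients and no term of order zero.
\<close>

definition vector_field :: "('a, 'm::finite) chart set \<Rightarrow> nat \<Rightarrow>
    ((real \<times> 'a jet \<Rightarrow> complex) \<Rightarrow> real \<times> 'a jet \<Rightarrow> complex) \<Rightarrow> bool" where
  "vector_field A k D \<longleftrightarrow>
     (\<forall>c\<in>A. \<exists>a b b'. smooth_in_chart A k c a \<and>
        (\<forall>r\<le>k. \<forall>i. smooth_in_chart A k c (b r i) \<and> smooth_in_chart A k c (b' r i)) \<and>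
        (\<forall>F. smooth_fun A k F \<longrightarrow> (\<forall>t. \<forall>J\<in>chart_dom A k c.
           D F (t, J) = a (t, J) * d_t A k c F (t, J)
             + (\<Sum>r\<le>k. \<Sum>i\<in>UNIV. b r i (t, J) * d_z A k c r i F (t, J)
                              + b' r i (t, J) * d_zbar A k c r i F (t, J)))))"

text \<open>
  \<open>local_form A k D Y Y'\<close>: in each chart c of A,
  \<open>D = \<partial>/\<partial>t + (Y c i) \<partial>/\<partial>z\<^sup>k\<^sup>i + (Y' c i) \<partial>/\<partial>zbar\<^sup>k\<^sup>i\<close>, summed over i, where
  \<open>z\<^sup>k\<^sup>i\<close> are the coordinates of highest order.
\<close>

definition local_form :: "('a, 'm::finite) chart set \<Rightarrow> nat \<Rightarrow>
    ((real \<times> 'a jet \<Rightarrow> complex) \<Rightarrow> real \<times> 'a jet \<Rightarrow> complex) \<Rightarrow>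
    (('a, 'm) chart \<Rightarrow> 'm \<Rightarrow> real \<times> 'a jet \<Rightarrow> complex) \<Rightarrow>
    (('a, 'm) chart \<Rightarrow> 'm \<Rightarrow> real \<times> 'a jet \<Rightarrow> complex) \<Rightarrow> bool" where
  "local_form A k D Y Y' \<longleftrightarrow>
     (\<forall>c\<in>A. \<forall>F. smooth_fun A k F \<longrightarrow> (\<forall>t. \<forall>J\<in>chart_dom A k c.
        D F (t, J) = d_t A k c F (t, J)
          + (\<Sum>i\<in>UNIV. Y c i (t, J) * d_z A k c k i F (t, J)
                      + Y' c i (t, J) * d_zbar A k c k i F (t, J))))"

text \<open>\<open>lifts_on A k S Z W\<close>: the identity defining the vertical lift holds for the functions in S.\<close>

definition lifts_on :: "('a, 'm::finite) chart set \<Rightarrow> nat \<Rightarrow> (real \<times> 'a jet \<Rightarrow> complex) set \<Rightarrow>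
    ((real \<times> 'a jet \<Rightarrow> complex) \<Rightarrow> real \<times> 'a jet \<Rightarrow> complex) \<Rightarrow>
    ((real \<times> 'a jet \<Rightarrow> complex) \<Rightarrow> real \<times> 'a jet \<Rightarrow> complex) \<Rightarrow> bool" where
  "lifts_on A k S Z W \<longleftrightarrow>
     (\<forall>f\<in>S. \<forall>t. \<forall>J\<in>ext A k. W (clift_iter A k f) (t, J) = vlift_iter A k (Z f) (t, J))"

definition vertical_lift :: "('a, 'm::finite) chart set \<Rightarrow> nat \<Rightarrow>
    ((real \<times> 'a jet \<Rightarrow> complex) \<Rightarrow> real \<times> 'a jet \<Rightarrow> complex) \<Rightarrow>
    ((real \<times> 'a jet \<Rightarrow> complex) \<Rightarrow> real \<times> 'a jet \<Rightarrow> complex) \<Rightarrow> bool" where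
  "vertical_lift A k Z W \<longleftrightarrow> vector_field A k W \<and> lifts_on A k {f. smooth_fun A 0 f} Z W"

text \<open>
  For \<open>k \<ge> 1\<close> and Z with t-component 1, no W satisfies the defining identity for all
  functions on N: it gives W t = 1 for \<open>f = t\<close>, while for \<open>f = t\<^sup>2\<close> the (first) complete lift is
  \<open>2 t\<^sup>2\<close>, so that the identity reads 4 t = 2 t (in general, \<open>2\<^sup>k\<close> times 2 t = 2 t). The identity
  is consistent on the functions \<open>a t + g\<close> with a constant and g a function on M, and it already
  determines W there. \<open>vertical_lift_affine\<close> is the notion with this class of test functions.
\<close>

definition vertical_lift_affine :: "('a, 'm::finite) chart set \<Rightarrow> nat \<Rightarrow>
    ((real \<times> 'a jet \<Rightarrow> complex) \<Rightarrow> real \<times> 'a jet \<Rightarrow> complex) \<Rightarrow>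
    ((real \<times> 'a jet \<Rightarrow> complex) \<Rightarrow> real \<times> 'a jet \<Rightarrow> complex) \<Rightarrow> bool" where
  "vertical_lift_affine A k Z W \<longleftrightarrow> vector_field A k W \<and>
     lifts_on A k {f. smooth_fun A 0 f \<and> (\<exists>a g. f = (\<lambda>(t, J). a * of_real t + g J))} Z W"

end

theory Submission
  imports Defs "HOL-Real_Asymp.Real_Asymp"
begin

text \<open>
  In a chart let \<open>z\<^sup>r\<close>, \<open>r \<le> k\<close>, be the jet coordinates of the jet of a curve \<open>\<gamma>\<close>, that is, the
  derivatives at 0 of \<open>\<gamma>\<close> read in the chart. The complete lift differentiates along the velocity of
  the jet, so the k-fold complete lift of \<open>f = a t + g\<close>, with a constant and g a function on M,
  sends t and the jet of \<open>\<gamma>\<close> to \<open>a t\<close> plus the k-th derivative of \<open>g \<circ> \<gamma>\<close> at 0 (\<open>clift_iter_jet\<close>). By the chain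
  rule this derivative is a universal expression \<open>prolong k G\<close> in the jet coordinates, where G is g
  read in the chart. For k > 0 the coordinates of order k enter it only through the single term
  \<open>\<Sum> z\<^sup>k\<^sup>i \<partial>G/\<partial>z\<^sup>i\<close> and its conjugate, so that
  \<open>\<partial>(prolong k G)/\<partial>z\<^sup>k\<^sup>i\<close> is \<open>\<partial>G/\<partial>z\<^sup>i\<close> pulled back to order k (\<open>partial_prolong_top\<close>). Hence the operator
  \<open>V = \<partial>/\<partial>t + (Z\<^sup>0\<^sup>i)\<^sup>v \<partial>/\<partial>z\<^sup>k\<^sup>i + (Zbar\<^sup>0\<^sup>i)\<^sup>v \<partial>/\<partial>zbar\<^sup>k\<^sup>i\<close> maps the complete lift of f to the vertical
  lift of \<open>Z f\<close> (\<open>vlift_of_local_form\<close>), which is one half of the claim.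

  For the other half, a vector field W with the lifting property differs from V by a first order
  operator that annihilates the complete lifts of all \<open>a t + g\<close>, and one has to see that such an
  operator vanishes. The function t kills the t-component. Write \<open>\<beta>\<^sup>r\<^sub>i\<close> for the remaining
  coefficients and collect them into the polynomials \<open>B\<^sub>i(s) = \<Sum> \<beta>\<^sup>r\<^sub>i s\<^sup>r / r!\<close>, a variation of the
  Taylor curve \<open>\<gamma>\<close> of the jet. Annihilating the lift of g then means that the coefficient of \<open>s\<^sup>k\<close> in
  \<open>\<Sum> B\<^sub>i(s) (\<partial>g/\<partial>z\<^sup>i)(\<gamma>(s))\<close> is 0, the sum including the conjugate coordinates. Suppose that the
  l-th coordinate of \<open>\<gamma>\<close> has nonzero velocity at 0, and let u be this coordinate minus its value at 0,
  which vanishes to order exactly 1 along \<open>\<gamma>\<close>. Inserting \<open>g = u\<^sup>j\<^sup>+\<^sup>1\<close> for \<open>j = k, k-1, \<dots>, 0\<close> shows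
  successively that the coefficients of \<open>B\<^sub>l\<close> vanish; then \<open>g = w u\<^sup>j\<close>, with w any other coordinate or
  conjugate coordinate, gives the same for the rest (\<open>annihilator_trivial\<close>). Functions with prescribed
  local form exist on all of M thanks to smooth cutoff functions and the Hausdorff property
  (\<open>global_extension\<close>). Jets of nonzero velocity are dense among all jets and the coefficients of W are
  continuous, so the coefficients agree everywhere (\<open>eq_by_density\<close>). At jets of zero velocity this
  limiting argument cannot be avoided: on TM, for example, complete lifts do not see the horizontal
  components of a vector at the zero section.

  Smoothness is expressed by iterated partial derivatives along coordinate shifts, so the analytic
  input is a chain rule for functions with continuous partial derivatives along commuting flows
  (\<open>chain_rule\<close>). It serves for functions on \<open>\<complex>\<^sup>m\<close> and for functions of the jet coordinates alike.
\<close>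

section \<open>Smoothness along coordinate shifts\<close>

text \<open>
  Functions of class \<open>C\<^sup>n\<close>. Closure properties of smooth functions do not follow by a direct induction on
  lists of shifts, because a derivative of a product is a sum of products; they do follow by induction
  on n, for all functions of class \<open>C\<^sup>n\<close> at once.
\<close>

primrec Ck ::
  "(real \<Rightarrow> 'p \<Rightarrow> 'p) set \<Rightarrow> 'p::topological_space set \<Rightarrow> nat \<Rightarrow> ('p \<Rightarrow> complex) \<Rightarrow> bool" where
  "Ck \<Sigma> S 0 H = continuous_on S H"
| "Ck \<Sigma> S (Suc n) H = (continuous_on S H \<and>
     (\<forall>\<sigma>\<in>\<Sigma>. (\<forall>p\<in>S. (\<lambda>h. H (\<sigma> h p)) differentiable (at 0)) \<and> Ck \<Sigma> S n (partial \<sigma> H)))"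

lemma smooth_along_step:
  "smooth_along \<Sigma> S H \<longleftrightarrow> continuous_on S H \<and>
     (\<forall>\<sigma>\<in>\<Sigma>. (\<forall>p\<in>S. (\<lambda>h. H (\<sigma> h p)) differentiable (at 0)) \<and> smooth_along \<Sigma> S (partial \<sigma> H))"
proof
  assume H: "smooth_along \<Sigma> S H"
  have "smooth_along \<Sigma> S (partial \<sigma> H)" if "\<sigma> \<in> \<Sigma>" for \<sigma>
    unfolding smooth_along_def
  proof (intro allI impI)
    fix \<sigma>s assume "set \<sigma>s \<subseteq> \<Sigma>"
    then have "set (\<sigma> # \<sigma>s) \<subseteq> \<Sigma>" using that by simp
    from H[unfolded smooth_along_def, rule_format, OF this]
    show "continuous_on S (fold partial \<sigma>s (partial \<sigma> H)) \<and>
      (\<forall>\<tau>\<in>\<Sigma>. \<forall>p\<in>S. (\<lambda>h. fold partial \<sigma>s (partial \<sigma> H) (\<tau> h p)) differentiable (at 0))"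
      by simp
  qed
  moreover have "continuous_on S H" "\<forall>\<sigma>\<in>\<Sigma>. \<forall>p\<in>S. (\<lambda>h. H (\<sigma> h p)) differentiable (at 0)"
    using H[unfolded smooth_along_def] by (metis empty_set empty_subsetI fold_simps(1))+
  ultimately show "continuous_on S H \<and>
     (\<forall>\<sigma>\<in>\<Sigma>. (\<forall>p\<in>S. (\<lambda>h. H (\<sigma> h p)) differentiable (at 0)) \<and> smooth_along \<Sigma> S (partial \<sigma> H))"
    by blast
next
  assume R: "continuous_on S H \<and>
     (\<forall>\<sigma>\<in>\<Sigma>. (\<forall>p\<in>S. (\<lambda>h. H (\<sigma> h p)) differentiable (at 0)) \<and> smooth_along \<Sigma> S (partial \<sigma> H))"
  show "smooth_along \<Sigma> S H"
    unfolding smooth_along_def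
  proof (intro allI impI)
    fix \<sigma>s assume s: "set \<sigma>s \<subseteq> \<Sigma>"
    show "continuous_on S (fold partial \<sigma>s H) \<and>
      (\<forall>\<tau>\<in>\<Sigma>. \<forall>p\<in>S. (\<lambda>h. fold partial \<sigma>s H (\<tau> h p)) differentiable (at 0))"
    proof (cases \<sigma>s)
      case Nil
      then show ?thesis using R by simp
    next
      case (Cons \<sigma> \<sigma>s')
      then have "smooth_along \<Sigma> S (partial \<sigma> H)" "set \<sigma>s' \<subseteq> \<Sigma>" using R s by auto
      then show ?thesis unfolding Cons smooth_along_def by simp
    qed
  qed
qed

lemma smooth_along_continuous: "smooth_along \<Sigma> S H \<Longrightarrow> continuous_on S H"
  and smooth_along_differentiable:
    "smooth_along \<Sigma> S H \<Longrightarrow> \<sigma> \<in> \<Sigma> \<Longrightarrow> p \<in> S \<Longrightarrow> (\<lambda>h. H (\<sigma> h p)) differentiable (at 0)"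
  and smooth_along_partial: "smooth_along \<Sigma> S H \<Longrightarrow> \<sigma> \<in> \<Sigma> \<Longrightarrow> smooth_along \<Sigma> S (partial \<sigma> H)"
  by (subst (asm) smooth_along_step; blast)+

lemma smooth_along_iff_Ck: "smooth_along \<Sigma> S H \<longleftrightarrow> (\<forall>n. Ck \<Sigma> S n H)"
proof
  have "smooth_along \<Sigma> S H \<Longrightarrow> Ck \<Sigma> S n H" for n
    by (induction n arbitrary: H)
      (simp_all add: smooth_along_continuous smooth_along_differentiable smooth_along_partial)
  then show "smooth_along \<Sigma> S H \<Longrightarrow> \<forall>n. Ck \<Sigma> S n H" by blast
next
  assume C: "\<forall>n. Ck \<Sigma> S n H"
  have "set \<sigma>s \<subseteq> \<Sigma> \<Longrightarrow> \<forall>n. Ck \<Sigma> S n (fold partial \<sigma>s H)" for \<sigma>s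
    using C
  proof (induction \<sigma>s arbitrary: H)
    case (Cons \<sigma> \<sigma>s)
    have "\<forall>n. Ck \<Sigma> S n (partial \<sigma> H)"
    proof
      fix n from Cons.prems have "Ck \<Sigma> S (Suc n) H" "\<sigma> \<in> \<Sigma>" by (blast, simp)
      then show "Ck \<Sigma> S n (partial \<sigma> H)" by simp
    qed
    then show ?case using Cons by simp
  qed simp
  then have *: "set \<sigma>s \<subseteq> \<Sigma> \<Longrightarrow> Ck \<Sigma> S (Suc 0) (fold partial \<sigma>s H)" for \<sigma>s by blast
  show "smooth_along \<Sigma> S H"
    unfolding smooth_along_def using * by simp
qed

lemma smooth_along_mono:
  assumes "smooth_along \<Sigma> S H" "\<Sigma>' \<subseteq> \<Sigma>" "S' \<subseteq> S"
  shows "smooth_along \<Sigma>' S' H"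
  using assms unfolding smooth_along_def by (meson continuous_on_subset in_mono order_trans)

lemma Ck_SucD: "Ck \<Sigma> S (Suc n) H \<Longrightarrow> Ck \<Sigma> S n H"
  by (induction n arbitrary: H) auto

text \<open>
  Restriction to a slice: an embedding e that turns every shift into one of the shifts of the larger
  space commutes with partial derivatives.
\<close>

lemma smooth_along_pullback:
  assumes H: "smooth_along \<Sigma> S H" and e: "continuous_on S' e" "e ` S' \<subseteq> S"
    and sh: "\<And>\<sigma>. \<sigma> \<in> \<Sigma>' \<Longrightarrow> \<tau> \<sigma> \<in> \<Sigma>" "\<And>\<sigma> h q. \<sigma> \<in> \<Sigma>' \<Longrightarrow> e (\<sigma> h q) = \<tau> \<sigma> h (e q)"
  shows "smooth_along \<Sigma>' S' (\<lambda>q. H (e q))"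
proof -
  have "Ck \<Sigma> S n H \<Longrightarrow> Ck \<Sigma>' S' n (\<lambda>q. H (e q))" for n
  proof (induction n arbitrary: H)
    case 0
    then show ?case using e by (auto intro: continuous_on_compose2)
  next
    case (Suc n)
    have p: "partial \<sigma> (\<lambda>q. H (e q)) = (\<lambda>q. partial (\<tau> \<sigma>) H (e q))" if "\<sigma> \<in> \<Sigma>'" for \<sigma>
      using sh(2)[OF that] by (auto simp: partial_def fun_eq_iff)
    show ?case
      using Suc.prems e sh Suc.IH by (auto simp: p intro: continuous_on_compose2)
  qed
  then show ?thesis using H by (auto simp: smooth_along_iff_Ck)
qed

text \<open>
  S need not be open in the ambient topology. The image of a chart of the k-th extension is not: its
  entries of order above k are 0. It only has to be open in the directions of the shifts, which is
  what makes partial derivatives on S depend on values in S alone.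
\<close>

locale shift_domain =
  fixes \<Sigma> :: "(real \<Rightarrow> 'p::topological_space \<Rightarrow> 'p) set" and S :: "'p set"
  assumes shift_zero: "\<sigma> \<in> \<Sigma> \<Longrightarrow> \<sigma> 0 p = p"
    and shift_stays: "\<sigma> \<in> \<Sigma> \<Longrightarrow> p \<in> S \<Longrightarrow> \<forall>\<^sub>F h in nhds 0. \<sigma> h p \<in> S"
begin

lemma partial_works:
  "(\<lambda>h. H (\<sigma> h p)) differentiable (at 0) \<longleftrightarrow>
    ((\<lambda>h. H (\<sigma> h p)) has_vector_derivative partial \<sigma> H p) (at 0)"
  by (simp add: vector_derivative_works partial_def)

lemma partialI: "((\<lambda>h. H (\<sigma> h p)) has_vector_derivative D) (at 0) \<Longrightarrow> partial \<sigma> H p = D"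
  by (simp add: partial_def vector_derivative_at)

lemma
  assumes "\<sigma> \<in> \<Sigma>" "p \<in> S" and "\<And>q. q \<in> S \<Longrightarrow> H q = H' q"
  shows partial_eq: "partial \<sigma> H p = partial \<sigma> H' p"
    and differentiable_eq:
      "(\<lambda>h. H (\<sigma> h p)) differentiable (at 0) \<longleftrightarrow> (\<lambda>h. H' (\<sigma> h p)) differentiable (at 0)"
proof -
  have ev: "\<forall>\<^sub>F h in nhds 0. H (\<sigma> h p) = H' (\<sigma> h p)"
    using shift_stays[OF assms(1,2)] by eventually_elim (rule assms(3))
  then show eq: "partial \<sigma> H p = partial \<sigma> H' p"
    unfolding partial_def by (intro vector_derivative_cong_eq) (auto)
  show "(\<lambda>h. H (\<sigma> h p)) differentiable (at 0) \<longleftrightarrow> (\<lambda>h. H' (\<sigma> h p)) differentiable (at 0)"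
    unfolding partial_works eq
    using ev eventually_nhds_x_imp_x[OF ev] by (intro has_vector_derivative_cong_ev) (auto elim: eventually_mono)
qed

lemma Ck_cong:
  assumes "\<And>q. q \<in> S \<Longrightarrow> H q = H' q" "Ck \<Sigma> S n H"
  shows "Ck \<Sigma> S n H'"
  using assms
proof (induction n arbitrary: H H')
  case 0
  then show ?case by (auto cong: continuous_on_cong)
next
  case (Suc n)
  have "continuous_on S H'" using Suc.prems by (auto cong: continuous_on_cong)
  moreover have "Ck \<Sigma> S n (partial \<sigma> H')" if "\<sigma> \<in> \<Sigma>" for \<sigma>
  proof (rule Suc.IH)
    show "Ck \<Sigma> S n (partial \<sigma> H)" using Suc.prems(2) that by simp
    show "partial \<sigma> H q = partial \<sigma> H' q" if "q \<in> S" for q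
      using partial_eq[OF \<open>\<sigma> \<in> \<Sigma>\<close> that Suc.prems(1)] .
  qed
  moreover have "(\<lambda>h. H' (\<sigma> h p)) differentiable (at 0)" if "\<sigma> \<in> \<Sigma>" "p \<in> S" for \<sigma> p
    using Suc.prems differentiable_eq[OF that, of H H'] that by auto
  ultimately show ?case by simp
qed

lemma smooth_along_cong:
  "(\<And>q. q \<in> S \<Longrightarrow> H q = H' q) \<Longrightarrow> smooth_along \<Sigma> S H \<Longrightarrow> smooth_along \<Sigma> S H'"
  unfolding smooth_along_iff_Ck using Ck_cong by blast

text \<open>
  The derivatives may be computed in any form that is correct on S; outside S the functions \<open>D \<sigma>\<close> and
  \<open>partial \<sigma> H\<close> may differ.
\<close>

lemma Ck_SucI:
  assumes "continuous_on S H"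
    and "\<And>\<sigma> p. \<sigma> \<in> \<Sigma> \<Longrightarrow> p \<in> S \<Longrightarrow> ((\<lambda>h. H (\<sigma> h p)) has_vector_derivative D \<sigma> p) (at 0)"
    and "\<And>\<sigma>. \<sigma> \<in> \<Sigma> \<Longrightarrow> Ck \<Sigma> S n (D \<sigma>)"
  shows "Ck \<Sigma> S (Suc n) H"
proof -
  have "(\<lambda>h. H (\<sigma> h p)) differentiable (at 0)" if "\<sigma> \<in> \<Sigma>" "p \<in> S" for \<sigma> p
    using assms(2)[OF that] by (auto simp: differentiable_def has_vector_derivative_def)
  moreover have "Ck \<Sigma> S n (partial \<sigma> H)" if "\<sigma> \<in> \<Sigma>" for \<sigma>
  proof (rule Ck_cong[OF _ assms(3)[OF that]])
    show "D \<sigma> p = partial \<sigma> H p" if "p \<in> S" for p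
      by (rule sym, rule partialI) (rule assms(2)[OF \<open>\<sigma> \<in> \<Sigma>\<close> that])
  qed
  ultimately show ?thesis using assms(1) by simp
qed

lemma Ck_const: "Ck \<Sigma> S n (\<lambda>_. a)"
proof (induction n arbitrary: a)
  case (Suc n)
  show ?case by (rule Ck_SucI[where D = "\<lambda>_ _. 0"]) (auto intro: Suc)
qed simp

lemma Ck_SucE:
  assumes "Ck \<Sigma> S (Suc n) H"
  shows "continuous_on S H" "Ck \<Sigma> S n H" "\<sigma> \<in> \<Sigma> \<Longrightarrow> Ck \<Sigma> S n (partial \<sigma> H)"
    "\<sigma> \<in> \<Sigma> \<Longrightarrow> p \<in> S \<Longrightarrow> ((\<lambda>h. H (\<sigma> h p)) has_vector_derivative partial \<sigma> H p) (at 0)"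
  using assms Ck_SucD[OF assms] by (auto simp: partial_works)

lemma Ck_add: "Ck \<Sigma> S n H \<Longrightarrow> Ck \<Sigma> S n K \<Longrightarrow> Ck \<Sigma> S n (\<lambda>p. H p + K p)"
proof (induction n arbitrary: H K)
  case (Suc n)
  note H = Ck_SucE[OF Suc.prems(1)] and K = Ck_SucE[OF Suc.prems(2)]
  show ?case
    by (rule Ck_SucI[where D = "\<lambda>\<sigma> p. partial \<sigma> H p + partial \<sigma> K p"])
      (auto intro!: continuous_on_add derivative_intros Suc.IH H K)
qed (auto intro: continuous_on_add)

lemma Ck_mult: "Ck \<Sigma> S n H \<Longrightarrow> Ck \<Sigma> S n K \<Longrightarrow> Ck \<Sigma> S n (\<lambda>p. H p * K p)"
proof (induction n arbitrary: H K)
  case (Suc n)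
  note H = Ck_SucE[OF Suc.prems(1)] and K = Ck_SucE[OF Suc.prems(2)]
  show ?case
  proof (rule Ck_SucI[where D = "\<lambda>\<sigma> p. H p * partial \<sigma> K p + partial \<sigma> H p * K p"])
    fix \<sigma> p assume s: "\<sigma> \<in> \<Sigma>" "p \<in> S"
    show "((\<lambda>h. H (\<sigma> h p) * K (\<sigma> h p)) has_vector_derivative
        H p * partial \<sigma> K p + partial \<sigma> H p * K p) (at 0)"
      using has_vector_derivative_mult[OF H(4)[OF s] K(4)[OF s]] shift_zero[OF s(1)] by simp
  qed (auto intro!: continuous_on_mult Ck_add Suc.IH H K)
qed (auto intro: continuous_on_mult)

lemma Ck_cnj: "Ck \<Sigma> S n H \<Longrightarrow> Ck \<Sigma> S n (\<lambda>p. cnj (H p))"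
proof (induction n arbitrary: H)
  case (Suc n)
  note H = Ck_SucE[OF Suc.prems]
  show ?case
    by (rule Ck_SucI[where D = "\<lambda>\<sigma> p. cnj (partial \<sigma> H p)"])
      (auto intro!: continuous_on_cnj has_vector_derivative_cnj Suc.IH H)
qed (auto intro: continuous_on_cnj)

lemma smooth_const: "smooth_along \<Sigma> S (\<lambda>_. a)"
  and smooth_add: "smooth_along \<Sigma> S H \<Longrightarrow> smooth_along \<Sigma> S K \<Longrightarrow> smooth_along \<Sigma> S (\<lambda>p. H p + K p)"
  and smooth_mult: "smooth_along \<Sigma> S H \<Longrightarrow> smooth_along \<Sigma> S K \<Longrightarrow> smooth_along \<Sigma> S (\<lambda>p. H p * K p)"
  and smooth_cnj: "smooth_along \<Sigma> S H \<Longrightarrow> smooth_along \<Sigma> S (\<lambda>p. cnj (H p))"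
  by (auto simp: smooth_along_iff_Ck Ck_const intro: Ck_add Ck_mult Ck_cnj)

lemma smooth_sum:
  "(\<And>i. i \<in> I \<Longrightarrow> smooth_along \<Sigma> S (H i)) \<Longrightarrow> smooth_along \<Sigma> S (\<lambda>p. \<Sum>i\<in>I. H i p)"
  by (induction I rule: infinite_finite_induct) (auto intro: smooth_add smooth_const)

lemma smooth_power: "smooth_along \<Sigma> S H \<Longrightarrow> smooth_along \<Sigma> S (\<lambda>p. H p ^ n)"
  by (induction n) (auto intro: smooth_mult smooth_const)

lemma smooth_diff:
  assumes "smooth_along \<Sigma> S H" "smooth_along \<Sigma> S K"
  shows "smooth_along \<Sigma> S (\<lambda>p. H p - K p)"
proof -
  have "smooth_along \<Sigma> S (\<lambda>p. H p + (-1) * K p)"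
    by (intro smooth_add smooth_mult smooth_const assms)
  then show ?thesis by simp
qed

lemma smooth_Re:
  assumes "smooth_along \<Sigma> S H"
  shows "smooth_along \<Sigma> S (\<lambda>p. of_real (Re (H p)))"
proof -
  have "smooth_along \<Sigma> S (\<lambda>p. (H p + cnj (H p)) * (1/2))"
    by (intro smooth_add smooth_mult smooth_const smooth_cnj assms)
  moreover have "(H p + cnj (H p)) * (1/2) = of_real (Re (H p))" for p
    by (simp add: complex_eq_iff)
  ultimately show ?thesis by simp
qed

lemma smooth_Im:
  assumes "smooth_along \<Sigma> S H"
  shows "smooth_along \<Sigma> S (\<lambda>p. of_real (Im (H p)))"
proof -
  have "smooth_along \<Sigma> S (\<lambda>p. of_real (Re ((- \<i>) * H p)))"
    by (intro smooth_Re smooth_mult smooth_const assms)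
  then show ?thesis by simp
qed

lemma smooth_affine:
  assumes "continuous_on S H"
    and "\<And>\<sigma> p. \<sigma> \<in> \<Sigma> \<Longrightarrow> p \<in> S \<Longrightarrow> ((\<lambda>h. H (\<sigma> h p)) has_vector_derivative d \<sigma>) (at 0)"
  shows "smooth_along \<Sigma> S H"
proof -
  have "Ck \<Sigma> S n H" for n
  proof (cases n)
    case (Suc m)
    show ?thesis unfolding Suc
      by (rule Ck_SucI[where D = "\<lambda>\<sigma> _. d \<sigma>"]) (auto intro: assms Ck_const)
  qed (simp add: assms(1))
  then show ?thesis by (simp add: smooth_along_iff_Ck)
qed

end

section \<open>A flat function\<close>

text \<open>
  \<open>exp (-1/x) / x\<^sup>m\<close>, extended by 0. The factor \<open>x\<^sup>-\<^sup>m\<close> is carried along because the derivatives of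
  \<open>exp (-1/x)\<close> are linear combinations of these functions, which makes smoothness an induction.
\<close>

definition flat :: "nat \<Rightarrow> real \<Rightarrow> real" where
  "flat m x = (if x > 0 then exp (- inverse x) * inverse x ^ m else 0)"

lemma flat_deriv: "(flat m has_real_derivative flat (m + 2) x - m * flat (m + 1) x) (at x)"
proof -
  consider "x > 0" | "x < 0" | "x = 0" by linarith
  then show ?thesis
  proof cases
    case 1
    have "((\<lambda>x. exp (- inverse x) * inverse x ^ m) has_real_derivative
        flat (m + 2) x - m * flat (m + 1) x) (at x)"
      using 1 by (auto intro!: derivative_eq_intros simp: flat_def field_simps power2_eq_square)
        (cases m; simp add: field_simps)
    moreover have "\<forall>\<^sub>F y in nhds x. exp (- inverse y) * inverse y ^ m = flat m y"
      using eventually_nhds_in_open[of "{0<..}" x] 1 by (auto elim!: eventually_mono simp: flat_def)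
    ultimately show ?thesis by (subst DERIV_cong_ev[OF refl _ refl, symmetric]) auto
  next
    case 2
    have "\<forall>\<^sub>F y in nhds x. 0 = flat m y"
      using eventually_nhds_in_open[of "{..<0}" x] 2 by (auto elim!: eventually_mono simp: flat_def)
    moreover have "((\<lambda>x. 0) has_real_derivative flat (m + 2) x - m * flat (m + 1) x) (at x)"
      using 2 by (auto simp: flat_def)
    ultimately show ?thesis by (subst DERIV_cong_ev[OF refl _ refl, symmetric]) auto
  next
    case 3
    have "((\<lambda>y. (flat m y - flat m 0) / (y - 0)) \<longlongrightarrow> 0) (at 0)"
    proof (rule filterlim_split_at_real)
      show "((\<lambda>y. (flat m y - flat m 0) / (y - 0)) \<longlongrightarrow> 0) (at_left 0)"
        by (rule tendsto_eventually) (auto simp: eventually_at_filter flat_def)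
      have "((\<lambda>y::real. exp (- inverse y) * inverse y ^ Suc m) \<longlongrightarrow> 0) (at_right 0)"
        by real_asymp
      moreover have "\<forall>\<^sub>F y in at_right 0. exp (- inverse y) * inverse y ^ Suc m =
          (flat m y - flat m 0) / (y - 0)"
        by (auto simp: eventually_at_filter flat_def field_simps)
      ultimately show "((\<lambda>y. (flat m y - flat m 0) / (y - 0)) \<longlongrightarrow> 0) (at_right 0)"
        by (rule Lim_transform_eventually)
    qed
    then show ?thesis using 3 by (simp add: has_field_derivative_iff flat_def)
  qed
qed

lemma (in shift_domain) Ck_flat:
  assumes "\<And>p. p \<in> S \<Longrightarrow> P p = of_real (r p)"
  shows "Ck \<Sigma> S n P \<Longrightarrow> Ck \<Sigma> S n (\<lambda>p. of_real (flat m (r p)))"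
proof -
  have continuous: "continuous_on S (\<lambda>p. complex_of_real (flat m (r p)))" if "continuous_on S P" for m
  proof -
    have "isCont (flat m) x" for x using flat_deriv DERIV_isCont by blast
    then have "continuous_on UNIV (flat m)" by (simp add: continuous_on_eq_continuous_at)
    moreover have "continuous_on S (\<lambda>p. Re (P p))" using that by (auto intro: continuous_intros)
    then have "continuous_on S r" using assms by (auto cong: continuous_on_cong)
    ultimately show ?thesis by (auto intro!: continuous_on_of_real intro: continuous_on_compose2)
  qed
  show "Ck \<Sigma> S n P \<Longrightarrow> Ck \<Sigma> S n (\<lambda>p. of_real (flat m (r p)))"
  proof (induction n arbitrary: m)
    case 0
    then show ?case using continuous by simp
  next
    case (Suc n)
    note P = Ck_SucE[OF Suc.prems]
    show ?case
    proof (rule Ck_SucI[where D = "\<lambda>\<sigma> p. (of_real (flat (m+2) (r p)) + (- of_nat m) * of_real (flat (m+1) (r p))) * partial \<sigma> P p"])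
      show "continuous_on S (\<lambda>p. complex_of_real (flat m (r p)))" by (rule continuous[OF P(1)])
    next
      fix \<sigma> p assume s: "\<sigma> \<in> \<Sigma>" "p \<in> S"
      have ev: "\<forall>\<^sub>F h in nhds 0. P (\<sigma> h p) = of_real (r (\<sigma> h p))"
        using shift_stays[OF s] by eventually_elim (rule assms)
      then have d: "((\<lambda>h. complex_of_real (r (\<sigma> h p))) has_vector_derivative partial \<sigma> P p) (at 0)"
        using P(4)[OF s] eventually_nhds_x_imp_x[OF ev]
        by (subst has_vector_derivative_cong_ev[where g = "\<lambda>h. P (\<sigma> h p)"])
          (auto elim!: eventually_mono)
      have dr: "((\<lambda>h. r (\<sigma> h p)) has_real_derivative Re (partial \<sigma> P p)) (at 0)"
        using bounded_linear.has_vector_derivative[OF bounded_linear_Re d]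
        by (simp add: has_real_derivative_iff_has_vector_derivative)
      have "((\<lambda>h. complex_of_real (r (\<sigma> h p))) has_vector_derivative of_real (Re (partial \<sigma> P p))) (at 0)"
        using dr by (intro has_vector_derivative_of_real)
      then have re: "partial \<sigma> P p = of_real (Re (partial \<sigma> P p))"
        using d vector_derivative_unique_at by blast
      have "((\<lambda>h. flat m (r (\<sigma> h p))) has_real_derivative
          (flat (m + 2) (r p) - m * flat (m + 1) (r p)) * Re (partial \<sigma> P p)) (at 0)"
        using DERIV_chain2[OF flat_deriv dr, of m] shift_zero[OF s(1)] by simp
      from has_vector_derivative_of_real[OF this]
      have "((\<lambda>h. complex_of_real (flat m (r (\<sigma> h p)))) has_vector_derivative
        of_real ((flat (m + 2) (r p) - m * flat (m + 1) (r p)) * Re (partial \<sigma> P p))) (at 0)" .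
      then show "((\<lambda>h. complex_of_real (flat m (r (\<sigma> h p)))) has_vector_derivative
        (of_real (flat (m+2) (r p)) + (- of_nat m) * of_real (flat (m+1) (r p))) * partial \<sigma> P p) (at 0)"
        by (subst re) simp
    qed (intro Ck_mult Ck_add Ck_const Suc.IH P; assumption?)
  qed
qed

lemma (in shift_domain) smooth_flat:
  assumes "smooth_along \<Sigma> S (\<lambda>p. of_real (r p))"
  shows "smooth_along \<Sigma> S (\<lambda>p. of_real (flat m (r p)))"
  using assms Ck_flat[of "\<lambda>p. of_real (r p)" r] by (simp add: smooth_along_iff_Ck)

section \<open>The chain rule along flows\<close>

definition flow :: "(real \<Rightarrow> 'p::topological_space \<Rightarrow> 'p) \<Rightarrow> bool" where
  "flow \<sigma> \<longleftrightarrow> (\<forall>p. \<sigma> 0 p = p) \<and> (\<forall>h h' p. \<sigma> (h + h') p = \<sigma> h (\<sigma> h' p)) \<and>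
     continuous_on UNIV (\<lambda>(h, p). \<sigma> h p)"

lemma continuous_on_open_tendsto_nhds:
  assumes "continuous_on S f" "open S" "x \<in> S"
  shows "(f \<longlongrightarrow> f x) (nhds x)"
proof -
  have "(f \<longlongrightarrow> f x) (at x)"
    using assms unfolding continuous_on_def by (metis at_within_open)
  then show ?thesis by (rule tendsto_at_iff_tendsto_nhds[THEN iffD1])
qed

lemma flow_tendsto:
  assumes "flow \<sigma>" "(e \<longlongrightarrow> h) F" "(q \<longlongrightarrow> p) F"
  shows "((\<lambda>s. \<sigma> (e s) (q s)) \<longlongrightarrow> \<sigma> h p) F"
proof -
  have "continuous_on UNIV (\<lambda>(h, p). \<sigma> h p)" using assms(1) by (simp add: flow_def)
  from filterlim_compose[OF continuous_on_open_tendsto_nhds[OF this, of "(h, p)"] tendsto_Pair[OF assms(2,3)]]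
  have "((\<lambda>s. (\<lambda>(h, p). \<sigma> h p) (e s, q s)) \<longlongrightarrow> (\<lambda>(h, p). \<sigma> h p) (h, p)) F"
    by simp
  then show ?thesis by simp
qed

lemma shift_domain_flow:
  assumes "\<And>\<sigma>. \<sigma> \<in> \<Sigma> \<Longrightarrow> flow \<sigma>" "open S"
  shows "shift_domain \<Sigma> S"
proof
  show "\<sigma> \<in> \<Sigma> \<Longrightarrow> \<sigma> 0 p = p" for \<sigma> p using assms(1) by (auto simp: flow_def)
  fix \<sigma> p assume s: "\<sigma> \<in> \<Sigma>" "p \<in> S"
  have "((\<lambda>h. \<sigma> h p) \<longlongrightarrow> \<sigma> 0 p) (nhds 0)"
    using flow_tendsto[OF assms(1)[OF s(1)], of "\<lambda>h. h" 0 "nhds 0" "\<lambda>_. p" p] by (simp add: filterlim_ident)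
  then have "((\<lambda>h. \<sigma> h p) \<longlongrightarrow> p) (nhds 0)" using assms(1)[OF s(1)] by (simp add: flow_def)
  then show "\<forall>\<^sub>F h in nhds 0. \<sigma> h p \<in> S"
    using assms(2) s(2) by (auto dest: topological_tendstoD)
qed

lemma flow_derivative:
  assumes f: "flow \<sigma>" and d: "(\<lambda>h. H (\<sigma> h (\<sigma> x q))) differentiable (at 0)"
  shows "((\<lambda>h. H (\<sigma> h q)) has_vector_derivative partial \<sigma> H (\<sigma> x q)) (at x)"
proof -
  have "((\<lambda>h. H (\<sigma> h (\<sigma> x q))) has_vector_derivative partial \<sigma> H (\<sigma> x q)) (at 0)"
    using d by (simp add: vector_derivative_works partial_def)
  then have "((\<lambda>h. H (\<sigma> h (\<sigma> x q))) has_vector_derivative partial \<sigma> H (\<sigma> x q)) (at (x - x))"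
    by simp
  moreover have "((\<lambda>h. h - x) has_vector_derivative 1) (at x)"
    by (auto intro!: derivative_eq_intros)
  ultimately have "((\<lambda>h. H (\<sigma> (h - x) (\<sigma> x q))) has_vector_derivative partial \<sigma> H (\<sigma> x q)) (at x)"
    using vector_diff_chain_at[of "\<lambda>h. h - x" 1 x "\<lambda>h. H (\<sigma> h (\<sigma> x q))"] by (simp add: o_def)
  moreover have "\<sigma> (h - x) (\<sigma> x q) = \<sigma> h q" for h
    using f unfolding flow_def by (metis diff_add_cancel)
  ultimately show ?thesis by simp
qed

text \<open>
  One step of the telescoping argument: if H is differentiable along a curve q, then it is so along the
  curve obtained by moving \<open>q u\<close> by \<open>e u\<close> along one more flow. By the mean value inequality
  the increment caused by the flow differs from \<open>e u\<close> times \<open>partial \<sigma> H p\<close> by at most \<open>\<bar>e u\<bar>\<close> times the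
  oscillation of \<open>partial \<sigma> H\<close> near p, which tends to 0.
\<close>

lemma chain_rule_step:
  assumes f: "flow \<sigma>" and S: "open S" "p \<in> S"
    and H: "\<And>q. q \<in> S \<Longrightarrow> (\<lambda>h. H (\<sigma> h q)) differentiable (at 0)" "continuous_on S (partial \<sigma> H)"
    and q: "(q \<longlongrightarrow> p) (at s)" "q s = p"
    and e: "e s = 0" "(e has_real_derivative e') (at s)"
    and D: "((\<lambda>u. H (q u)) has_vector_derivative D) (at s)"
  shows "((\<lambda>u. H (\<sigma> (e u) (q u))) has_vector_derivative D + e' *\<^sub>R partial \<sigma> H p) (at s)"
proof -
  define A where "A = partial \<sigma> H p"
  define R where "R u = H (\<sigma> (e u) (q u)) - H (q u) - e u *\<^sub>R A" for u
  have R0: "R s = 0" using e(1) f by (simp add: R_def flow_def)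
  have small: "\<forall>\<^sub>F u in nhds s. norm (R u) \<le> \<epsilon> * \<bar>e u\<bar>" if "\<epsilon> > 0" for \<epsilon>
  proof -
    have tA: "(partial \<sigma> H \<longlongrightarrow> A) (nhds p)"
      unfolding A_def by (rule continuous_on_open_tendsto_nhds[OF H(2) S])
    have "((\<lambda>(h, x). \<sigma> h x) \<longlongrightarrow> p) (nhds 0 \<times>\<^sub>F nhds p)"
      using flow_tendsto[OF f filterlim_fst filterlim_snd, of 0 p] f
      by (simp add: flow_def case_prod_unfold)
    moreover have "\<forall>\<^sub>F x in nhds p. x \<in> S \<and> dist (partial \<sigma> H x) A < \<epsilon>"
      using tA that S by (auto intro!: eventually_conj eventually_nhds_in_open dest: tendstoD)
    ultimately have "\<forall>\<^sub>F (h, x) in nhds 0 \<times>\<^sub>F nhds p. \<sigma> h x \<in> S \<and> dist (partial \<sigma> H (\<sigma> h x)) A < \<epsilon>"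
      unfolding filterlim_iff case_prod_unfold by blast
    then obtain P Q where PQ: "eventually P (nhds 0)" "eventually Q (nhds p)"
      "\<And>h x. P h \<Longrightarrow> Q x \<Longrightarrow> \<sigma> h x \<in> S \<and> dist (partial \<sigma> H (\<sigma> h x)) A < \<epsilon>"
      unfolding eventually_prod_filter by auto
    \<comment> \<open>A neighbourhood of \<open>(0, p)\<close> makes the estimate uniform along the whole segment from 0 to \<open>e u\<close>.\<close>
    from PQ(1) obtain \<eta> where \<eta>: "\<eta> > 0" "\<And>h. \<bar>h\<bar> < \<eta> \<Longrightarrow> P h"
      unfolding eventually_nhds_metric by (auto simp: dist_real_def)
    have te: "(e \<longlongrightarrow> 0) (nhds s)"
      using DERIV_isCont[OF e(2)] e(1) tendsto_at_iff_tendsto_nhds[of e s] by (simp add: isCont_def)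
    have tq: "(q \<longlongrightarrow> p) (nhds s)"
      using q tendsto_at_iff_tendsto_nhds[of q s] by simp
    have "\<forall>\<^sub>F u in nhds s. \<bar>e u\<bar> < \<eta>" using tendstoD[OF te \<eta>(1)] by simp
    moreover have "\<forall>\<^sub>F u in nhds s. Q (q u)" using tq PQ(2) by (auto simp: filterlim_iff)
    ultimately show ?thesis
    proof eventually_elim
      case (elim u)
      \<comment> \<open>Subtracting the linear part leaves a function of h with derivative of norm at most \<open>\<epsilon>\<close>.\<close>
      define g where "g h = H (\<sigma> h (q u)) - h *\<^sub>R A" for h
      have P': "\<sigma> h (q u) \<in> S \<and> dist (partial \<sigma> H (\<sigma> h (q u))) A < \<epsilon>" if "h \<in> closed_segment 0 (e u)" for h
      proof -
        have "\<bar>h\<bar> \<le> \<bar>e u\<bar>" using that by (auto simp: closed_segment_eq_real_ivl split: if_splits)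
        then show ?thesis using PQ(3) \<eta>(2) elim by auto
      qed
      have "norm (g (e u) - g 0) \<le> \<epsilon> * norm (e u - 0)"
      proof (rule differentiable_bound)
        show "convex (closed_segment 0 (e u))" by simp
        fix h assume h: "h \<in> closed_segment 0 (e u)"
        have "((\<lambda>h. H (\<sigma> h (q u))) has_vector_derivative partial \<sigma> H (\<sigma> h (q u))) (at h)"
          using flow_derivative[OF f] H(1) P'[OF h] by auto
        then have "(g has_vector_derivative partial \<sigma> H (\<sigma> h (q u)) - A) (at h)"
          unfolding g_def by (auto intro!: derivative_eq_intros)
        then show "(g has_derivative (\<lambda>x. x *\<^sub>R (partial \<sigma> H (\<sigma> h (q u)) - A))) (at h within closed_segment 0 (e u))"
          unfolding has_vector_derivative_def by (rule has_derivative_at_withinI)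
        show "onorm (\<lambda>x::real. x *\<^sub>R (partial \<sigma> H (\<sigma> h (q u)) - A)) \<le> \<epsilon>"
          using P'[OF h] by (intro onorm_le) (auto simp: dist_norm mult.commute[of _ \<epsilon>] mult.commute[of _ "cmod _"] intro!: mult_right_mono)
      qed auto
      moreover have "g (e u) - g 0 = R u"
        using f by (simp add: g_def R_def flow_def)
      ultimately show ?case by simp
    qed
  qed
  obtain B where B: "B > 0" "\<forall>\<^sub>F u in nhds s. \<bar>e u\<bar> \<le> B * \<bar>u - s\<bar>"
  proof -
    have "((\<lambda>u. e u / (u - s)) \<longlongrightarrow> e') (at s)"
      using e by (simp add: has_field_derivative_iff)
    from tendstoD[OF this, of 1] have "\<forall>\<^sub>F u in at s. dist (e u / (u - s)) e' < 1" by simp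
    then have "\<forall>\<^sub>F u in at s. \<bar>e u\<bar> \<le> (\<bar>e'\<bar> + 1) * \<bar>u - s\<bar>"
    proof (rule eventually_mono[OF eventually_conj[OF _ eventually_at_ball'[of 1 s UNIV]]])
      fix u assume "dist (e u / (u - s)) e' < 1 \<and> u \<in> ball s 1 \<and> u \<noteq> s \<and> u \<in> UNIV"
      then have u: "\<bar>e u / (u - s) - e'\<bar> < 1" "u \<noteq> s" by (auto simp: dist_real_def)
      then have "\<bar>e u / (u - s)\<bar> \<le> \<bar>e'\<bar> + 1" by linarith
      then show "\<bar>e u\<bar> \<le> (\<bar>e'\<bar> + 1) * \<bar>u - s\<bar>" using u(2) by (simp add: abs_divide field_simps)
    qed auto
    then have "\<forall>\<^sub>F u in nhds s. \<bar>e u\<bar> \<le> (\<bar>e'\<bar> + 1) * \<bar>u - s\<bar>"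
      unfolding eventually_at_filter by (rule eventually_mono) (use e(1) in auto)
    then show ?thesis by (rule that[rotated]) auto
  qed
  have "(R has_vector_derivative 0) (at s)"
    unfolding has_vector_derivative_def has_derivative_at_alt
  proof (intro conjI allI impI)
    fix \<epsilon> :: real assume "\<epsilon> > 0"
    then have "\<epsilon> / B > 0" using B(1) by simp
    from eventually_conj[OF small[OF this] B(2)]
    have "\<forall>\<^sub>F u in nhds s. norm (R u) \<le> \<epsilon> * norm (u - s)"
    proof (rule eventually_mono)
      fix u assume u: "norm (R u) \<le> \<epsilon> / B * \<bar>e u\<bar> \<and> \<bar>e u\<bar> \<le> B * \<bar>u - s\<bar>"
      then have "\<epsilon> / B * \<bar>e u\<bar> \<le> \<epsilon> / B * (B * \<bar>u - s\<bar>)"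
        using \<open>\<epsilon> / B > 0\<close> by (intro mult_left_mono) auto
      then show "norm (R u) \<le> \<epsilon> * norm (u - s)" using u B(1) by simp
    qed
    then obtain d where "d > 0" "\<And>u. dist u s < d \<Longrightarrow> norm (R u) \<le> \<epsilon> * norm (u - s)"
      unfolding eventually_nhds_metric by blast
    then show "\<exists>d>0. \<forall>y. norm (y - s) < d \<longrightarrow> norm (R y - R s - (y - s) *\<^sub>R 0) \<le> \<epsilon> * norm (y - s)"
      using R0 by (intro exI[of _ d]) (auto simp: dist_norm)
  qed auto
  from has_vector_derivative_add[OF has_vector_derivative_add[OF D this]
      has_vector_derivative_scaleR[OF e(2) has_vector_derivative_const[of A]]]
  have "((\<lambda>u. H (q u) + R u + e u *\<^sub>R A) has_vector_derivative D + 0 + (e s *\<^sub>R 0 + e' *\<^sub>R A)) (at s)" .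
  then show ?thesis by (simp add: R_def A_def)
qed

text \<open>
  Continuous partial derivatives suffice for the chain rule. The space has no linear structure here:
  \<open>\<Psi>\<close> is a parametrisation by finitely many real coordinates, in which each flow translates one coordinate,
  and the coordinates of the curve are released from their value at s one after the other.
\<close>

theorem chain_rule:
  fixes \<Psi> :: "('j \<Rightarrow> real) \<Rightarrow> 'p::topological_space" and d :: "real \<Rightarrow> 'j \<Rightarrow> real"
  assumes J: "finite J" and f: "\<And>j. j \<in> J \<Longrightarrow> flow (\<sigma> j)"
    and \<Psi>: "\<And>j x h. j \<in> J \<Longrightarrow> \<Psi> (x(j := x j + h)) = \<sigma> j h (\<Psi> x)"
    and S: "open S" "\<Psi> (d s) \<in> S"
    and H: "\<And>j q. j \<in> J \<Longrightarrow> q \<in> S \<Longrightarrow> (\<lambda>h. H (\<sigma> j h q)) differentiable (at 0)"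
      "\<And>j. j \<in> J \<Longrightarrow> continuous_on S (partial (\<sigma> j) H)"
    and d: "\<And>j. j \<in> J \<Longrightarrow> ((\<lambda>u. d u j) has_real_derivative d' j) (at s)"
      "\<And>u j. j \<notin> J \<Longrightarrow> d u j = d s j"
  shows "((\<lambda>u. H (\<Psi> (d u))) has_vector_derivative
     (\<Sum>j\<in>J. d' j *\<^sub>R partial (\<sigma> j) H (\<Psi> (d s)))) (at s)"
proof -
  define q where "q F u = \<Psi> (\<lambda>j. if j \<in> F then d u j else d s j)" for F u
  have qs: "q F s = \<Psi> (d s)" for F by (simp add: q_def)
  have "((q F) \<longlongrightarrow> \<Psi> (d s)) (at s) \<and> ((\<lambda>u. H (q F u)) has_vector_derivative
     (\<Sum>j\<in>F. d' j *\<^sub>R partial (\<sigma> j) H (\<Psi> (d s)))) (at s)" if "F \<subseteq> J" for F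
    using finite_subset[OF that J] that
  proof (induction F rule: finite_induct)
    case empty
    have "q {} = (\<lambda>_. \<Psi> (d s))" by (simp add: q_def fun_eq_iff)
    then show ?case by simp
  next
    case (insert j F)
    then have j: "j \<in> J" and IH: "((q F) \<longlongrightarrow> \<Psi> (d s)) (at s)" "((\<lambda>u. H (q F u)) has_vector_derivative
     (\<Sum>j\<in>F. d' j *\<^sub>R partial (\<sigma> j) H (\<Psi> (d s)))) (at s)" by auto
    have e: "((\<lambda>u. d u j - d s j) has_real_derivative d' j) (at s)"
      using d(1)[OF j] by (auto intro!: derivative_eq_intros)
    have eq: "q (insert j F) = (\<lambda>u. \<sigma> j (d u j - d s j) (q F u))"
    proof
      fix u
      have *: "(\<lambda>i. if i \<in> insert j F then d u i else d s i) =
        (\<lambda>i. if i \<in> F then d u i else d s i)(j := (\<lambda>i. if i \<in> F then d u i else d s i) j + (d u j - d s j))"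
        using insert by auto
      show "q (insert j F) u = \<sigma> j (d u j - d s j) (q F u)"
        unfolding q_def[of "insert j F"] * q_def[of F] by (rule \<Psi>[OF j])
    qed
    have "(q (insert j F) \<longlongrightarrow> \<Psi> (d s)) (at s)"
    proof -
      have "((\<lambda>u. d u j - d s j) \<longlongrightarrow> 0) (at s)" using DERIV_isCont[OF e] by (simp add: isCont_def)
      then have "((\<lambda>u. \<sigma> j (d u j - d s j) (q F u)) \<longlongrightarrow> \<sigma> j 0 (\<Psi> (d s))) (at s)"
        by (rule flow_tendsto[OF f[OF j] _ IH(1)])
      then show ?thesis using f[OF j] unfolding eq by (simp add: flow_def)
    qed
    moreover have "((\<lambda>u. H (q (insert j F) u)) has_vector_derivative
     (\<Sum>j\<in>F. d' j *\<^sub>R partial (\<sigma> j) H (\<Psi> (d s))) + d' j *\<^sub>R partial (\<sigma> j) H (\<Psi> (d s))) (at s)"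
      unfolding eq
      by (rule chain_rule_step[OF f[OF j] S H(1)[OF j] H(2)[OF j] IH(1) qs _ e IH(2)]) auto
    ultimately show ?case using insert by (simp add: add.commute)
  qed
  from this[of J] have "((\<lambda>u. H (q J u)) has_vector_derivative
     (\<Sum>j\<in>J. d' j *\<^sub>R partial (\<sigma> j) H (\<Psi> (d s)))) (at s)" by blast
  moreover have "q J u = \<Psi> (d u)" for u
    unfolding q_def by (rule arg_cong[of _ _ \<Psi>]) (auto simp: d(2)[symmetric])
  ultimately show ?thesis by simp
qed

section \<open>Functions on complex coordinate space and on jet coordinates\<close>

abbreviation vec_shifts :: "(real \<Rightarrow> complex ^ 'm \<Rightarrow> complex ^ 'm) set" where
  "vec_shifts \<equiv> {shift_vec i w |i w. w \<in> {1, \<i>}}"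

abbreviation jet_shifts ::
  "(real \<Rightarrow> real \<times> (nat \<Rightarrow> complex ^ 'm::finite) \<Rightarrow> real \<times> (nat \<Rightarrow> complex ^ 'm)) set" where
  "jet_shifts \<equiv> insert shift_t {shift_z r i w |r i w. w \<in> {1, \<i>}}"

lemma shift_vec_nth: "shift_vec i w h x $ j = x $ j + (if j = i then w * of_real h else 0)"
  by (simp add: shift_vec_def axis_def)

lemma shift_z_simps [simp]:
  "fst (shift_z r i w h p) = fst p"
  "snd (shift_z r i w h p) = (snd p)(r := shift_vec i w h (snd p r))"
  by (auto simp: shift_z_def split: prod.splits)

lemma shift_t_simps [simp]: "fst (shift_t h p) = fst p + h" "snd (shift_t h p) = snd p"
  by (auto simp: shift_t_def split: prod.splits)

lemma continuous_on_jet_coordinate: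
  "continuous_on S f \<Longrightarrow> continuous_on S (\<lambda>x. snd (f x) n)"
  by (rule continuous_on_product_then_coordinatewise) (rule continuous_on_snd)

lemma continuous_shift_vec:
  assumes "continuous_on S h" "continuous_on S f"
  shows "continuous_on S (\<lambda>x. shift_vec i w (h x) (f x :: complex ^ 'm::finite))"
proof -
  have "shift_vec i w (h x) (f x) = (\<chi> j. f x $ j + (if j = i then w else 0) * of_real (h x))" for x
    by (auto simp: vec_eq_iff shift_vec_nth)
  then show ?thesis using assms by (auto intro!: continuous_intros)
qed

lemma flow_shift_vec: "flow (shift_vec i w :: real \<Rightarrow> complex ^ 'm::finite \<Rightarrow> _)"
  unfolding flow_def
  by (auto simp: vec_eq_iff shift_vec_nth algebra_simps case_prod_unfold
      intro!: continuous_shift_vec continuous_intros)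

lemma flow_shift_t: "flow (shift_t :: real \<Rightarrow> real \<times> (nat \<Rightarrow> complex ^ 'm::finite) \<Rightarrow> _)"
  unfolding flow_def
proof (intro conjI allI)
  have "(\<lambda>(h, p). shift_t h p :: real \<times> (nat \<Rightarrow> complex ^ 'm)) =
      (\<lambda>x. (fst (snd x) + fst x, snd (snd x)))"
    by (auto simp: shift_t_def fun_eq_iff)
  then show "continuous_on UNIV (\<lambda>(h, p). shift_t h p :: real \<times> (nat \<Rightarrow> complex ^ 'm))"
    by (simp add: continuous_on_Pair continuous_on_add continuous_on_fst continuous_on_snd)
qed (auto simp: shift_t_def split: prod.splits)

lemma flow_shift_z: "flow (shift_z r i w :: real \<Rightarrow> real \<times> (nat \<Rightarrow> complex ^ 'm::finite) \<Rightarrow> _)"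
  unfolding flow_def
proof (intro conjI allI)
  have eq: "(\<lambda>(h, p). shift_z r i w h p :: real \<times> (nat \<Rightarrow> complex ^ 'm)) =
      (\<lambda>x. (fst (snd x), \<lambda>n. if n = r then shift_vec i w (fst x) (snd (snd x) r) else snd (snd x) n))"
    by (auto simp: shift_z_def fun_eq_iff)
  have "continuous_on UNIV (\<lambda>x :: real \<times> real \<times> (nat \<Rightarrow> complex ^ 'm).
      if n = r then shift_vec i w (fst x) (snd (snd x) r) else snd (snd x) n)" for n
    by (cases "n = r")
      (simp_all add: continuous_shift_vec continuous_on_fst continuous_on_snd
        continuous_on_jet_coordinate)
  then show "continuous_on UNIV (\<lambda>(h, p). shift_z r i w h p :: real \<times> (nat \<Rightarrow> complex ^ 'm))"
    unfolding eq
    by (intro continuous_on_Pair continuous_on_coordinatewise_then_product)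
      (auto intro!: continuous_intros)
next
  fix p :: "real \<times> (nat \<Rightarrow> complex ^ 'm)" and h h'
  show "shift_z r i w 0 p = p" using flow_shift_vec[of i w]
    by (auto simp: prod_eq_iff flow_def)
  show "shift_z r i w (h + h') p = shift_z r i w h (shift_z r i w h' p)"
    using flow_shift_vec[of i w] by (auto simp: prod_eq_iff flow_def)
qed

lemma shift_domain_vec: "open V \<Longrightarrow> shift_domain vec_shifts (V :: (complex ^ 'm::finite) set)"
  by (rule shift_domain_flow) (auto intro: flow_shift_vec)

lemma open_over: "open V \<Longrightarrow> open {(t::real, \<zeta> :: nat \<Rightarrow> complex ^ 'm::finite). \<zeta> 0 \<in> V}"
proof -
  assume "open V"
  then have "open ((\<lambda>p :: real \<times> (nat \<Rightarrow> complex ^ 'm). snd p 0) -` V)"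
    by (rule open_vimage) (rule continuous_on_jet_coordinate[OF continuous_on_id])
  then show ?thesis by (simp add: vimage_def case_prod_unfold)
qed

lemma shift_domain_jet:
  "open V \<Longrightarrow> shift_domain jet_shifts {(t, \<zeta> :: nat \<Rightarrow> complex ^ 'm::finite). \<zeta> 0 \<in> V}"
  by (rule shift_domain_flow) (auto intro: flow_shift_z flow_shift_t open_over)

lemma sum_UNIV_bool: "(\<Sum>b\<in>UNIV. f b) = f False + f True"
  by (simp add: UNIV_bool)

lemma has_vector_derivative_Re:
  "(f has_vector_derivative D) F \<Longrightarrow> ((\<lambda>x. Re (f x)) has_vector_derivative Re D) F"
  by (rule bounded_linear.has_vector_derivative[OF bounded_linear_Re])

lemma has_vector_derivative_Im:
  "(f has_vector_derivative D) F \<Longrightarrow> ((\<lambda>x. Im (f x)) has_vector_derivative Im D) F"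
  by (rule bounded_linear.has_vector_derivative[OF bounded_linear_Im])

lemma chain_rule_vec:
  fixes c :: "real \<Rightarrow> complex ^ 'm::finite"
  assumes V: "open V" "c s \<in> V"
    and H: "\<And>\<sigma> q. \<sigma> \<in> vec_shifts \<Longrightarrow> q \<in> V \<Longrightarrow> (\<lambda>h. H (\<sigma> h q)) differentiable (at 0)"
      "\<And>\<sigma>. \<sigma> \<in> vec_shifts \<Longrightarrow> continuous_on V (partial \<sigma> H)"
    and c: "\<And>i. ((\<lambda>u. c u $ i) has_vector_derivative c' i) (at s)"
  shows "((\<lambda>u. H (c u)) has_vector_derivative
     (\<Sum>i\<in>UNIV. of_real (Re (c' i)) * partial (shift_vec i 1) H (c s)
              + of_real (Im (c' i)) * partial (shift_vec i \<i>) H (c s))) (at s)"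
proof -
  define \<sigma> :: "'m \<times> bool \<Rightarrow> real \<Rightarrow> complex ^ 'm \<Rightarrow> complex ^ 'm"
    where "\<sigma> j = shift_vec (fst j) (if snd j then \<i> else 1)" for j
  define \<Psi> :: "('m \<times> bool \<Rightarrow> real) \<Rightarrow> complex ^ 'm"
    where "\<Psi> x = (\<chi> i. Complex (x (i, False)) (x (i, True)))" for x
  define d where "d u j = (if snd j then Im (c u $ fst j) else Re (c u $ fst j))" for u j
  define d' where "d' j = (if snd j then Im (c' (fst j)) else Re (c' (fst j)))" for j
  have \<Psi>d: "\<Psi> (d u) = c u" for u
    by (simp add: \<Psi>_def d_def vec_eq_iff)
  have \<sigma>: "\<sigma> j \<in> vec_shifts" for j by (auto simp: \<sigma>_def)
  have "((\<lambda>u. H (\<Psi> (d u))) has_vector_derivative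
     (\<Sum>j\<in>UNIV. d' j *\<^sub>R partial (\<sigma> j) H (\<Psi> (d s)))) (at s)"
  proof (rule chain_rule[where S = V])
    show "flow (\<sigma> j)" for j unfolding \<sigma>_def by (rule flow_shift_vec)
    show "\<Psi> (x(j := x j + h)) = \<sigma> j h (\<Psi> x)" for j x h
      by (cases j) (auto simp: \<Psi>_def \<sigma>_def vec_eq_iff shift_vec_nth complex_eq_iff)
    show "((\<lambda>u. d u j) has_real_derivative d' j) (at s)" for j
      using has_vector_derivative_Re[OF c[of "fst j"]] has_vector_derivative_Im[OF c[of "fst j"]]
      by (auto simp: d_def d'_def has_real_derivative_iff_has_vector_derivative)
  qed (use V H \<sigma> \<Psi>d in auto)
  also have "(\<Sum>j\<in>UNIV. d' j *\<^sub>R partial (\<sigma> j) H (\<Psi> (d s))) =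
    (\<Sum>i\<in>UNIV. of_real (Re (c' i)) * partial (shift_vec i 1) H (c s)
              + of_real (Im (c' i)) * partial (shift_vec i \<i>) H (c s))"
    by (simp add: \<Psi>d UNIV_Times_UNIV[symmetric] sum.cartesian_product' sum_UNIV_bool d'_def \<sigma>_def scaleR_conv_of_real
        del: UNIV_Times_UNIV)
  finally show ?thesis by (simp add: \<Psi>d)
qed

lemma chain_rule_jet:
  fixes \<zeta> :: "real \<Rightarrow> nat \<Rightarrow> complex ^ 'm::finite"
  assumes S: "open S" "(t, \<zeta> s) \<in> S"
    and H: "\<And>\<sigma> q. \<sigma> \<in> jet_shifts \<Longrightarrow> q \<in> S \<Longrightarrow> (\<lambda>h. H (\<sigma> h q)) differentiable (at 0)"
      "\<And>\<sigma>. \<sigma> \<in> jet_shifts \<Longrightarrow> continuous_on S (partial \<sigma> H)"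
    and \<zeta>: "\<And>r i. r \<le> k \<Longrightarrow> ((\<lambda>u. \<zeta> u r $ i) has_vector_derivative \<zeta>' r $ i) (at s)"
      "\<And>r u. r > k \<Longrightarrow> \<zeta> u r = \<zeta> s r"
  shows "((\<lambda>u. H (t, \<zeta> u)) has_vector_derivative
     (\<Sum>r\<le>k. \<Sum>i\<in>UNIV. of_real (Re (\<zeta>' r $ i)) * partial (shift_z r i 1) H (t, \<zeta> s)
              + of_real (Im (\<zeta>' r $ i)) * partial (shift_z r i \<i>) H (t, \<zeta> s))) (at s)"
proof -
  define \<sigma> :: "nat \<times> 'm \<times> bool \<Rightarrow> real \<Rightarrow> real \<times> (nat \<Rightarrow> complex ^ 'm) \<Rightarrow> real \<times> (nat \<Rightarrow> complex ^ 'm)"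
    where "\<sigma> = (\<lambda>(r, i, b). shift_z r i (if b then \<i> else 1))"
  define \<Psi> :: "(nat \<times> 'm \<times> bool \<Rightarrow> real) \<Rightarrow> real \<times> (nat \<Rightarrow> complex ^ 'm)"
    where "\<Psi> x = (t, \<lambda>r. if r \<le> k then \<chi> i. Complex (x (r, i, False)) (x (r, i, True)) else \<zeta> s r)" for x
  define d where "d u = (\<lambda>(r, i, b). if r \<le> k then if b then Im (\<zeta> u r $ i) else Re (\<zeta> u r $ i) else 0)" for u
  define d' where "d' = (\<lambda>(r, i, b). if b then Im (\<zeta>' r $ i) else Re (\<zeta>' r $ i))"
  define J where "J = {..k} \<times> (UNIV :: 'm set) \<times> (UNIV :: bool set)"
  have \<Psi>d: "\<Psi> (d u) = (t, \<zeta> u)" for u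
    by (auto simp: \<Psi>_def d_def vec_eq_iff fun_eq_iff intro: \<zeta>(2)[symmetric, THEN arg_cong])
  have \<sigma>: "\<sigma> j \<in> jet_shifts" for j by (auto simp: \<sigma>_def split: prod.splits)
  have "((\<lambda>u. H (\<Psi> (d u))) has_vector_derivative
     (\<Sum>j\<in>J. d' j *\<^sub>R partial (\<sigma> j) H (\<Psi> (d s)))) (at s)"
  proof (rule chain_rule[where S = S])
    show "finite J" by (simp add: J_def)
    show "flow (\<sigma> j)" for j unfolding \<sigma>_def by (auto intro: flow_shift_z split: prod.splits)
    show "\<Psi> (x(j := x j + h)) = \<sigma> j h (\<Psi> x)" if "j \<in> J" for j x h
      using that by (cases j rule: prod_cases3)
        (auto simp: J_def \<Psi>_def \<sigma>_def shift_z_def vec_eq_iff shift_vec_nth complex_eq_iff fun_eq_iff)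
    show "((\<lambda>u. d u j) has_real_derivative d' j) (at s)" if "j \<in> J" for j
      using that has_vector_derivative_Re[OF \<zeta>(1)] has_vector_derivative_Im[OF \<zeta>(1)]
      by (auto simp: J_def d_def d'_def has_real_derivative_iff_has_vector_derivative)
    show "d u j = d s j" if "j \<notin> J" for u j
      using that by (cases j rule: prod_cases3) (auto simp: J_def d_def)
  qed (use S H \<sigma> \<Psi>d in auto)
  also have "(\<Sum>j\<in>J. d' j *\<^sub>R partial (\<sigma> j) H (\<Psi> (d s))) =
    (\<Sum>r\<le>k. \<Sum>i\<in>UNIV. of_real (Re (\<zeta>' r $ i)) * partial (shift_z r i 1) H (t, \<zeta> s)
              + of_real (Im (\<zeta>' r $ i)) * partial (shift_z r i \<i>) H (t, \<zeta> s))"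
    by (simp add: \<Psi>d J_def UNIV_Times_UNIV[symmetric] sum.cartesian_product' sum_UNIV_bool d'_def
        \<sigma>_def scaleR_conv_of_real del: UNIV_Times_UNIV)
  finally show ?thesis by (simp add: \<Psi>d)
qed

lemma (in shift_domain) smooth_compose:
  fixes g :: "'p \<Rightarrow> complex ^ 'm::finite"
  assumes V: "open V" "g ` S \<subseteq> V" and g: "\<And>i. smooth_along \<Sigma> S (\<lambda>p. g p $ i)"
    and G: "smooth_along vec_shifts V G"
  shows "smooth_along \<Sigma> S (\<lambda>p. G (g p))"
proof -
  have cg: "continuous_on S g"
    using continuous_on_vec_lambda[of S "\<lambda>i p. g p $ i"] smooth_along_continuous[OF g] by simp
  have "Ck \<Sigma> S n (\<lambda>p. G (g p))" for n using G
  proof (induction n arbitrary: G)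
    case 0
    then show ?case using smooth_along_continuous V(2) cg by (auto intro: continuous_on_compose2)
  next
    case (Suc n)
    have dG: "smooth_along vec_shifts V (partial (shift_vec i w) G)" if "w \<in> {1, \<i>}" for i w
      using smooth_along_partial[OF Suc.prems] that by blast
    define D where "D \<sigma> p = (\<Sum>i\<in>UNIV.
        of_real (Re (partial \<sigma> (\<lambda>p. g p $ i) p)) * partial (shift_vec i 1) G (g p)
      + of_real (Im (partial \<sigma> (\<lambda>p. g p $ i) p)) * partial (shift_vec i \<i>) G (g p))" for \<sigma> p
    show ?case
    proof (rule Ck_SucI[where D = D])
      show "continuous_on S (\<lambda>p. G (g p))"
        using smooth_along_continuous[OF Suc.prems] V(2) cg by (auto intro: continuous_on_compose2)
      fix \<sigma> assume s: "\<sigma> \<in> \<Sigma>"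
      have "Ck \<Sigma> S n (\<lambda>p. a p * partial (shift_vec i w) G (g p))"
        if "smooth_along \<Sigma> S a" "w \<in> {1, \<i>}" for a i w
        using that Suc.IH[OF dG] by (auto intro!: Ck_mult simp: smooth_along_iff_Ck[of \<Sigma> S a])
      then have "Ck \<Sigma> S n (\<lambda>p. of_real (Re (partial \<sigma> (\<lambda>p. g p $ i) p)) * partial (shift_vec i 1) G (g p)
          + of_real (Im (partial \<sigma> (\<lambda>p. g p $ i) p)) * partial (shift_vec i \<i>) G (g p))" for i
        using smooth_Re smooth_Im smooth_along_partial[OF g s] by (intro Ck_add) auto
      then have "Ck \<Sigma> S n (\<lambda>p. \<Sum>i\<in>I. of_real (Re (partial \<sigma> (\<lambda>p. g p $ i) p)) * partial (shift_vec i 1) G (g p)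
          + of_real (Im (partial \<sigma> (\<lambda>p. g p $ i) p)) * partial (shift_vec i \<i>) G (g p))" for I
        by (induction I rule: infinite_finite_induct) (auto intro: Ck_const Ck_add)
      then show "Ck \<Sigma> S n (D \<sigma>)" unfolding D_def .
      fix p assume p: "p \<in> S"
      have z: "\<sigma> 0 p = p" by (rule shift_zero[OF s])
      have "((\<lambda>u. G (g (\<sigma> u p))) has_vector_derivative
         (\<Sum>i\<in>UNIV. of_real (Re (partial \<sigma> (\<lambda>p. g p $ i) p)) * partial (shift_vec i 1) G (g (\<sigma> 0 p))
            + of_real (Im (partial \<sigma> (\<lambda>p. g p $ i) p)) * partial (shift_vec i \<i>) G (g (\<sigma> 0 p)))) (at 0)"
      proof (rule chain_rule_vec[OF V(1)])
        show "g (\<sigma> 0 p) \<in> V" using V(2) p z by auto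
        show "((\<lambda>u. g (\<sigma> u p) $ i) has_vector_derivative partial \<sigma> (\<lambda>p. g p $ i) p) (at 0)" for i
          using smooth_along_differentiable[OF g s p] partial_works[of "\<lambda>p. g p $ i"] by blast
      qed (use smooth_along_differentiable[OF Suc.prems]
            smooth_along_continuous[OF smooth_along_partial[OF Suc.prems]] in blast)+
      then show "((\<lambda>u. G (g (\<sigma> u p))) has_vector_derivative D \<sigma> p) (at 0)"
        by (simp add: D_def z)
    qed
  qed
  then show ?thesis by (simp add: smooth_along_iff_Ck)
qed

lemma smooth_along_Un:
  assumes "open S" "open S'" "smooth_along \<Sigma> S H" "smooth_along \<Sigma> S' H"
  shows "smooth_along \<Sigma> (S \<union> S') H"
  using assms unfolding smooth_along_def by (auto intro: continuous_on_open_Un)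

section \<open>Prolongation of a function to jet coordinates\<close>

text \<open>
  \<open>prolong k G\<close> expresses the k-th derivative of \<open>G \<circ> c\<close> at 0 by the derivatives of the curve c at 0. The
  recursion is the total derivative, which sends the coordinate of order r to that of order r+1; up to
  the t-component it is the defining formula of the complete lift in one chart.
\<close>

primrec prolong :: "nat \<Rightarrow> (complex ^ 'm::finite \<Rightarrow> complex) \<Rightarrow> real \<times> (nat \<Rightarrow> complex ^ 'm) \<Rightarrow> complex" where
  "prolong 0 G = (\<lambda>p. G (snd p 0))"
| "prolong (Suc k) G = (\<lambda>p. \<Sum>r\<le>k. \<Sum>i\<in>UNIV.
     of_real (Re (snd p (Suc r) $ i)) * partial (shift_z r i 1) (prolong k G) p
   + of_real (Im (snd p (Suc r) $ i)) * partial (shift_z r i \<i>) (prolong k G) p)"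

text \<open>Translates the Wirtinger form of the complete lift into the real form of \<open>prolong\<close>.\<close>

lemma wirt_real_form:
  "a * wirt \<sigma> H p + cnj a * wirt_bar \<sigma> H p =
     of_real (Re a) * partial (\<sigma> 1) H p + of_real (Im a) * partial (\<sigma> \<i>) H p"
  by (simp add: wirt_def wirt_bar_def complex_eq_iff field_simps)

lemma smooth_coordinate:
  fixes V :: "(complex ^ 'm::finite) set"
  assumes "open V"
  shows "smooth_along jet_shifts {(t, \<zeta> :: nat \<Rightarrow> complex ^ 'm). \<zeta> 0 \<in> V} (\<lambda>p. snd p r $ i)"
proof -
  interpret shift_domain jet_shifts "{(t, \<zeta> :: nat \<Rightarrow> complex ^ 'm). \<zeta> 0 \<in> V}"
    by (rule shift_domain_jet[OF assms])
  show ?thesis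
  proof (rule smooth_affine[where d = "\<lambda>\<sigma>. vector_derivative (\<lambda>h. snd (\<sigma> h (0, \<lambda>_. 0)) r $ i) (at 0)"])
    fix \<sigma> :: "real \<Rightarrow> real \<times> (nat \<Rightarrow> complex ^ 'm) \<Rightarrow> real \<times> (nat \<Rightarrow> complex ^ 'm)"
      and p assume "\<sigma> \<in> jet_shifts"
    then obtain a where a: "\<And>h p. snd (\<sigma> h p) r $ i = snd p r $ i + a * of_real h"
    proof
      assume "\<sigma> = shift_t" then show thesis by (intro that[of 0]) auto
    next
      assume "\<sigma> \<in> {shift_z r i w |r i w. w \<in> {1, \<i>}}"
      then obtain r' i' w where "\<sigma> = shift_z r' i' w" by auto
      then show thesis
        by (intro that[of "if r = r' \<and> i = i' then w else 0"]) (auto simp: shift_vec_nth)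
    qed
    have "((\<lambda>h. b + a * of_real h) has_vector_derivative a) (at 0)" for b
      by (auto intro!: derivative_eq_intros)
    then show "((\<lambda>h. snd (\<sigma> h p) r $ i) has_vector_derivative
        vector_derivative (\<lambda>h. snd (\<sigma> h (0, \<lambda>_. 0)) r $ i) (at 0)) (at 0)"
      unfolding a by (metis vector_derivative_at)
  qed (rule continuous_on_component[OF continuous_on_jet_coordinate[OF continuous_on_id]])
qed

text \<open>
  Smoothness holds on the open set of all \<open>(t, \<zeta>)\<close> with \<open>\<zeta> 0\<close> in V, without restricting the order of
  the nonzero entries of \<open>\<zeta>\<close>. Being open, this set is also a domain for the chain rule.
\<close>

lemma smooth_prolong:
  fixes V :: "(complex ^ 'm::finite) set"
  assumes V: "open V" and G: "smooth_along vec_shifts V G"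
  shows "smooth_along jet_shifts {(t, \<zeta> :: nat \<Rightarrow> complex ^ 'm). \<zeta> 0 \<in> V} (prolong k G)"
proof -
  interpret shift_domain jet_shifts "{(t, \<zeta> :: nat \<Rightarrow> complex ^ 'm). \<zeta> 0 \<in> V}"
    by (rule shift_domain_jet[OF V])
  show ?thesis
  proof (induction k)
    case 0
    show ?case unfolding prolong.simps
      by (rule smooth_compose[OF V _ smooth_coordinate[OF V] G]) auto
  next
    case (Suc k)
    show ?case unfolding prolong.simps
      by (intro smooth_sum smooth_add smooth_mult smooth_Re smooth_Im smooth_coordinate[OF V]
          smooth_along_partial[OF Suc]) auto
  qed
qed

lemma partial_agree:
  assumes H: "\<And>p q. (\<And>n. n \<le> k \<Longrightarrow> snd p n = snd q n) \<Longrightarrow> H p = H q"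
    and pq: "\<And>n. n \<le> k \<Longrightarrow> snd p n = snd q n"
  shows "partial (shift_z r i w) H p = partial (shift_z r i w) H q"
proof -
  have "H (shift_z r i w h p) = H (shift_z r i w h q)" for h
    by (rule H) (use pq in auto)
  then show ?thesis by (simp add: partial_def)
qed

lemma prolong_agree:
  "(\<And>n. n \<le> k \<Longrightarrow> snd p n = snd q n) \<Longrightarrow> prolong k G p = prolong k G q"
proof (induction k arbitrary: p q)
  case (Suc k)
  have "partial (shift_z r i w) (prolong k G) p = partial (shift_z r i w) (prolong k G) q" for r i w
    by (rule partial_agree[of k, OF Suc.IH]) (use Suc.prems in auto)
  then show ?case using Suc.prems by (auto intro!: sum.cong)
qed auto

lemma partial_prolong_agree:
  "(\<And>n. n \<le> k \<Longrightarrow> snd p n = snd q n) \<Longrightarrow>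
    partial (shift_z r i w) (prolong k G) p = partial (shift_z r i w) (prolong k G) q"
  by (rule partial_agree[of k, OF prolong_agree])

text \<open>
  The coordinate of order k+1 occurs in \<open>prolong (k+1) G\<close> only as an explicit linear factor, multiplied
  with the derivatives of \<open>prolong k G\<close> by the coordinates of order k. So the top partial derivatives
  do not change with k, and for k = 0 they are those of G.
\<close>

lemma partial_prolong_top:
  assumes w: "w \<in> {1, \<i>}"
  shows "partial (shift_z k i w) (prolong k G) p = partial (shift_vec i w) G (snd p 0)"
proof (induction k)
  case 0
  then show ?case by (simp add: partial_def)
next
  case (Suc k)
  define A where "A j v = partial (shift_z k j v) (prolong k G) p" for j v
  have "prolong (Suc k) G (shift_z (Suc k) i w h p) = prolong (Suc k) G p + of_real h * A i w" for h
  proof -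
    let ?p = "shift_z (Suc k) i w h p"
    have eq: "partial (shift_z r j v) (prolong k G) ?p = partial (shift_z r j v) (prolong k G) p" for r j v
      by (rule partial_prolong_agree) auto
    have nth: "snd ?p (Suc r) $ j = snd p (Suc r) $ j + (if r = k \<and> j = i then w * of_real h else 0)" for r j
      by (auto simp: shift_vec_nth)
    have term_eq: "of_real (Re (snd ?p (Suc r) $ j)) * partial (shift_z r j 1) (prolong k G) ?p
       + of_real (Im (snd ?p (Suc r) $ j)) * partial (shift_z r j \<i>) (prolong k G) ?p
       = (of_real (Re (snd p (Suc r) $ j)) * partial (shift_z r j 1) (prolong k G) p
       + of_real (Im (snd p (Suc r) $ j)) * partial (shift_z r j \<i>) (prolong k G) p)
       + (if r = k then if j = i then of_real h * A i w else 0 else 0)" for r j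
      unfolding nth eq using w by (auto simp: A_def algebra_simps)
    show ?thesis
    proof -
      have "(\<Sum>r\<le>k. \<Sum>j\<in>UNIV. if r = k then if j = i then of_real h * A i w else 0 else 0) =
          (\<Sum>r\<le>k. if r = k then of_real h * A i w else 0)"
        by (rule sum.cong) auto
      then show ?thesis unfolding prolong.simps term_eq by (simp add: sum.distrib)
    qed
  qed
  then have "((\<lambda>h. prolong (Suc k) G (shift_z (Suc k) i w h p)) has_vector_derivative A i w) (at 0)"
    by (auto intro!: derivative_eq_intros)
  then have "partial (shift_z (Suc k) i w) (prolong (Suc k) G) p = A i w"
    unfolding partial_def by (rule vector_derivative_at)
  then show ?case using Suc by (simp add: A_def)
qed



section \<open>Higher derivatives of curves\<close>

lemma nderiv_0 [simp]: "nderiv 0 g = g"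
  by (simp add: nderiv_def)

lemma nderiv_Suc: "nderiv (Suc n) g s = vector_derivative (nderiv n g) (at s)"
  by (simp add: nderiv_def)

lemma nderiv_cong:
  assumes "open U" "\<And>u. u \<in> U \<Longrightarrow> f u = g u" "u \<in> U"
  shows "nderiv n f u = nderiv n g u"
  using assms(3)
proof (induction n arbitrary: u)
  case (Suc n)
  have "\<forall>\<^sub>F v in nhds u. nderiv n f v = nderiv n g v"
    using eventually_nhds_in_open[OF assms(1) Suc.prems] by eventually_elim (rule Suc.IH)
  then show ?case unfolding nderiv_Suc by (intro vector_derivative_cong_eq) auto
qed (simp add: assms(2))

lemma differentiable_cong_open:
  assumes "open U" "\<And>u. u \<in> U \<Longrightarrow> f u = g u" "u \<in> U" "f differentiable (at u)"
  shows "g differentiable (at u)"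
  using assms unfolding differentiable_def
  by (meson has_derivative_transform_within_open)

lemma nderiv_vec:
  fixes c :: "real \<Rightarrow> complex ^ 'm::finite"
  assumes U: "open U" and d: "\<And>u n i. u \<in> U \<Longrightarrow> nderiv n (\<lambda>s. c s $ i) differentiable (at u)" and "u \<in> U"
  shows "nderiv n c differentiable (at u)" and "nderiv n c u $ i = nderiv n (\<lambda>s. c s $ i) u"
proof -
  have diff: "f differentiable (at u)" if "\<And>i. (\<lambda>v. f v $ i) differentiable (at u)"
    for f :: "real \<Rightarrow> complex ^ 'm" and u
  proof -
    have "linear (axis i :: complex \<Rightarrow> complex ^ 'm)" for i
      by (auto simp: linear_iff vec_eq_iff axis_def)
    then have "(\<lambda>v. axis i (f v $ i) :: complex ^ 'm) differentiable (at u)" for i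
      using that[of i] by (intro differentiable_compose[of "axis i", OF linear_imp_differentiable])
    then have "(\<lambda>v. \<Sum>i\<in>UNIV. axis i (f v $ i) :: complex ^ 'm) differentiable (at u)"
      by (intro differentiable_sum) auto
    moreover have "(\<Sum>i\<in>UNIV. axis i (f v $ i)) = f v" for v
      by (simp add: vec_eq_iff axis_def)
    ultimately show ?thesis by simp
  qed
  have "\<forall>u\<in>U. nderiv n c differentiable (at u) \<and> (\<forall>i. nderiv n c u $ i = nderiv n (\<lambda>s. c s $ i) u)" for n
  proof (induction n)
    case 0
    show ?case using d[of _ 0] by (auto intro: diff)
  next
    case (Suc n)
    have eq: "nderiv (Suc n) c u $ i = nderiv (Suc n) (\<lambda>s. c s $ i) u" if u: "u \<in> U" for u i
    proof -
      have "(nderiv n c has_vector_derivative nderiv (Suc n) c u) (at u)"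
        unfolding nderiv_Suc using Suc u vector_derivative_works by blast
      then have "((\<lambda>v. nderiv n c v $ i) has_vector_derivative nderiv (Suc n) c u $ i) (at u)"
        by (rule bounded_linear.has_vector_derivative[OF bounded_linear_vec_nth])
      then have "vector_derivative (\<lambda>v. nderiv n c v $ i) (at u) = nderiv (Suc n) c u $ i"
        by (rule vector_derivative_at)
      moreover have "\<forall>\<^sub>F v in nhds u. nderiv n c v $ i = nderiv n (\<lambda>s. c s $ i) v"
        using eventually_nhds_in_open[OF U u] by eventually_elim (use Suc in auto)
      then have "vector_derivative (\<lambda>v. nderiv n c v $ i) (at u) = nderiv (Suc n) (\<lambda>s. c s $ i) u"
        unfolding nderiv_Suc by (intro vector_derivative_cong_eq) auto
      ultimately show ?thesis by simp
    qed
    have "nderiv (Suc n) c differentiable (at u)" if u: "u \<in> U" for u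
    proof (rule diff)
      fix i show "(\<lambda>v. nderiv (Suc n) c v $ i) differentiable at u"
        by (rule differentiable_cong_open[OF U _ u d[OF u, of "Suc n" i]]) (simp add: eq)
    qed
    then show ?case using eq by blast
  qed
  then show "nderiv n c differentiable (at u)" and "nderiv n c u $ i = nderiv n (\<lambda>s. c s $ i) u"
    using assms(3) by blast+
qed

text \<open>
  The meaning of \<open>prolong\<close>. The curve of jets \<open>u \<mapsto> (nderiv r c u)\<^sub>r\<close> has the velocity
  \<open>(nderiv (r+1) c u)\<^sub>r\<close>, so by the chain rule differentiating \<open>prolong k G\<close> along it yields
  \<open>prolong (k+1) G\<close>.
\<close>

lemma nderiv_compose:
  fixes c :: "real \<Rightarrow> complex ^ 'm::finite"
  assumes V: "open V" and G: "smooth_along vec_shifts V G"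
    and U: "open U" "\<And>u. u \<in> U \<Longrightarrow> c u \<in> V" "\<And>u n. u \<in> U \<Longrightarrow> nderiv n c differentiable (at u)"
    and u: "u \<in> U"
  shows "nderiv k (\<lambda>s. G (c s)) u = prolong k G (t, \<lambda>r. nderiv r c u)"
    and "nderiv k (\<lambda>s. G (c s)) differentiable (at u)"
proof -
  let ?S = "{(t :: real, \<zeta> :: nat \<Rightarrow> complex ^ 'm). \<zeta> 0 \<in> V}"
  have der: "((\<lambda>v. prolong k G (t, \<lambda>r. nderiv r c v)) has_vector_derivative
     prolong (Suc k) G (t, \<lambda>r. nderiv r c u)) (at u)" if u: "u \<in> U" for k u
  proof -
    \<comment> \<open>The chain rule moves finitely many coordinates, so those of order above k are frozen at u; \<open>prolong k\<close> does not see them.\<close>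
    define \<zeta> where "\<zeta> v r = (if r \<le> k then nderiv r c v else nderiv r c u)" for v r
    have \<zeta>u: "\<zeta> u = (\<lambda>r. nderiv r c u)" by (auto simp: \<zeta>_def)
    have "((\<lambda>v. prolong k G (t, \<zeta> v)) has_vector_derivative
      (\<Sum>r\<le>k. \<Sum>i\<in>UNIV. of_real (Re (nderiv (Suc r) c u $ i)) * partial (shift_z r i 1) (prolong k G) (t, \<zeta> u)
        + of_real (Im (nderiv (Suc r) c u $ i)) * partial (shift_z r i \<i>) (prolong k G) (t, \<zeta> u))) (at u)"
    proof (rule chain_rule_jet[of ?S, OF open_over[OF V]])
      show "(t, \<zeta> u) \<in> ?S" using U(2)[OF u] by (simp add: \<zeta>_def)
      show "(\<lambda>h. prolong k G (\<sigma> h q)) differentiable at 0" if "\<sigma> \<in> jet_shifts" "q \<in> ?S" for \<sigma> q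
        by (rule smooth_along_differentiable[OF smooth_prolong[OF V G] that])
      show "continuous_on ?S (partial \<sigma> (prolong k G))" if "\<sigma> \<in> jet_shifts" for \<sigma>
        by (rule smooth_along_continuous[OF smooth_along_partial[OF smooth_prolong[OF V G] that]])
      fix r i assume "r \<le> k"
      have "(nderiv r c has_vector_derivative nderiv (Suc r) c u) (at u)"
        unfolding nderiv_Suc using U(3)[OF u] vector_derivative_works by blast
      then have "((\<lambda>v. nderiv r c v $ i) has_vector_derivative nderiv (Suc r) c u $ i) (at u)"
        by (rule bounded_linear.has_vector_derivative[OF bounded_linear_vec_nth])
      then show "((\<lambda>v. \<zeta> v r $ i) has_vector_derivative nderiv (Suc r) c u $ i) (at u)"
        using \<open>r \<le> k\<close> by (simp add: \<zeta>_def)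
    qed (auto simp: \<zeta>_def)
    moreover have "prolong k G (t, \<zeta> v) = prolong k G (t, \<lambda>r. nderiv r c v)" for v
      by (rule prolong_agree) (simp add: \<zeta>_def)
    ultimately show ?thesis by (simp add: \<zeta>u)
  qed
  have eq: "nderiv k (\<lambda>s. G (c s)) u = prolong k G (t, \<lambda>r. nderiv r c u)" if "u \<in> U" for k u
    using that
  proof (induction k arbitrary: u)
    case (Suc k)
    have "\<forall>\<^sub>F v in nhds u. nderiv k (\<lambda>s. G (c s)) v = prolong k G (t, \<lambda>r. nderiv r c v)"
      using eventually_nhds_in_open[OF U(1) Suc.prems] by eventually_elim (rule Suc.IH)
    then have "nderiv (Suc k) (\<lambda>s. G (c s)) u = vector_derivative (\<lambda>v. prolong k G (t, \<lambda>r. nderiv r c v)) (at u)"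
      unfolding nderiv_Suc by (intro vector_derivative_cong_eq) auto
    then show ?case using vector_derivative_at[OF der[OF Suc.prems]] by simp
  qed simp
  show "nderiv k (\<lambda>s. G (c s)) u = prolong k G (t, \<lambda>r. nderiv r c u)" by (rule eq[OF u])
  have "(\<lambda>v. prolong k G (t, \<lambda>r. nderiv r c v)) differentiable (at u)"
    using der[OF u] by (auto simp: differentiable_def has_vector_derivative_def)
  then show "nderiv k (\<lambda>s. G (c s)) differentiable (at u)"
    by (rule differentiable_cong_open[OF U(1) _ u, rotated]) (simp add: eq)
qed

section \<open>Taylor curves\<close>

definition taylor_curve :: "nat \<Rightarrow> (nat \<Rightarrow> complex ^ 'm::finite) \<Rightarrow> real \<Rightarrow> complex ^ 'm" where
  "taylor_curve k \<zeta> s = (\<Sum>r\<le>k. (s ^ r / fact r) *\<^sub>R \<zeta> r)"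

lemma taylor_curve_derivative:
  assumes "\<zeta> (Suc k) = 0"
  shows "(taylor_curve k \<zeta> has_vector_derivative taylor_curve k (\<lambda>r. \<zeta> (Suc r)) s) (at s)"
proof -
  have "((\<lambda>s. \<Sum>r\<le>k. (s ^ r / fact r) *\<^sub>R \<zeta> r) has_vector_derivative
    (\<Sum>r<k. (s ^ r / fact r) *\<^sub>R \<zeta> (Suc r))) (at s)"
  proof (induction k)
    case 0
    show ?case by simp
  next
    case (Suc k)
    have "((\<lambda>s. s ^ Suc k / fact (Suc k)) has_real_derivative s ^ k / fact k) (at s)"
    proof -
      have "((\<lambda>s. s ^ Suc k / fact (Suc k)) has_real_derivative real (Suc k) * s ^ k / fact (Suc k)) (at s)"
        using DERIV_cdivide[OF DERIV_pow[of "Suc k" s UNIV], of "fact (Suc k)"]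
        by (simp del: power_Suc of_nat_Suc fact_Suc)
      moreover have "real (Suc k) * s ^ k / fact (Suc k) = s ^ k / fact k"
        by (simp add: fact_Suc del: of_nat_Suc)
      ultimately show ?thesis by simp
    qed
    from has_vector_derivative_add[OF Suc has_vector_derivative_scaleR[OF this has_vector_derivative_const[of "\<zeta> (Suc k)"]]]
    show ?case by simp
  qed
  moreover have "(\<Sum>r<k. (s ^ r / fact r) *\<^sub>R \<zeta> (Suc r)) = taylor_curve k (\<lambda>r. \<zeta> (Suc r)) s"
    unfolding taylor_curve_def using assms by (simp add: lessThan_Suc_atMost[symmetric])
  ultimately show ?thesis by (simp add: taylor_curve_def[abs_def])
qed

lemma nderiv_taylor_curve:
  assumes "\<And>r. r > k \<Longrightarrow> \<zeta> r = 0"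
  shows "nderiv n (taylor_curve k \<zeta>) = taylor_curve k (\<lambda>r. \<zeta> (r + n))"
proof (induction n)
  case (Suc n)
  have "(taylor_curve k (\<lambda>r. \<zeta> (r + n)) has_vector_derivative taylor_curve k (\<lambda>r. \<zeta> (r + Suc n)) s) (at s)" for s
    using taylor_curve_derivative[of "\<lambda>r. \<zeta> (r + n)" k s] assms by simp
  then show ?case unfolding nderiv_Suc[abs_def] Suc by (auto simp: fun_eq_iff nderiv_Suc Suc vector_derivative_at)
qed simp

lemma taylor_curve_0: "taylor_curve k \<zeta> 0 = \<zeta> 0"
proof -
  have "taylor_curve k \<zeta> 0 = (\<Sum>r\<le>k. if r = 0 then \<zeta> r else 0)"
    unfolding taylor_curve_def by (intro sum.cong) (auto simp: power_0_left)
  then show ?thesis by simp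
qed

lemma nderiv_taylor_curve_differentiable:
  assumes "\<And>r. r > k \<Longrightarrow> \<zeta> r = 0"
  shows "nderiv n (taylor_curve k \<zeta>) differentiable (at s)"
proof -
  have "nderiv n (taylor_curve k \<zeta>) = taylor_curve k (\<lambda>r. \<zeta> (r + n))"
    by (rule nderiv_taylor_curve[OF assms])
  then show ?thesis
    using taylor_curve_derivative[of "\<lambda>r. \<zeta> (r + n)" k s] assms
    by (auto simp: differentiable_def has_vector_derivative_def)
qed

lemma nderiv_const: "nderiv n (\<lambda>_. x) = (if n = 0 then \<lambda>_. x else (\<lambda>_. 0))"
proof (induction n)
  case (Suc n)
  have "vector_derivative (nderiv n (\<lambda>_. x)) (at u) = 0" for u
    unfolding Suc by (cases "n = 0") simp_all
  then show ?case by (simp add: fun_eq_iff nderiv_Suc)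
qed simp

section \<open>Charts, germs of curves and jets\<close>

locale complex_manifold =
  fixes A :: "('a::t2_space, 'm::finite) chart set"
  assumes atlas: "complex_atlas A"
begin

abbreviation chart_inv :: "('a, 'm) chart \<Rightarrow> complex ^ 'm \<Rightarrow> 'a" where
  "chart_inv c \<equiv> the_inv_into (fst c) (snd c)"

lemma
  assumes "c \<in> A"
  shows open_chart: "open (fst c)" and open_chart_image: "open (snd c ` fst c)"
    and chart_homeomorphism: "homeomorphism (fst c) (snd c ` fst c) (snd c) (chart_inv c)"
proof -
  have "open (fst c) \<and> open (snd c ` fst c) \<and>
      homeomorphism (fst c) (snd c ` fst c) (snd c) (chart_inv c)"
    using atlas assms unfolding complex_atlas_def case_prod_unfold by blast
  then show "open (fst c)" "open (snd c ` fst c)"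
    "homeomorphism (fst c) (snd c ` fst c) (snd c) (chart_inv c)" by blast+
qed

lemma chart_exists: obtains c where "c \<in> A" "p \<in> fst c"
proof -
  have "p \<in> (\<Union>(U, \<phi>)\<in>A. U)" using atlas by (simp add: complex_atlas_def)
  then obtain c where "c \<in> A" "p \<in> fst c" by auto
  then show thesis by (rule that)
qed

lemma chart_inj: "c \<in> A \<Longrightarrow> inj_on (snd c) (fst c)"
  using homeomorphism_apply1[OF chart_homeomorphism] by (rule inj_on_inverseI)

lemma chart_inv_apply [simp]: "c \<in> A \<Longrightarrow> p \<in> fst c \<Longrightarrow> chart_inv c (snd c p) = p"
  by (rule the_inv_into_f_f[OF chart_inj])

lemma open_overlap:
  assumes "c \<in> A" "open V"
  shows "open (snd c ` (fst c \<inter> V))"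
proof -
  have "snd c ` (fst c \<inter> V) = snd c ` fst c \<inter> chart_inv c -` V"
    using chart_inv_apply[OF assms(1)] by auto
  moreover have "continuous_on (snd c ` fst c) (chart_inv c)"
    using chart_homeomorphism[OF assms(1)] by (simp add: homeomorphism_def)
  ultimately show ?thesis
    using continuous_open_preimage[OF _ open_chart_image[OF assms(1)] assms(2)] by metis
qed

lemma transition_smooth:
  assumes "c \<in> A" "d \<in> A"
  shows "smooth_along vec_shifts (snd c ` (fst c \<inter> fst d)) (\<lambda>x. snd d (chart_inv c x) $ j)"
proof -
  have "holomorphic_map (snd c ` (fst c \<inter> fst d)) (snd d \<circ> chart_inv c)"
    using atlas assms unfolding complex_atlas_def case_prod_unfold by blast
  then show ?thesis by (simp add: holomorphic_map_def)
qed

lemma germ_nbhd: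
  assumes "smooth_germ A \<gamma>" "c \<in> A" "\<gamma> 0 \<in> fst c"
  obtains I where "open I" "0 \<in> I" "\<And>s. s \<in> I \<Longrightarrow> \<gamma> s \<in> fst c"
    "\<And>s n. s \<in> I \<Longrightarrow> nderiv n (snd c \<circ> \<gamma>) differentiable (at s)"
proof -
  obtain \<epsilon> where e: "\<epsilon> > 0" "\<And>s. \<bar>s\<bar> < \<epsilon> \<Longrightarrow> \<gamma> s \<in> fst c \<and> (\<forall>n. nderiv n (snd c \<circ> \<gamma>) differentiable (at s))"
    using assms unfolding smooth_germ_def by (cases c) fastforce
  then show ?thesis by (intro that[of "ball 0 \<epsilon>"]) (auto simp: dist_real_def)
qed

text \<open>
  Smoothness of a curve passes from one chart to another, and its derivatives in the new chart are
  functions of its derivatives up to the same order in the old one. Everything about jets that has to be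
  independent of the chart rests on this.
\<close>

lemma change_of_chart:
  assumes c: "c \<in> A" and d: "d \<in> A" and I: "open I" "\<And>s. s \<in> I \<Longrightarrow> \<gamma> s \<in> fst c"
    "\<And>s n. s \<in> I \<Longrightarrow> nderiv n (snd c \<circ> \<gamma>) differentiable (at s)"
    and zero: "0 \<in> I" "\<gamma> 0 \<in> fst d"
  obtains I' where "open I'" "0 \<in> I'" "\<And>s. s \<in> I' \<Longrightarrow> \<gamma> s \<in> fst d"
    "\<And>s n. s \<in> I' \<Longrightarrow> nderiv n (snd d \<circ> \<gamma>) differentiable (at s)"
    "\<And>n j. nderiv n (snd d \<circ> \<gamma>) 0 $ j =
        prolong n (\<lambda>x. snd d (chart_inv c x) $ j) (0, \<lambda>r. nderiv r (snd c \<circ> \<gamma>) 0)"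
proof -
  define W where "W = snd c ` (fst c \<inter> fst d)"
  \<comment> \<open>\<open>\<gamma>\<close> is known to be continuous only through its expression in the chart c, so openness is pulled back from there.\<close>
  define I' where "I' = I \<inter> (snd c \<circ> \<gamma>) -` W"
  have W: "open W" unfolding W_def by (rule open_overlap[OF c open_chart[OF d]])
  have "continuous_on I (snd c \<circ> \<gamma>)"
    using I(3)[of _ 0] unfolding nderiv_0
    by (intro differentiable_imp_continuous_on) (simp add: differentiable_on_def differentiable_at_withinI)
  then have oI': "open I'" unfolding I'_def by (rule continuous_open_preimage[OF _ I(1) W])
  have zero': "0 \<in> I'" using zero I(2) by (auto simp: I'_def W_def)
  have in_d: "\<gamma> s \<in> fst d" if "s \<in> I'" for s
  proof -
    from that obtain p where "p \<in> fst c \<inter> fst d" "snd c (\<gamma> s) = snd c p" by (auto simp: I'_def W_def)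
    then have "\<gamma> s = p" using that I(2) chart_inj[OF c] by (auto simp: I'_def inj_on_def)
    then show ?thesis using \<open>p \<in> fst c \<inter> fst d\<close> by simp
  qed
  have inW: "(snd c \<circ> \<gamma>) s \<in> W" if "s \<in> I'" for s using that by (simp add: I'_def)
  have dI': "nderiv n (snd c \<circ> \<gamma>) differentiable (at s)" if "s \<in> I'" for s n
    using that I(3) by (simp add: I'_def)
  note comp = nderiv_compose[OF W, of "\<lambda>x. snd d (chart_inv c x) $ j" I' "snd c \<circ> \<gamma>" for j,
      OF transition_smooth[OF c d, folded W_def] oI' inW dI']
  have eq: "snd d (chart_inv c ((snd c \<circ> \<gamma>) s)) $ j = (snd d \<circ> \<gamma>) s $ j" if "s \<in> I'" for s j
    using that I(2) c by (simp add: I'_def)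
  have dc: "nderiv n (\<lambda>s. (snd d \<circ> \<gamma>) s $ j) differentiable (at s)" if "s \<in> I'" for s n j
    by (rule differentiable_cong_open[OF oI' _ that comp(2)[OF _ _ that]])
      (use nderiv_cong[OF oI' eq] in auto)
  have dd: "nderiv n (snd d \<circ> \<gamma>) differentiable (at s)" if "s \<in> I'" for s n
    by (rule nderiv_vec(1)[OF oI' dc that])
  show ?thesis
  proof (rule that[OF oI' zero' in_d dd])
    fix n j
    have "nderiv n (snd d \<circ> \<gamma>) 0 $ j = nderiv n (\<lambda>s. (snd d \<circ> \<gamma>) s $ j) 0"
      by (rule nderiv_vec(2)[OF oI' dc zero'])
    also have "\<dots> = nderiv n (\<lambda>s. snd d (chart_inv c ((snd c \<circ> \<gamma>) s)) $ j) 0"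
      by (rule nderiv_cong[OF oI' eq[symmetric] zero'])
    also have "\<dots> = prolong n (\<lambda>x. snd d (chart_inv c x) $ j) (0, \<lambda>r. nderiv r (snd c \<circ> \<gamma>) 0)"
      by (rule comp(1)[OF _ _ zero'])
    finally show "nderiv n (snd d \<circ> \<gamma>) 0 $ j =
        prolong n (\<lambda>x. snd d (chart_inv c x) $ j) (0, \<lambda>r. nderiv r (snd c \<circ> \<gamma>) 0)" .
  qed
qed

lemma smooth_germI:
  assumes "c \<in> A" "open I" "0 \<in> I" "\<And>s. s \<in> I \<Longrightarrow> \<gamma> s \<in> fst c"
    "\<And>s n. s \<in> I \<Longrightarrow> nderiv n (snd c \<circ> \<gamma>) differentiable (at s)"
  shows "smooth_germ A \<gamma>"
proof -
  have "\<exists>\<epsilon>>0. \<forall>s. \<bar>s\<bar> < \<epsilon> \<longrightarrow> \<gamma> s \<in> fst d \<and> (\<forall>n. nderiv n (snd d \<circ> \<gamma>) differentiable (at s))"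
    if d: "d \<in> A" "\<gamma> 0 \<in> fst d" for d
  proof (rule change_of_chart[OF assms(1) d(1) assms(2,4,5,3) d(2)])
    fix I' assume I': "open I'" "0 \<in> I'" "\<And>s. s \<in> I' \<Longrightarrow> \<gamma> s \<in> fst d"
      "\<And>s n. s \<in> I' \<Longrightarrow> nderiv n (snd d \<circ> \<gamma>) differentiable (at s)"
    obtain \<epsilon> where "\<epsilon> > 0" "ball 0 \<epsilon> \<subseteq> I'" using I'(1,2) open_contains_ball by blast
    then show ?thesis using I'(3,4) by (intro exI[of _ \<epsilon>]) (auto simp: subset_eq dist_real_def)
  qed
  then show ?thesis unfolding smooth_germ_def by auto
qed

lemma smooth_germ_const: "smooth_germ A (\<lambda>_. p)"
proof -
  obtain c where "c \<in> A" "p \<in> fst c" by (rule chart_exists)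
  then show ?thesis
    by (intro smooth_germI[of c UNIV]) (auto simp: o_def nderiv_const)
qed

lemma nderiv_agree_all_charts:
  assumes g: "smooth_germ A \<gamma>" "smooth_germ A \<delta>" and c: "c \<in> A" "\<gamma> 0 \<in> fst c" "\<delta> 0 \<in> fst c"
    and eq: "\<And>r. r \<le> k \<Longrightarrow> nderiv r (snd c \<circ> \<gamma>) 0 = nderiv r (snd c \<circ> \<delta>) 0"
  shows "\<gamma> 0 = \<delta> 0"
    and "d \<in> A \<Longrightarrow> \<gamma> 0 \<in> fst d \<Longrightarrow> r \<le> k \<Longrightarrow> nderiv r (snd d \<circ> \<gamma>) 0 = nderiv r (snd d \<circ> \<delta>) 0"
proof -
  show same: "\<gamma> 0 = \<delta> 0" using eq[of 0] c chart_inj[OF c(1)] by (auto simp: inj_on_def)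
  assume d: "d \<in> A" "\<gamma> 0 \<in> fst d" and r: "r \<le> k"
  have *: "nderiv r (snd d \<circ> \<alpha>) 0 $ j =
        prolong r (\<lambda>x. snd d (chart_inv c x) $ j) (0, \<lambda>r. nderiv r (snd c \<circ> \<alpha>) 0)"
    if \<alpha>: "smooth_germ A \<alpha>" "\<alpha> 0 \<in> fst c" "\<alpha> 0 \<in> fst d" for \<alpha> j
  proof (rule germ_nbhd[OF \<alpha>(1) c(1) \<alpha>(2)])
    fix I assume I: "open I" "0 \<in> I" "\<And>s. s \<in> I \<Longrightarrow> \<alpha> s \<in> fst c"
      "\<And>s n. s \<in> I \<Longrightarrow> nderiv n (snd c \<circ> \<alpha>) differentiable (at s)"
    show ?thesis by (rule change_of_chart[OF c(1) d(1) I(1,3,4,2) \<alpha>(3)])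
  qed
  have "nderiv r (snd d \<circ> \<gamma>) 0 $ j = nderiv r (snd d \<circ> \<delta>) 0 $ j" for j
    using *[OF g(1) c(2) d(2)] *[OF g(2) c(3)] d(2) same
      prolong_agree[of r "(0, \<lambda>r. nderiv r (snd c \<circ> \<gamma>) 0)" "(0, \<lambda>r. nderiv r (snd c \<circ> \<delta>) 0)"]
      eq r by simp
  then show "nderiv r (snd d \<circ> \<gamma>) 0 = nderiv r (snd d \<circ> \<delta>) 0" by (simp add: vec_eq_iff)
qed

lemma jet_eqI:
  assumes "smooth_germ A \<gamma>" "smooth_germ A \<delta>" "c \<in> A" "\<gamma> 0 \<in> fst c" "\<delta> 0 \<in> fst c"
    and "\<And>r. r \<le> k \<Longrightarrow> nderiv r (snd c \<circ> \<gamma>) 0 = nderiv r (snd c \<circ> \<delta>) 0"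
  shows "jet A k \<gamma> = jet A k \<delta>"
proof -
  note * = nderiv_agree_all_charts[OF assms]
  show ?thesis unfolding jet_def using * by auto
qed

lemma rep_jet:
  assumes "smooth_germ A \<gamma>"
  shows "smooth_germ A (rep (jet A k \<gamma>))" "rep (jet A k \<gamma>) 0 = \<gamma> 0"
    "\<And>c r. c \<in> A \<Longrightarrow> \<gamma> 0 \<in> fst c \<Longrightarrow> r \<le> k \<Longrightarrow>
      nderiv r (snd c \<circ> rep (jet A k \<gamma>)) 0 = nderiv r (snd c \<circ> \<gamma>) 0"
proof -
  have "\<gamma> \<in> jet A k \<gamma>" using assms by (simp add: jet_def case_prod_unfold)
  then have "rep (jet A k \<gamma>) \<in> jet A k \<gamma>" unfolding rep_def by (rule someI[where P = "\<lambda>\<delta>. \<delta> \<in> jet A k \<gamma>"])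
  then show "smooth_germ A (rep (jet A k \<gamma>))" "rep (jet A k \<gamma>) 0 = \<gamma> 0"
    "\<And>c r. c \<in> A \<Longrightarrow> \<gamma> 0 \<in> fst c \<Longrightarrow> r \<le> k \<Longrightarrow>
      nderiv r (snd c \<circ> rep (jet A k \<gamma>)) 0 = nderiv r (snd c \<circ> \<gamma>) 0"
    by (auto simp: jet_def case_prod_unfold)
qed

lemma jet_in_ext: "smooth_germ A \<gamma> \<Longrightarrow> jet A k \<gamma> \<in> ext A k"
  by (auto simp: ext_def)

lemma extE:
  assumes "J \<in> ext A k" obtains \<gamma> where "smooth_germ A \<gamma>" "J = jet A k \<gamma>"
  using assms by (auto simp: ext_def)

lemma chart_dom_jet_iff:
  "smooth_germ A \<gamma> \<Longrightarrow> jet A k \<gamma> \<in> chart_dom A k c \<longleftrightarrow> \<gamma> 0 \<in> fst c"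
  by (simp add: chart_dom_def jet_in_ext rep_jet)

lemma chart_domE:
  assumes "J \<in> chart_dom A k c" obtains \<gamma> where "smooth_germ A \<gamma>" "J = jet A k \<gamma>" "\<gamma> 0 \<in> fst c"
  using assms by (metis (mono_tags, lifting) chart_dom_def chart_dom_jet_iff extE mem_Collect_eq)

lemma coord_jet:
  "smooth_germ A \<gamma> \<Longrightarrow> c \<in> A \<Longrightarrow> \<gamma> 0 \<in> fst c \<Longrightarrow>
    coord c k (jet A k \<gamma>) = (\<lambda>r. if r \<le> k then nderiv r (snd c \<circ> \<gamma>) 0 else 0)"
  by (auto simp: coord_def rep_jet)

lemma proj_jet:
  assumes "smooth_germ A \<gamma>" shows "proj A k (jet A (Suc k) \<gamma>) = jet A k \<gamma>"
proof -
  obtain c where c: "c \<in> A" "\<gamma> 0 \<in> fst c" by (rule chart_exists)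
  show ?thesis unfolding proj_def
    by (rule jet_eqI[OF rep_jet(1)[OF assms] assms c(1)]) (use assms c in \<open>auto simp: rep_jet\<close>)
qed

lemma coord_inj: "c \<in> A \<Longrightarrow> inj_on (coord c k) (chart_dom A k c)"
proof (rule inj_onI)
  fix J J' assume c: "c \<in> A" and J: "J \<in> chart_dom A k c" "J' \<in> chart_dom A k c" "coord c k J = coord c k J'"
  obtain \<gamma> where \<gamma>: "smooth_germ A \<gamma>" "J = jet A k \<gamma>" "\<gamma> 0 \<in> fst c" using J(1) by (rule chart_domE)
  obtain \<delta> where \<delta>: "smooth_germ A \<delta>" "J' = jet A k \<delta>" "\<delta> 0 \<in> fst c" using J(2) by (rule chart_domE)
  have "nderiv r (snd c \<circ> \<gamma>) 0 = nderiv r (snd c \<circ> \<delta>) 0" if "r \<le> k" for r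
    using fun_cong[OF J(3), of r] that \<gamma> \<delta> c by (simp add: coord_jet)
  then show "J = J'" unfolding \<gamma>(2) \<delta>(2) by (rule jet_eqI[OF \<gamma>(1) \<delta>(1) c \<gamma>(3) \<delta>(3)])
qed

text \<open>
  All jet coordinates over the chart occur: the Taylor polynomial with the given derivatives is pulled
  back to M. Where the Taylor
  polynomial leaves the chart image the curve takes junk values, which do not affect its germ.
\<close>

lemma germ_with_coordinates:
  assumes c: "c \<in> A" and \<zeta>: "\<zeta> 0 \<in> snd c ` fst c" "\<And>r. r > k \<Longrightarrow> \<zeta> r = 0"
  obtains \<gamma> where "smooth_germ A \<gamma>" "\<gamma> 0 \<in> fst c" "\<And>r. nderiv r (snd c \<circ> \<gamma>) 0 = \<zeta> r"
proof -
  define \<gamma> where "\<gamma> s = chart_inv c (taylor_curve k \<zeta> s)" for s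
  define I where "I = taylor_curve k \<zeta> -` (snd c ` fst c)"
  have "isCont (taylor_curve k \<zeta>) s" for s
    using nderiv_taylor_curve_differentiable[of k \<zeta> 0 s] \<zeta>(2) differentiable_imp_continuous_within by auto
  then have I: "open I" unfolding I_def
    by (intro open_vimage open_chart_image[OF c]) (simp add: continuous_on_eq_continuous_at)
  have zero: "0 \<in> I" using \<zeta>(1) by (simp add: I_def taylor_curve_0)
  have in_c: "\<gamma> s \<in> fst c" "snd c (\<gamma> s) = taylor_curve k \<zeta> s" if "s \<in> I" for s
  proof -
    from that obtain p where p: "p \<in> fst c" "taylor_curve k \<zeta> s = snd c p" by (auto simp: I_def)
    then show "\<gamma> s \<in> fst c" "snd c (\<gamma> s) = taylor_curve k \<zeta> s" using c by (auto simp: \<gamma>_def)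
  qed
  have eq: "nderiv n (snd c \<circ> \<gamma>) s = nderiv n (taylor_curve k \<zeta>) s" if "s \<in> I" for n s
    by (rule nderiv_cong[OF I _ that]) (simp add: in_c)
  have "nderiv n (snd c \<circ> \<gamma>) differentiable (at s)" if "s \<in> I" for n s
    by (rule differentiable_cong_open[OF I _ that nderiv_taylor_curve_differentiable[of k \<zeta> n s]])
      (simp_all add: eq \<zeta>(2))
  then have "smooth_germ A \<gamma>" using c I zero in_c(1) by (intro smooth_germI)
  moreover have "nderiv r (snd c \<circ> \<gamma>) 0 = \<zeta> r" for r
    using eq[OF zero] nderiv_taylor_curve[of k \<zeta>] \<zeta>(2) by (simp add: taylor_curve_0)
  ultimately show ?thesis using that in_c(1)[OF zero] by blast
qed

lemma coord_image:
  assumes c: "c \<in> A"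
  shows "coord c k ` chart_dom A k c = {\<zeta>. \<zeta> 0 \<in> snd c ` fst c \<and> (\<forall>r>k. \<zeta> r = 0)}"
proof (intro equalityI subsetI)
  fix \<zeta> assume "\<zeta> \<in> coord c k ` chart_dom A k c"
  then obtain \<gamma> where "smooth_germ A \<gamma>" "\<gamma> 0 \<in> fst c" "\<zeta> = coord c k (jet A k \<gamma>)"
    by (auto elim: chart_domE)
  then show "\<zeta> \<in> {\<zeta>. \<zeta> 0 \<in> snd c ` fst c \<and> (\<forall>r>k. \<zeta> r = 0)}" using c by (auto simp: coord_jet)
next
  fix \<zeta> assume "\<zeta> \<in> {\<zeta>. \<zeta> 0 \<in> snd c ` fst c \<and> (\<forall>r>k. \<zeta> r = 0)}"
  then have \<zeta>: "\<zeta> 0 \<in> snd c ` fst c" "\<And>r. r > k \<Longrightarrow> \<zeta> r = 0" by auto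
  obtain \<gamma> where "smooth_germ A \<gamma>" "\<gamma> 0 \<in> fst c" "\<And>r. nderiv r (snd c \<circ> \<gamma>) 0 = \<zeta> r"
    by (rule germ_with_coordinates[of c \<zeta> k]) (use c \<zeta> in auto)
  then have "coord c k (jet A k \<gamma>) = \<zeta>" "jet A k \<gamma> \<in> chart_dom A k c"
    using c \<zeta>(2) by (auto simp: coord_jet chart_dom_jet_iff)
  then show "\<zeta> \<in> coord c k ` chart_dom A k c" by blast
qed

lemma local_expr_coord:
  "c \<in> A \<Longrightarrow> J \<in> chart_dom A k c \<Longrightarrow> local_expr A k c F (t, coord c k J) = F (t, J)"
  by (simp add: local_expr_def the_inv_into_f_f[OF coord_inj])

text \<open>
  The identification of M with its extension of order 0, a 0-jet being the class of all curves through
  one point.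
\<close>

definition point :: "'a \<Rightarrow> 'a jet" where
  "point p = jet A 0 (\<lambda>_. p)"

section \<open>Iterated complete lifts of functions affine in t\<close>

definition base_expr :: "('a, 'm) chart \<Rightarrow> ('a jet \<Rightarrow> complex) \<Rightarrow> complex ^ 'm \<Rightarrow> complex" where
  "base_expr c g x = g (point (chart_inv c x))"

lemma jet_0: "smooth_germ A \<gamma> \<Longrightarrow> jet A 0 \<gamma> = point (\<gamma> 0)"
proof -
  assume \<gamma>: "smooth_germ A \<gamma>"
  obtain c where c: "c \<in> A" "\<gamma> 0 \<in> fst c" by (rule chart_exists)
  show ?thesis unfolding point_def
    by (rule jet_eqI[OF \<gamma> smooth_germ_const c c(2)]) simp
qed

lemma base_expr_chart [simp]: "c \<in> A \<Longrightarrow> p \<in> fst c \<Longrightarrow> base_expr c g (snd c p) = g (point p)"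
  by (simp add: base_expr_def)

lemma local_expr_base:
  assumes c: "c \<in> A" and \<zeta>: "\<zeta> \<in> coord c 0 ` chart_dom A 0 c"
  shows "local_expr A 0 c (\<lambda>(t, J). a * of_real t + g J) (t, \<zeta>) = a * of_real t + base_expr c g (\<zeta> 0)"
proof -
  from \<zeta> obtain \<gamma> where \<gamma>: "smooth_germ A \<gamma>" "\<gamma> 0 \<in> fst c" "\<zeta> = coord c 0 (jet A 0 \<gamma>)"
    by (auto elim: chart_domE)
  have "\<zeta> 0 = snd c (\<gamma> 0)" using \<gamma> c by (simp add: coord_jet)
  moreover have "local_expr A 0 c (\<lambda>(t, J). a * of_real t + g J) (t, \<zeta>) = a * of_real t + g (point (\<gamma> 0))"
    unfolding \<gamma>(3) jet_0[OF \<gamma>(1), symmetric] using \<gamma> c by (simp add: local_expr_coord chart_dom_jet_iff)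
  ultimately show ?thesis using \<gamma>(2) c by simp
qed

lemma jet_domain_subset:
  "c \<in> A \<Longrightarrow> UNIV \<times> coord c k ` chart_dom A k c \<subseteq> {(t, \<zeta>). \<zeta> 0 \<in> snd c ` fst c}"
  by (auto simp: coord_image)

abbreviation k_shifts ::
  "nat \<Rightarrow> (real \<Rightarrow> real \<times> (nat \<Rightarrow> complex ^ 'm) \<Rightarrow> real \<times> (nat \<Rightarrow> complex ^ 'm)) set" where
  "k_shifts k \<equiv> insert shift_t {shift_z r i w |r i w. r \<le> k \<and> w \<in> {1, \<i>}}"

lemma k_shifts_subset: "k_shifts k \<subseteq> jet_shifts"
  by auto

lemma shift_domain_coord:
  assumes c: "c \<in> A"
  shows "shift_domain (k_shifts k) (UNIV \<times> coord c k ` chart_dom A k c)"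
proof -
  let ?S = "{(t :: real, \<zeta> :: nat \<Rightarrow> complex ^ 'm). \<zeta> 0 \<in> snd c ` fst c}"
  interpret shift_domain jet_shifts ?S by (rule shift_domain_jet[OF open_chart_image[OF c]])
  show ?thesis
  proof
    show "\<sigma> \<in> k_shifts k \<Longrightarrow> \<sigma> 0 p = p" for \<sigma> p using shift_zero k_shifts_subset by blast
    fix \<sigma> and p :: "real \<times> (nat \<Rightarrow> complex ^ 'm)" assume \<sigma>: "\<sigma> \<in> k_shifts k" and p: "p \<in> UNIV \<times> coord c k ` chart_dom A k c"
    have "\<forall>\<^sub>F h in nhds 0. \<sigma> h p \<in> ?S"
      using \<sigma> p jet_domain_subset[OF c] k_shifts_subset by (intro shift_stays) blast+
    then show "\<forall>\<^sub>F h in nhds 0. \<sigma> h p \<in> UNIV \<times> coord c k ` chart_dom A k c"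
    proof eventually_elim
      case (elim h)
      then show ?case using \<sigma> p unfolding coord_image[OF c] by (auto simp: shift_t_def shift_z_def)
    qed
  qed
qed

text \<open>
  Smoothness of \<open>a t + g\<close> is a statement about functions of \<open>(t, \<zeta>)\<close>; restricting to the slice t = 0,
  with all entries of \<open>\<zeta>\<close> of positive order equal to 0, turns it into one about functions on \<open>\<complex>\<^sup>m\<close>.
\<close>

lemma base_expr_smooth:
  assumes c: "c \<in> A" and f: "smooth_fun A 0 (\<lambda>(t, J). a * of_real t + g J)"
  shows "smooth_along vec_shifts (snd c ` fst c) (base_expr c g)"
proof -
  let ?F = "\<lambda>(t, J). a * of_real t + g J"
  define e :: "complex ^ 'm \<Rightarrow> real \<times> (nat \<Rightarrow> complex ^ 'm)" where "e x = (0, \<lambda>r. if r = 0 then x else 0)" for x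
  \<comment> \<open>Any shift of \<open>\<complex>\<^sup>m\<close> acts on the entry of order 0; for \<open>shift_vec i w\<close> this is \<open>shift_z 0 i w\<close>.\<close>
  define \<tau> :: "(real \<Rightarrow> complex ^ 'm \<Rightarrow> complex ^ 'm) \<Rightarrow> real \<Rightarrow> real \<times> (nat \<Rightarrow> complex ^ 'm) \<Rightarrow> real \<times> (nat \<Rightarrow> complex ^ 'm)"
    where "\<tau> \<sigma> = (\<lambda>h (t, \<zeta>). (t, \<zeta>(0 := \<sigma> h (\<zeta> 0))))" for \<sigma>
  have \<tau>: "\<tau> (shift_vec i w) = shift_z 0 i w" for i w by (auto simp: \<tau>_def shift_z_def fun_eq_iff)
  have e: "e x \<in> UNIV \<times> coord c 0 ` chart_dom A 0 c" if "x \<in> snd c ` fst c" for x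
    using that unfolding coord_image[OF c] by (auto simp: e_def)
  have "smooth_along vec_shifts (snd c ` fst c) (\<lambda>x. local_expr A 0 c ?F (e x))"
  proof (rule smooth_along_pullback[where \<tau> = \<tau>])
    show "smooth_along (k_shifts 0) (UNIV \<times> coord c 0 ` chart_dom A 0 c) (local_expr A 0 c ?F)"
      using f c by (auto simp: smooth_fun_def smooth_in_chart_def)
    have "continuous_on (snd c ` fst c) (\<lambda>x :: complex ^ 'm. if i = 0 then x else 0)" for i :: nat
      by (cases "i = 0") simp_all
    then show "continuous_on (snd c ` fst c) e"
      unfolding e_def by (intro continuous_on_Pair continuous_on_coordinatewise_then_product)
        simp_all
    show "\<tau> \<sigma> \<in> k_shifts 0" if "\<sigma> \<in> vec_shifts" for \<sigma> using that \<tau> by fastforce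
    show "e (\<sigma> h q) = \<tau> \<sigma> h (e q)" for \<sigma> h q by (auto simp: e_def \<tau>_def)
  qed (use e in blast)
  then show ?thesis
  proof (rule shift_domain.smooth_along_cong[OF shift_domain_vec[OF open_chart_image[OF c]], rotated])
    fix x assume "x \<in> snd c ` fst c"
    then show "local_expr A 0 c ?F (e x) = base_expr c g x"
      using local_expr_base[OF c, of "snd (e x)" a g 0] e[of x] by (simp add: e_def)
  qed
qed

lemma smooth_affine_prolong:
  assumes c: "c \<in> A" and G: "smooth_along vec_shifts (snd c ` fst c) G"
  shows "smooth_along (k_shifts k) (UNIV \<times> coord c k ` chart_dom A k c)
    (\<lambda>p. a * of_real (fst p) + prolong k G p)"
proof -
  let ?S = "{(t :: real, \<zeta> :: nat \<Rightarrow> complex ^ 'm). \<zeta> 0 \<in> snd c ` fst c}"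
  interpret shift_domain jet_shifts ?S by (rule shift_domain_jet[OF open_chart_image[OF c]])
  have "smooth_along jet_shifts ?S (\<lambda>p. of_real (fst p))"
  proof (rule smooth_affine[where d = "\<lambda>\<sigma>. of_real (fst (\<sigma> 1 (0, \<lambda>_. 0)))"])
    show "continuous_on ?S (\<lambda>p. complex_of_real (fst p))" by (intro continuous_intros)
    fix \<sigma> :: "real \<Rightarrow> real \<times> (nat \<Rightarrow> complex ^ 'm) \<Rightarrow> real \<times> (nat \<Rightarrow> complex ^ 'm)"
      and p assume "\<sigma> \<in> jet_shifts"
    then consider "\<sigma> = shift_t" | r i w where "\<sigma> = shift_z r i w" by auto
    then show "((\<lambda>h. complex_of_real (fst (\<sigma> h p))) has_vector_derivative of_real (fst (\<sigma> 1 (0, \<lambda>_. 0)))) (at 0)"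
      by cases (auto intro!: derivative_eq_intros)
  qed
  then have "smooth_along jet_shifts ?S (\<lambda>p. a * of_real (fst p) + prolong k G p)"
    by (intro smooth_add smooth_mult smooth_const smooth_prolong[OF open_chart_image[OF c] G])
  then show ?thesis by (rule smooth_along_mono[OF _ k_shifts_subset jet_domain_subset[OF c]])
qed

lemma smooth_fun_affineI:
  assumes "\<And>c. c \<in> A \<Longrightarrow> smooth_along vec_shifts (snd c ` fst c) (base_expr c g)"
  shows "smooth_fun A 0 (\<lambda>(t, J). a * of_real t + g J)"
  unfolding smooth_fun_def smooth_in_chart_def
proof
  fix c assume c: "c \<in> A"
  interpret shift_domain "k_shifts 0" "UNIV \<times> coord c 0 ` chart_dom A 0 c" by (rule shift_domain_coord[OF c])
  show "smooth_along (k_shifts 0) (UNIV \<times> coord c 0 ` chart_dom A 0 c)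
      (local_expr A 0 c (\<lambda>(t, J). a * of_real t + g J))"
    by (rule smooth_along_cong[OF _ smooth_affine_prolong[OF c assms[OF c], of 0 a]])
      (auto simp: local_expr_base[OF c])
qed

text \<open>
  The local expression of F is known on the chart image only, where it is determined by F; this is enough
  for its partial derivatives because the image is open in the directions of the shifts.
\<close>

lemma partial_affine_prolong:
  assumes c: "c \<in> A" and G: "smooth_along vec_shifts (snd c ` fst c) G"
    and F: "\<And>t \<zeta>. \<zeta> \<in> coord c k ` chart_dom A k c \<Longrightarrow>
      local_expr A k c F (t, \<zeta>) = a * of_real t + prolong k G (t, \<zeta>)"
    and J: "J \<in> chart_dom A k c"
  shows "d_t A k c F (t, J) = a"
    and "r \<le> k \<Longrightarrow> d_z A k c r i F (t, J) = wirt (shift_z r i) (prolong k G) (t, coord c k J)"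
    and "r \<le> k \<Longrightarrow> d_zbar A k c r i F (t, J) = wirt_bar (shift_z r i) (prolong k G) (t, coord c k J)"
proof -
  let ?S = "UNIV \<times> coord c k ` chart_dom A k c"
  let ?E = "\<lambda>p. a * of_real (fst p) + prolong k G p"
  interpret shift_domain "k_shifts k" ?S by (rule shift_domain_coord[OF c])
  have p: "(t, coord c k J) \<in> ?S" using J by auto
  have eq: "partial \<sigma> (local_expr A k c F) (t, coord c k J) = partial \<sigma> ?E (t, coord c k J)"
    if "\<sigma> \<in> k_shifts k" for \<sigma>
    by (rule partial_eq[OF that p]) (auto simp: F)
  have "prolong k G (shift_t h q) = prolong k G q" for h q by (rule prolong_agree) auto
  then have "partial shift_t ?E q = a" for q
    by (intro partialI) (auto intro!: derivative_eq_intros)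
  then show "d_t A k c F (t, J) = a" using eq[of shift_t] by (simp add: d_t_def)
  have z: "partial (shift_z r i w) ?E (t, coord c k J) = partial (shift_z r i w) (prolong k G) (t, coord c k J)"
    if "r \<le> k" "w \<in> {1, \<i>}" for r i w
  proof (rule partialI)
    have "(t, coord c k J) \<in> {(t, \<zeta>). \<zeta> 0 \<in> snd c ` fst c}" using p jet_domain_subset[OF c] by blast
    moreover have "shift_z r i w \<in> jet_shifts" using that by auto
    ultimately have "(\<lambda>h. prolong k G (shift_z r i w h (t, coord c k J))) differentiable (at 0)"
      by (intro smooth_along_differentiable[OF smooth_prolong[OF open_chart_image[OF c] G]])
    then show "((\<lambda>h. ?E (shift_z r i w h (t, coord c k J))) has_vector_derivative
        partial (shift_z r i w) (prolong k G) (t, coord c k J)) (at 0)"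
      unfolding partial_works by (auto intro!: derivative_eq_intros)
  qed
  have "partial (shift_z r i w) (local_expr A k c F) (t, coord c k J) = partial (shift_z r i w) (prolong k G) (t, coord c k J)"
    if "r \<le> k" "w \<in> {1, \<i>}" for r i w
    using eq[of "shift_z r i w"] z[OF that] that by auto
  then show "r \<le> k \<Longrightarrow> d_z A k c r i F (t, J) = wirt (shift_z r i) (prolong k G) (t, coord c k J)"
    and "r \<le> k \<Longrightarrow> d_zbar A k c r i F (t, J) = wirt_bar (shift_z r i) (prolong k G) (t, coord c k J)"
    by (auto simp: d_z_def d_zbar_def wirt_def wirt_bar_def)
qed

text \<open>
  In the chart that the complete lift selects, the induction step is the recursion for \<open>prolong\<close>. To get
  to an arbitrary chart both sides are recognised as the derivative of order k+1 of \<open>g \<circ> \<gamma>\<close>, in which no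
  chart is left.
\<close>

theorem clift_iter_jet:
  assumes f: "f = (\<lambda>(t, J). a * of_real t + g J)" "smooth_fun A 0 f"
    and \<gamma>: "smooth_germ A \<gamma>" "c \<in> A" "\<gamma> 0 \<in> fst c"
  shows "clift_iter A k f (t, jet A k \<gamma>) =
    a * of_real t + prolong k (base_expr c g) (t, \<lambda>r. nderiv r (snd c \<circ> \<gamma>) 0)"
  using \<gamma>
proof (induction k arbitrary: t c \<gamma>)
  case 0
  then show ?case using f(1) by (simp add: jet_0)
next
  case (Suc k)
  note \<gamma> = Suc.prems
  have G: "smooth_along vec_shifts (snd c ` fst c) (base_expr c g)" if "c \<in> A" for c
    using base_expr_smooth[OF that] f by simp
  let ?J = "jet A (Suc k) \<gamma>"
  define c' where "c' = (SOME c. c \<in> A \<and> ?J \<in> chart_dom A (Suc k) c)"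
  have "c' \<in> A \<and> ?J \<in> chart_dom A (Suc k) c'"
    unfolding c'_def by (rule someI[of _ c]) (simp add: \<gamma> chart_dom_jet_iff)
  then have c': "c' \<in> A" "\<gamma> 0 \<in> fst c'" using \<gamma>(1) chart_dom_jet_iff by blast+
  define \<zeta> where "\<zeta> = coord c' k (jet A k \<gamma>)"
  define \<zeta>' where "\<zeta>' = (\<lambda>r. nderiv r (snd c' \<circ> \<gamma>) 0)"
  have \<zeta>: "\<zeta> n = \<zeta>' n" if "n \<le> k" for n
    using that c' \<gamma>(1) by (simp add: \<zeta>_def \<zeta>'_def coord_jet)
  have zdot: "coord c' (Suc k) ?J (Suc r) = \<zeta>' (Suc r)" if "r \<le> k" for r
    using that c' \<gamma>(1) by (simp add: \<zeta>'_def coord_jet)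
  have loc: "local_expr A k c' (clift_iter A k f) (t, \<xi>) = a * of_real t + prolong k (base_expr c' g) (t, \<xi>)"
    if "\<xi> \<in> coord c' k ` chart_dom A k c'" for t \<xi>
  proof -
    from that obtain \<delta> where \<delta>: "smooth_germ A \<delta>" "\<delta> 0 \<in> fst c'" "\<xi> = coord c' k (jet A k \<delta>)"
      by (auto elim: chart_domE)
    have "prolong k (base_expr c' g) (t, \<lambda>r. nderiv r (snd c' \<circ> \<delta>) 0) = prolong k (base_expr c' g) (t, \<xi>)"
      by (rule prolong_agree) (use \<delta> c' in \<open>simp add: coord_jet\<close>)
    moreover have "local_expr A k c' (clift_iter A k f) (t, \<xi>) = clift_iter A k f (t, jet A k \<delta>)"
      using \<delta> c' by (simp add: local_expr_coord chart_dom_jet_iff)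
    ultimately show ?thesis using Suc.IH[OF \<delta>(1) c'(1) \<delta>(2), of t] by metis
  qed
  note part = partial_affine_prolong[OF c'(1) G[OF c'(1)] loc, of "jet A k \<gamma>", folded \<zeta>_def]
  have Jk: "jet A k \<gamma> \<in> chart_dom A k c'" using \<gamma>(1) c'(2) by (simp add: chart_dom_jet_iff)
  have "clift_iter A (Suc k) f (t, ?J) = a * of_real t +
     (\<Sum>r\<le>k. \<Sum>i\<in>UNIV. \<zeta>' (Suc r) $ i * wirt (shift_z r i) (prolong k (base_expr c' g)) (t, \<zeta>)
        + cnj (\<zeta>' (Suc r) $ i) * wirt_bar (shift_z r i) (prolong k (base_expr c' g)) (t, \<zeta>))"
    unfolding clift_iter.simps clift_def c'_def[symmetric] Let_def prod.case vlift_def proj_jet[OF \<gamma>(1)]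
    using part[OF _ Jk] zdot by (simp add: mult.commute)
  also have "\<dots> = a * of_real t + prolong (Suc k) (base_expr c' g) (t, \<zeta>')"
  proof -
    have "partial (shift_z r i w) (prolong k (base_expr c' g)) (t, \<zeta>) =
        partial (shift_z r i w) (prolong k (base_expr c' g)) (t, \<zeta>')" for r i w
      by (rule partial_prolong_agree) (simp add: \<zeta>)
    then show ?thesis unfolding wirt_real_form by simp
  qed
  also have "prolong (Suc k) (base_expr c' g) (t, \<zeta>') =
      prolong (Suc k) (base_expr c g) (t, \<lambda>r. nderiv r (snd c \<circ> \<gamma>) 0)"
  proof -
    have *: "nderiv (Suc k) (\<lambda>s. g (point (\<gamma> s))) 0 =
        prolong (Suc k) (base_expr d g) (t, \<lambda>r. nderiv r (snd d \<circ> \<gamma>) 0)"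
      if d: "d \<in> A" "\<gamma> 0 \<in> fst d" for d
    proof (rule germ_nbhd[OF \<gamma>(1) d])
      fix I assume I: "open I" "0 \<in> I" "\<And>s. s \<in> I \<Longrightarrow> \<gamma> s \<in> fst d"
        "\<And>s n. s \<in> I \<Longrightarrow> nderiv n (snd d \<circ> \<gamma>) differentiable (at s)"
      have "nderiv (Suc k) (\<lambda>s. g (point (\<gamma> s))) 0 = nderiv (Suc k) (\<lambda>s. base_expr d g ((snd d \<circ> \<gamma>) s)) 0"
        by (rule nderiv_cong[OF I(1) _ I(2)]) (simp add: I(3) d)
      also have "\<dots> = prolong (Suc k) (base_expr d g) (t, \<lambda>r. nderiv r (snd d \<circ> \<gamma>) 0)"
        by (rule nderiv_compose(1)[OF open_chart_image[OF d(1)] G[OF d(1)] I(1) _ I(4) I(2)])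
          (simp add: I(3))
      finally show ?thesis .
    qed
    show ?thesis using *[OF c'] *[OF \<gamma>(2,3)] by (simp add: \<zeta>'_def)
  qed
  finally show ?case .
qed

lemma clift_iter_coord:
  assumes f: "f = (\<lambda>(t, J). a * of_real t + g J)" "smooth_fun A 0 f" and c: "c \<in> A"
    and J: "J \<in> chart_dom A k c"
  shows "clift_iter A k f (t, J) = a * of_real t + prolong k (base_expr c g) (t, coord c k J)"
proof -
  obtain \<gamma> where \<gamma>: "smooth_germ A \<gamma>" "J = jet A k \<gamma>" "\<gamma> 0 \<in> fst c" using J by (rule chart_domE)
  have "prolong k (base_expr c g) (t, \<lambda>r. nderiv r (snd c \<circ> \<gamma>) 0) = prolong k (base_expr c g) (t, coord c k J)"
    by (rule prolong_agree) (use \<gamma> c in \<open>simp add: coord_jet\<close>)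
  then show ?thesis using clift_iter_jet[OF f \<gamma>(1) c \<gamma>(3)] \<gamma>(2) by simp
qed

lemma clift_iter_local_expr:
  assumes f: "f = (\<lambda>(t, J). a * of_real t + g J)" "smooth_fun A 0 f" and c: "c \<in> A"
    and \<zeta>: "\<zeta> \<in> coord c k ` chart_dom A k c"
  shows "local_expr A k c (clift_iter A k f) (t, \<zeta>) = a * of_real t + prolong k (base_expr c g) (t, \<zeta>)"
  using \<zeta> clift_iter_coord[OF f c] c by (auto simp: local_expr_coord)

text \<open>
  Vector fields are prescribed on smooth functions only, so a vector field on the k-th extension can be
  applied to complete lifts because of this.
\<close>

lemma clift_iter_smooth:
  assumes f: "f = (\<lambda>(t, J). a * of_real t + g J)" "smooth_fun A 0 f"
  shows "smooth_fun A k (clift_iter A k f)"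
  unfolding smooth_fun_def smooth_in_chart_def
proof
  fix c assume c: "c \<in> A"
  interpret shift_domain "k_shifts k" "UNIV \<times> coord c k ` chart_dom A k c" by (rule shift_domain_coord[OF c])
  have "smooth_along vec_shifts (snd c ` fst c) (base_expr c g)" using base_expr_smooth[OF c] f by simp
  from smooth_along_cong[OF _ smooth_affine_prolong[OF c this, of k a]]
  show "smooth_along (k_shifts k) (UNIV \<times> coord c k ` chart_dom A k c) (local_expr A k c (clift_iter A k f))"
    using clift_iter_local_expr[OF f c] by auto
qed

lemma clift_iter_partials:
  assumes f: "f = (\<lambda>(t, J). a * of_real t + g J)" "smooth_fun A 0 f" and c: "c \<in> A"
    and J: "J \<in> chart_dom A k c"
  shows "d_t A k c (clift_iter A k f) (t, J) = a"
    and "r \<le> k \<Longrightarrow> d_z A k c r i (clift_iter A k f) (t, J) =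
       wirt (shift_z r i) (prolong k (base_expr c g)) (t, coord c k J)"
    and "r \<le> k \<Longrightarrow> d_zbar A k c r i (clift_iter A k f) (t, J) =
       wirt_bar (shift_z r i) (prolong k (base_expr c g)) (t, coord c k J)"
proof -
  have "smooth_along vec_shifts (snd c ` fst c) (base_expr c g)" using base_expr_smooth[OF c] f by simp
  from partial_affine_prolong[OF c this clift_iter_local_expr[OF f c] J]
  show "d_t A k c (clift_iter A k f) (t, J) = a"
    and "r \<le> k \<Longrightarrow> d_z A k c r i (clift_iter A k f) (t, J) =
       wirt (shift_z r i) (prolong k (base_expr c g)) (t, coord c k J)"
    and "r \<le> k \<Longrightarrow> d_zbar A k c r i (clift_iter A k f) (t, J) =
       wirt_bar (shift_z r i) (prolong k (base_expr c g)) (t, coord c k J)"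
    by blast+
qed

lemma clift_iter_top_partials:
  assumes f: "f = (\<lambda>(t, J). a * of_real t + g J)" "smooth_fun A 0 f" and c: "c \<in> A"
    and J: "J \<in> chart_dom A k c"
  shows "d_z A k c k i (clift_iter A k f) (t, J) = wirt (shift_vec i) (base_expr c g) (coord c k J 0)"
    and "d_zbar A k c k i (clift_iter A k f) (t, J) = wirt_bar (shift_vec i) (base_expr c g) (coord c k J 0)"
  using clift_iter_partials(2,3)[OF f c J, of k]
  by (simp_all add: wirt_def wirt_bar_def partial_prolong_top)

lemma vlift_iter_jet:
  "smooth_germ A \<gamma> \<Longrightarrow> vlift_iter A k f (t, jet A k \<gamma>) = f (t, point (\<gamma> 0))"
  by (induction k) (simp_all add: jet_0 vlift_def proj_jet)

end

section \<open>Polynomial test functions\<close>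

lemma nderiv_poly:
  "nderiv n (\<lambda>s. poly p (of_real s :: complex)) = (\<lambda>s. poly ((pderiv ^^ n) p) (of_real s))"
proof (induction n)
  case (Suc n)
  have "((\<lambda>s. poly q (of_real s :: complex)) has_vector_derivative poly (pderiv q) (of_real s)) (at s)" for q s
    using has_vector_derivative_real_field[OF poly_DERIV[of q "of_real s"]] by simp
  then show ?case by (auto simp: fun_eq_iff nderiv_Suc Suc intro: vector_derivative_at)
qed simp

lemma nderiv_poly_0: "nderiv n (\<lambda>s. poly p (of_real s :: complex)) 0 = fact n * coeff p n"
  by (simp add: nderiv_poly poly_0_coeff_0 coeff_higher_pderiv pochhammer_fact)

lemma coeff_power_order:
  fixes u :: "complex poly"
  assumes "coeff u 0 = 0"
  shows "l < m \<Longrightarrow> coeff (u ^ m) l = 0" and "coeff (u ^ m) m = coeff u 1 ^ m"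
proof -
  have lt: "\<forall>l<m. coeff (u ^ m) l = 0" for m
  proof (induction m)
    case (Suc m)
    show ?case
    proof (intro allI impI)
      fix l assume l: "l < Suc m"
      have "coeff u i * coeff (u ^ m) (l - i) = 0" if "i \<le> l" for i
        using Suc that l assms by (cases "i = 0") auto
      then show "coeff (u ^ Suc m) l = 0"
        unfolding power_Suc coeff_mult by (intro sum.neutral) blast
    qed
  qed simp
  then show "l < m \<Longrightarrow> coeff (u ^ m) l = 0" by blast
  show "coeff (u ^ m) m = coeff u 1 ^ m"
  proof (induction m)
    case (Suc m)
    have "coeff u i * coeff (u ^ m) (Suc m - i) = (if i = 1 then coeff u 1 * coeff u 1 ^ m else 0)"
      if "i \<le> Suc m" for i
    proof (cases "i \<le> 1")
      case True then show ?thesis using assms Suc by (cases "i = 0") (auto simp: le_Suc_eq)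
    next
      case False then show ?thesis using that lt[of m] by auto
    qed
    then have "coeff (u ^ Suc m) (Suc m) = (\<Sum>i\<le>Suc m. if i = 1 then coeff u 1 * coeff u 1 ^ m else 0)"
      by (simp add: coeff_mult del: sum.atMost_Suc)
    also have "\<dots> = coeff u 1 ^ Suc m" by (subst sum.delta) auto
    finally show ?case .
  qed simp
qed

text \<open>
  As u vanishes to order exactly 1, \<open>u\<^sup>k\<^sup>-\<^sup>n\<close> starts with the power k-n. If B starts with the power n,
  then the coefficient of \<open>B u\<^sup>k\<^sup>-\<^sup>n\<close> of order k is the product of the two leading coefficients, and it
  vanishes only if that of B does. For k = 0 only the power \<open>u\<^sup>0 = 1\<close> is involved.
\<close>

lemma poly_zero_if_moments_vanish:
  fixes B u :: "complex poly"
  assumes u: "coeff u 0 = 0" "k = 0 \<or> coeff u 1 \<noteq> 0"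
    and B: "\<And>n. n > k \<Longrightarrow> coeff B n = 0" "\<And>j. j \<le> k \<Longrightarrow> coeff (B * u ^ j) k = 0"
  shows "B = 0"
proof -
  have "n \<le> k \<Longrightarrow> coeff B n = 0" for n
  proof (induction n rule: less_induct)
    case (less n)
    have "coeff B i * coeff (u ^ (k - n)) (k - i) = (if i = n then coeff B n * coeff u 1 ^ (k - n) else 0)"
      if "i \<le> k" for i
    proof -
      consider "i < n" | "i = n" | "i > n" by linarith
      then show ?thesis
        using less that coeff_power_order[OF u(1)] by cases auto
    qed
    then have "coeff (B * u ^ (k - n)) k = (\<Sum>i\<le>k. if i = n then coeff B n * coeff u 1 ^ (k - n) else 0)"
      by (simp add: coeff_mult)
    then have "coeff B n * coeff u 1 ^ (k - n) = 0"
      using B(2)[of "k - n"] less.prems by simp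
    then show ?case using u(2) less.prems by auto
  qed
  then show ?thesis using B(1) by (metis coeff_0 not_le poly_eqI)
qed

definition coeffwise_deriv :: "(real \<Rightarrow> complex poly) \<Rightarrow> complex poly \<Rightarrow> bool" where
  "coeffwise_deriv P P' \<longleftrightarrow> (\<forall>n. ((\<lambda>h. coeff (P h) n) has_vector_derivative coeff P' n) (at 0))"

lemma coeffwise_deriv_mult:
  assumes "coeffwise_deriv P P'" "coeffwise_deriv Q Q'"
  shows "coeffwise_deriv (\<lambda>h. P h * Q h) (P 0 * Q' + P' * Q 0)"
  unfolding coeffwise_deriv_def
proof
  fix n
  have "((\<lambda>h. \<Sum>i\<le>n. coeff (P h) i * coeff (Q h) (n - i)) has_vector_derivative
    (\<Sum>i\<le>n. coeff (P 0) i * coeff Q' (n - i) + coeff P' i * coeff (Q 0) (n - i))) (at 0)"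
    using assms unfolding coeffwise_deriv_def
    by (intro has_vector_derivative_sum has_vector_derivative_mult) auto
  then show "((\<lambda>h. coeff (P h * Q h) n) has_vector_derivative coeff (P 0 * Q' + P' * Q 0) n) (at 0)"
    by (simp add: coeff_mult sum.distrib)
qed

lemma coeffwise_deriv_power:
  assumes "coeffwise_deriv P P'"
  shows "coeffwise_deriv (\<lambda>h. P h ^ j) (of_nat j * P 0 ^ (j - 1) * P')"
proof (induction j)
  case 0
  show ?case by (simp add: coeffwise_deriv_def)
next
  case (Suc j)
  from coeffwise_deriv_mult[OF assms Suc]
  have "coeffwise_deriv (\<lambda>h. P h ^ Suc j) (P 0 * (of_nat j * P 0 ^ (j - 1) * P') + P' * P 0 ^ j)" by simp
  moreover have "P 0 * (of_nat j * P 0 ^ (j - 1) * P') + P' * P 0 ^ j = of_nat (Suc j) * P 0 ^ (Suc j - 1) * P'"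
    by (cases j) (simp_all add: algebra_simps)
  ultimately show ?case by metis
qed

definition conj_if :: "bool \<Rightarrow> complex \<Rightarrow> complex" where
  "conj_if b z = (if b then cnj z else z)"

text \<open>
  The i-th complex coordinate, or for true b its conjugate, of the Taylor curve with derivatives \<open>\<zeta>\<close>, as
  a polynomial in the curve parameter and measured from its value at x.
\<close>

definition coord_poly :: "nat \<Rightarrow> 'm::finite \<Rightarrow> bool \<Rightarrow> complex ^ 'm \<Rightarrow> (nat \<Rightarrow> complex ^ 'm) \<Rightarrow> complex poly" where
  "coord_poly k i b x \<zeta> = (\<Sum>r\<le>k. monom (conj_if b (\<zeta> r $ i) / fact r) r) - [:conj_if b (x $ i):]"

lemma coeff_coord_poly:
  "coeff (coord_poly k i b x \<zeta>) n =
     (if n \<le> k then conj_if b (\<zeta> n $ i) / fact n else 0) - (if n = 0 then conj_if b (x $ i) else 0)"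
  by (cases n) (simp_all add: coord_poly_def coeff_sum)

lemma poly_coord_poly:
  "poly (coord_poly k i b x \<zeta>) (of_real s) = conj_if b (taylor_curve k \<zeta> s $ i) - conj_if b (x $ i)"
  by (cases b) (simp_all add: coord_poly_def poly_sum poly_monom conj_if_def taylor_curve_def
      scaleR_conv_of_real[where 'a = complex] sum_component mult_ac)

lemma coord_poly_coeffwise_deriv:
  assumes "r \<le> k"
  shows "coeffwise_deriv (\<lambda>h. coord_poly k i b x (snd (shift_z r i' w h p)))
    (smult (conj_if b w) (if i = i' then monom (1 / fact r) r else 0))"
  unfolding coeffwise_deriv_def
proof
  fix n
  define e where "e = (if n = r \<and> i = i' then conj_if b w / fact r else 0)"
  have "coeff (coord_poly k i b x (snd (shift_z r i' w h p))) n =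
      coeff (coord_poly k i b x (snd p)) n + of_real h * e" for h
    using assms by (auto simp: coeff_coord_poly e_def shift_vec_nth conj_if_def add_divide_distrib)
  moreover have "((\<lambda>h. q + of_real h * e) has_vector_derivative e) (at 0)" for q
    by (auto intro!: derivative_eq_intros)
  moreover have "coeff (smult (conj_if b w) (if i = i' then monom (1 / fact r) r else 0)) n = e"
    by (simp add: e_def)
  ultimately show "((\<lambda>h. coeff (coord_poly k i b x (snd (shift_z r i' w h p))) n) has_vector_derivative
      coeff (smult (conj_if b w) (if i = i' then monom (1 / fact r) r else 0)) n) (at 0)"
    by simp
qed

text \<open>The functions \<open>w u\<^sup>j\<close> of the uniqueness argument, with w and u measured from the point x.\<close>

definition test_poly :: "complex ^ 'm::finite \<Rightarrow> 'm \<Rightarrow> bool \<Rightarrow> 'm \<Rightarrow> nat \<Rightarrow> complex ^ 'm \<Rightarrow> complex" where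
  "test_poly x i b l j y = (conj_if b (y $ i) - conj_if b (x $ i)) * (y $ l - x $ l) ^ j"

lemma prolong_test_poly:
  fixes W :: "(complex ^ 'm::finite) set"
  assumes W: "open W" "\<zeta> 0 \<in> W" and G: "smooth_along vec_shifts W G"
    and GP: "\<And>y. y \<in> W \<Longrightarrow> G y = test_poly x i b l j y"
    and \<zeta>: "\<And>r. r > k \<Longrightarrow> \<zeta> r = 0"
  shows "prolong k G (t, \<zeta>) = fact k * coeff (coord_poly k i b x \<zeta> * coord_poly k l False x \<zeta> ^ j) k"
proof -
  define U where "U = taylor_curve k \<zeta> -` W"
  have d: "nderiv n (taylor_curve k \<zeta>) differentiable (at s)" for n s
    by (rule nderiv_taylor_curve_differentiable[OF \<zeta>])
  have "continuous_on UNIV (taylor_curve k \<zeta>)"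
    using d[of 0] by (auto simp: continuous_on_eq_continuous_at intro: differentiable_imp_continuous_within)
  then have U: "open U" "0 \<in> U" using W by (auto simp: U_def taylor_curve_0 intro: open_vimage)
  have "prolong k G (t, \<zeta>) = prolong k G (t, \<lambda>r. nderiv r (taylor_curve k \<zeta>) 0)"
    using nderiv_taylor_curve[OF \<zeta>] by (simp add: taylor_curve_0)
  also have "\<dots> = nderiv k (\<lambda>s. G (taylor_curve k \<zeta> s)) 0"
    by (rule nderiv_compose(1)[OF W(1) G U(1) _ d U(2), symmetric]) (simp add: U_def)
  also have "\<dots> = nderiv k (\<lambda>s. poly (coord_poly k i b x \<zeta> * coord_poly k l False x \<zeta> ^ j) (of_real s)) 0"
    by (rule nderiv_cong[OF U(1) _ U(2)])
      (simp add: U_def GP poly_coord_poly test_poly_def poly_power, simp add: conj_if_def)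
  finally show ?thesis by (simp only: nderiv_poly_0)
qed

text \<open>
  A shift of the coordinate of order r adds a multiple of \<open>s\<^sup>r / r!\<close> to the Taylor curve, so the derivative
  of \<open>prolong k G\<close> is given by the product rule for polynomials. The Wirtinger derivatives select the
  complex linear and the antilinear part: the factor \<open>u\<^sup>j\<close> is holomorphic and contributes to the first
  only, the factor X to the first or the second according to b.
\<close>

lemma wirt_prolong_test_poly:
  fixes W :: "(complex ^ 'm::finite) set" and i' :: 'm
  assumes W: "open W" "\<zeta> 0 \<in> W" and G: "smooth_along vec_shifts W G"
    and GP: "\<And>y. y \<in> W \<Longrightarrow> G y = test_poly x i b l j y"
    and \<zeta>: "\<And>r. r > k \<Longrightarrow> \<zeta> r = 0" and r: "r \<le> k"
  defines "X \<equiv> coord_poly k i b x \<zeta>" and "u \<equiv> coord_poly k l False x \<zeta>"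
    and "E \<equiv> \<lambda>i. if i = i' then monom (1 / fact r) r else 0"
  shows "wirt (shift_z r i') (prolong k G) (t, \<zeta>) =
      fact k * ((if b then 0 else coeff (E i * u ^ j) k) + of_nat j * coeff (E l * (X * u ^ (j - 1))) k)"
    and "wirt_bar (shift_z r i') (prolong k G) (t, \<zeta>) = fact k * (if b then coeff (E i * u ^ j) k else 0)"
proof -
  interpret shift_domain jet_shifts "{(t, \<zeta> :: nat \<Rightarrow> complex ^ 'm). \<zeta> 0 \<in> W}"
    by (rule shift_domain_jet[OF W(1)])
  have part: "partial (shift_z r i' w) (prolong k G) (t, \<zeta>) =
    fact k * (conj_if b w * coeff (E i * u ^ j) k + w * (of_nat j * coeff (E l * (X * u ^ (j - 1))) k))"
    if w: "w \<in> {1, \<i>}" for w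
  proof (rule partialI)
    let ?X = "\<lambda>h. coord_poly k i b x (snd (shift_z r i' w h (t, \<zeta>)))"
    let ?u = "\<lambda>h. coord_poly k l False x (snd (shift_z r i' w h (t, \<zeta>)))"
    have 0: "shift_z r i' w 0 (t, \<zeta>) = (t, \<zeta>)" 
      using flow_shift_z[of r i' w] unfolding flow_def by blast
    have "coeffwise_deriv (\<lambda>h. ?X h * ?u h ^ j)
      (?X 0 * (of_nat j * ?u 0 ^ (j - 1) * smult (conj_if False w) (E l)) + smult (conj_if b w) (E i) * ?u 0 ^ j)"
      unfolding E_def by (intro coeffwise_deriv_mult coeffwise_deriv_power coord_poly_coeffwise_deriv r)
    then have "((\<lambda>h. coeff (?X h * ?u h ^ j) k) has_vector_derivative
      coeff (X * (of_nat j * u ^ (j - 1) * smult w (E l)) + smult (conj_if b w) (E i) * u ^ j) k) (at 0)"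
      unfolding coeffwise_deriv_def 0 by (simp add: X_def u_def conj_if_def)
    also have "coeff (X * (of_nat j * u ^ (j - 1) * smult w (E l)) + smult (conj_if b w) (E i) * u ^ j) k =
      conj_if b w * coeff (E i * u ^ j) k + w * (of_nat j * coeff (E l * (X * u ^ (j - 1))) k)"
    proof -
      have "X * (of_nat j * u ^ (j - 1) * smult w (E l)) = smult (w * of_nat j) (E l * (X * u ^ (j - 1)))"
        by (simp add: of_nat_poly mult_ac)
      then show ?thesis by simp
    qed
    finally have "((\<lambda>h. fact k * coeff (?X h * ?u h ^ j) k) has_vector_derivative
      fact k * (conj_if b w * coeff (E i * u ^ j) k + w * (of_nat j * coeff (E l * (X * u ^ (j - 1))) k))) (at 0)"
      by (rule has_vector_derivative_mult_right)
    moreover have "\<forall>\<^sub>F h in nhds 0. fact k * coeff (?X h * ?u h ^ j) k = prolong k G (shift_z r i' w h (t, \<zeta>))"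
    proof -
      have "\<forall>\<^sub>F h in nhds 0. shift_z r i' w h (t, \<zeta>) \<in> {(t, \<zeta>). \<zeta> 0 \<in> W}"
        by (rule shift_stays) (use w W(2) in auto)
      then show ?thesis
      proof eventually_elim
        case (elim h)
        have "prolong k G (fst (shift_z r i' w h (t, \<zeta>)), snd (shift_z r i' w h (t, \<zeta>))) =
            fact k * coeff (?X h * ?u h ^ j) k"
          by (rule prolong_test_poly[OF W(1) _ G GP]) (use elim \<zeta> r in \<open>auto simp: case_prod_unfold\<close>)
        then show ?case by (simp only: prod.collapse)
      qed
    qed
    ultimately show "((\<lambda>h. prolong k G (shift_z r i' w h (t, \<zeta>))) has_vector_derivative
      fact k * (conj_if b w * coeff (E i * u ^ j) k + w * (of_nat j * coeff (E l * (X * u ^ (j - 1))) k))) (at 0)"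
      by (subst (asm) has_vector_derivative_cong_ev[where g = "\<lambda>h. prolong k G (shift_z r i' w h (t, \<zeta>))"])
        (auto elim!: eventually_mono dest: eventually_nhds_x_imp_x)
  qed
  show "wirt (shift_z r i') (prolong k G) (t, \<zeta>) =
      fact k * ((if b then 0 else coeff (E i * u ^ j) k) + of_nat j * coeff (E l * (X * u ^ (j - 1))) k)"
    unfolding wirt_def part[of 1, simplified] part[of \<i>, simplified]
    by (simp add: conj_if_def algebra_simps)
  show "wirt_bar (shift_z r i') (prolong k G) (t, \<zeta>) = fact k * (if b then coeff (E i * u ^ j) k else 0)"
    unfolding wirt_bar_def part[of 1, simplified] part[of \<i>, simplified]
    by (simp add: conj_if_def algebra_simps)
qed

section \<open>Cutoff functions\<close>

lemma flat_0_mono: "x \<le> y \<Longrightarrow> flat 0 x \<le> flat 0 y"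
  by (auto simp: flat_def)

text \<open>
  A composition of flat functions avoids dividing by a sum of smooth functions. Write
  \<open>\<rho> = \<bar>y - x\<bar>\<^sup>2\<close>. For \<open>\<rho> \<le> d\<close> the inner function is 0, so the numerator equals the denominator; for
  \<open>\<rho> \<ge> 2 d\<close> the outer argument is at most 0.
\<close>

definition cutoff :: "real \<Rightarrow> complex ^ 'm::finite \<Rightarrow> complex ^ 'm \<Rightarrow> complex" where
  "cutoff d x y = of_real (flat 0 (flat 0 d - flat 0 ((norm (y - x))\<^sup>2 - d)) / flat 0 (flat 0 d))"

lemma flat_0_pos: "d > 0 \<Longrightarrow> flat 0 d > 0"
  by (simp add: flat_def)

lemma cutoff_eq_1: "d > 0 \<Longrightarrow> (norm (y - x))\<^sup>2 \<le> d \<Longrightarrow> cutoff d x y = 1"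
  using flat_0_pos[OF flat_0_pos[of d]] by (simp add: cutoff_def flat_def[of 0 "_ - d"])

lemma cutoff_eq_0: "(norm (y - x))\<^sup>2 \<ge> 2 * d \<Longrightarrow> cutoff d x y = 0"
  using flat_0_mono[of d "(norm (y - x))\<^sup>2 - d"] by (simp add: cutoff_def flat_def[of 0 "_ - _ :: real"])

lemma smooth_nth: "open V \<Longrightarrow> smooth_along vec_shifts (V :: (complex ^ 'm::finite) set) (\<lambda>y. y $ i)"
proof -
  assume V: "open V"
  interpret shift_domain vec_shifts V by (rule shift_domain_vec[OF V])
  show ?thesis
  proof (rule smooth_affine[where d = "\<lambda>\<sigma>. \<sigma> 1 0 $ i"])
    fix \<sigma> :: "real \<Rightarrow> complex ^ 'm \<Rightarrow> complex ^ 'm" and p :: "complex ^ 'm" assume "\<sigma> \<in> vec_shifts"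
    then obtain j w where \<sigma>: "\<sigma> = shift_vec j w" by auto
    have "((\<lambda>h. p $ i + (if i = j then w else 0) * of_real h) has_vector_derivative (if i = j then w else 0)) (at 0)"
      by (auto intro!: derivative_eq_intros)
    then show "((\<lambda>h. \<sigma> h p $ i) has_vector_derivative \<sigma> 1 0 $ i) (at 0)"
      by (cases "i = j") (simp_all add: \<sigma> shift_vec_nth)
  qed (intro continuous_intros)
qed

lemma smooth_cutoff: "smooth_along vec_shifts UNIV (cutoff d (x :: complex ^ 'm::finite))"
proof -
  interpret shift_domain vec_shifts "UNIV :: (complex ^ 'm) set" by (rule shift_domain_vec) simp
  note nth = smooth_nth[OF open_UNIV]
  have "smooth_along vec_shifts UNIV (\<lambda>y. (\<Sum>i\<in>UNIV. (y $ i - x $ i) * cnj (y $ i - x $ i)) - of_real d)"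
    by (intro smooth_diff smooth_sum smooth_mult smooth_cnj smooth_const nth)
  moreover have "(\<Sum>i\<in>UNIV. (y $ i - x $ i) * cnj (y $ i - x $ i)) - of_real d = of_real ((norm (y - x))\<^sup>2 - d)" for y
  proof -
    have "(\<Sum>i\<in>UNIV. (y $ i - x $ i) * cnj (y $ i - x $ i)) = of_real (\<Sum>i\<in>UNIV. (cmod (y $ i - x $ i))\<^sup>2)"
      by (simp only: of_real_sum complex_norm_square)
    then show ?thesis by (simp add: norm_vec_def L2_set_def sum_nonneg)
  qed
  ultimately have "smooth_along vec_shifts UNIV (\<lambda>y. of_real ((norm (y - x))\<^sup>2 - d))" by simp
  from smooth_diff[OF smooth_const smooth_flat[OF this, of 0], of "of_real (flat 0 d)"]
  have "smooth_along vec_shifts UNIV (\<lambda>y. of_real (flat 0 d - flat 0 ((norm (y - x))\<^sup>2 - d)))" by simp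
  from smooth_mult[OF smooth_flat[OF this, of 0] smooth_const[of "of_real (1 / flat 0 (flat 0 d))"]]
  show ?thesis by (simp add: cutoff_def[abs_def])
qed

lemma smooth_test_poly: "smooth_along vec_shifts UNIV (test_poly (x :: complex ^ 'm::finite) i b l j)"
proof -
  interpret shift_domain vec_shifts "UNIV :: (complex ^ 'm) set" by (rule shift_domain_vec) simp
  note nth = smooth_nth[OF open_UNIV]
  have "smooth_along vec_shifts UNIV (\<lambda>y. conj_if b (y $ i))"
    using nth smooth_cnj[OF nth] by (cases b) (simp_all add: conj_if_def)
  then show ?thesis unfolding test_poly_def[abs_def]
    by (intro smooth_mult smooth_diff smooth_power smooth_const nth)
qed

context complex_manifold
begin

section \<open>The vertical lift\<close>

text \<open>
  Near x the function P is multiplied with a cutoff function supported in a closed ball inside the chart.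
  Extended by 0 it is smooth on M because the preimage K of the ball is compact and hence, M being
  Hausdorff, closed: M is covered by the open sets \<open>fst c\<close> and M - K.
\<close>

lemma global_extension:
  assumes c: "c \<in> A" and x: "x \<in> snd c ` fst c" and P: "smooth_along vec_shifts UNIV P"
  obtains g W where "smooth_fun A 0 (\<lambda>(t, J). 0 * of_real t + g J)" "open W" "x \<in> W" "W \<subseteq> snd c ` fst c"
    "\<And>y. y \<in> W \<Longrightarrow> base_expr c g y = P y"
proof -
  obtain \<rho> where \<rho>: "\<rho> > 0" "cball x \<rho> \<subseteq> snd c ` fst c"
    using open_chart_image[OF c] x open_contains_cball by blast
  \<comment> \<open>The cutoff vanishes from squared distance \<open>2 d = \<rho>\<^sup>2\<close> on.\<close>
  define d where "d = \<rho>\<^sup>2 / 2"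
  have d: "d > 0" using \<rho>(1) by (simp add: d_def)
  define Q where "Q y = P y * cutoff d x y" for y
  have Q0: "Q y = 0" if "y \<notin> cball x \<rho>" for y
  proof -
    have "\<rho>\<^sup>2 \<le> (norm (y - x))\<^sup>2" using that \<rho>(1) by (intro power_mono) (auto simp: dist_norm norm_minus_commute)
    then show ?thesis by (simp add: Q_def cutoff_eq_0 d_def)
  qed
  have Q: "smooth_along vec_shifts V Q" for V
  proof -
    interpret shift_domain vec_shifts "UNIV :: (complex ^ 'm) set" by (rule shift_domain_vec) simp
    show ?thesis unfolding Q_def[abs_def]
      by (rule smooth_along_mono[OF smooth_mult[OF P smooth_cutoff]]) auto
  qed
  define K where "K = chart_inv c ` cball x \<rho>"
  have "continuous_on (cball x \<rho>) (chart_inv c)"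
    using chart_homeomorphism[OF c] \<rho>(2) continuous_on_subset by (auto simp: homeomorphism_def)
  then have K: "closed K" unfolding K_def by (intro compact_imp_closed compact_continuous_image) auto
  define g where "g J = (if rep J 0 \<in> fst c then Q (snd c (rep J 0)) else 0)" for J
  have g: "g (point p) = (if p \<in> fst c then Q (snd c p) else 0)" for p
    using rep_jet(2)[OF smooth_germ_const] by (simp add: g_def point_def)
  have "smooth_along vec_shifts (snd e ` fst e) (base_expr e g)" if e: "e \<in> A" for e
  proof -
    let ?V = "snd e ` (fst e \<inter> fst c)" and ?V' = "snd e ` (fst e \<inter> - K)"
    have V: "open ?V" "open ?V'"
      using open_overlap[OF e] open_chart[OF c] K by auto
    have "smooth_along vec_shifts ?V (base_expr e g)"
    proof -
      interpret shift_domain vec_shifts ?V by (rule shift_domain_vec[OF V(1)])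
      have "smooth_along vec_shifts ?V (\<lambda>y. Q (snd c (chart_inv e y)))"
        by (rule smooth_compose[OF open_UNIV _ transition_smooth[OF e c] Q]) simp
      then show ?thesis
        by (rule smooth_along_cong[rotated]) (use e in \<open>auto simp: g\<close>)
    qed
    moreover have "smooth_along vec_shifts ?V' (base_expr e g)"
    proof -
      interpret shift_domain vec_shifts ?V' by (rule shift_domain_vec[OF V(2)])
      have "base_expr e g y = 0" if "y \<in> ?V'" for y
      proof -
        from that obtain p where p: "p \<in> fst e" "p \<notin> K" "y = snd e p" by auto
        have "Q (snd c p) = 0" if "p \<in> fst c"
        proof (rule Q0)
          show "snd c p \<notin> cball x \<rho>"
            using p(2) chart_inv_apply[OF c that] unfolding K_def by (metis imageI)
        qed
        then show ?thesis using p e by (simp add: g)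
      qed
      then have "0 = base_expr e g y" if "y \<in> ?V'" for y using that by simp
      then show ?thesis by (rule smooth_along_cong[OF _ smooth_const[of 0]])
    qed
    moreover have "snd e ` fst e = ?V \<union> ?V'"
    proof -
      have "K \<subseteq> fst c" using \<rho>(2) c by (auto simp: K_def)
      then show ?thesis by blast
    qed
    ultimately show ?thesis by (simp only: smooth_along_Un[OF V])
  qed
  then have "smooth_fun A 0 (\<lambda>(t, J). 0 * of_real t + g J)" by (rule smooth_fun_affineI)
  moreover define W where "W = ball x (min \<rho> (sqrt d))"
  have "base_expr c g y = P y" if "y \<in> W" for y
  proof -
    have y: "norm (y - x) < \<rho>" "norm (y - x) < sqrt d"
      using that by (auto simp: W_def dist_norm norm_minus_commute)
    then have "(norm (y - x))\<^sup>2 \<le> d"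
      using d power_mono[of "norm (y - x)" "sqrt d" 2] by simp
    moreover have "y \<in> snd c ` fst c" using y(1) \<rho>(2) by (auto simp: dist_norm norm_minus_commute subset_eq)
    ultimately show ?thesis using c d by (auto simp: g Q_def cutoff_eq_1)
  qed
  moreover have "open W" "x \<in> W" "W \<subseteq> snd c ` fst c"
    using \<rho> d by (auto simp: W_def)
  ultimately show thesis using that by blast
qed

text \<open>
  The heart of the uniqueness: at a jet of nonzero velocity, the complete lifts of functions \<open>a t + g\<close>
  separate all tangent directions.
\<close>

lemma annihilator_trivial:
  assumes c: "c \<in> A" and J: "J \<in> chart_dom A k c" and gen: "k = 0 \<or> coord c k J 1 $ l \<noteq> 0"
    and ann: "\<And>a g. smooth_fun A 0 (\<lambda>(t, J). a * of_real t + g J) \<Longrightarrow>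
      \<alpha> * a + (\<Sum>r\<le>k. \<Sum>i\<in>UNIV.
        \<beta> r i * wirt (shift_z r i) (prolong k (base_expr c g)) (t, coord c k J)
      + \<beta>' r i * wirt_bar (shift_z r i) (prolong k (base_expr c g)) (t, coord c k J)) = 0"
  shows "\<alpha> = 0" and "r \<le> k \<Longrightarrow> \<beta> r i = 0" and "r \<le> k \<Longrightarrow> \<beta>' r i = 0"
proof -
  define \<zeta> where "\<zeta> = coord c k J"
  have \<zeta>: "\<zeta> 0 \<in> snd c ` fst c" "\<And>r. r > k \<Longrightarrow> \<zeta> r = 0"
    using coord_image[OF c, of k] J unfolding \<zeta>_def by blast+
  show "\<alpha> = 0"
  proof -
    have b: "base_expr e (\<lambda>_. 0) = (\<lambda>_. 0)" for e by (simp add: base_expr_def fun_eq_iff)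
    have "smooth_fun A 0 (\<lambda>(t, J). 1 * of_real t + 0)"
      by (rule smooth_fun_affineI)
        (use b shift_domain.smooth_const[OF shift_domain_vec[OF open_chart_image]] in auto)
    from ann[OF this] have "\<alpha> + (\<Sum>r\<le>k. \<Sum>i\<in>UNIV.
        \<beta> r i * wirt (shift_z r i) (prolong k (\<lambda>_. 0)) (t, \<zeta>)
      + \<beta>' r i * wirt_bar (shift_z r i) (prolong k (\<lambda>_. 0)) (t, \<zeta>)) = 0" by (simp add: b \<zeta>_def)
    moreover have "prolong k (\<lambda>_ :: complex ^ 'm. 0) = (\<lambda>_. 0)"
    proof (induction k)
      case (Suc k)
      have "partial \<sigma> (prolong k (\<lambda>_ :: complex ^ 'm. 0)) p = 0" for \<sigma> p
        unfolding Suc by (simp add: partial_def)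
      then show ?case by (simp add: fun_eq_iff)
    qed simp
    ultimately show ?thesis by (simp add: wirt_def wirt_bar_def partial_def)
  qed
  define u where "u = coord_poly k l False (\<zeta> 0) \<zeta>"
  define X where "X i b = coord_poly k i b (\<zeta> 0) \<zeta>" for i b
  define B where "B i b = (\<Sum>r\<le>k. smult (if b then \<beta>' r i else \<beta> r i) (monom (1 / fact r) r))" for i b
  have coeff_B: "coeff (B i b) n = (if n \<le> k then (if b then \<beta>' n i else \<beta> n i) / fact n else 0)" for i b n
    by (simp add: B_def coeff_sum if_distrib[of "\<lambda>z. _ * z"] cong: if_cong)
  have main: "coeff (B i b * u ^ j) k + of_nat j * coeff (B l False * (X i b * u ^ (j - 1))) k = 0" for i b j
  proof -
    obtain g W where g: "smooth_fun A 0 (\<lambda>(t, J). 0 * of_real t + g J)" "open W" "\<zeta> 0 \<in> W"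
      "W \<subseteq> snd c ` fst c" "\<And>y. y \<in> W \<Longrightarrow> base_expr c g y = test_poly (\<zeta> 0) i b l j y"
      by (rule global_extension[OF c \<zeta>(1) smooth_test_poly[of "\<zeta> 0" i b l j]]) blast
    have G: "smooth_along vec_shifts W (base_expr c g)"
      by (rule smooth_along_mono[OF base_expr_smooth[OF c g(1)] order_refl g(4)])
    define E where "E r i' i = (if i = i' then monom (1 / fact r) r else (0 :: complex poly))" for r and i' i :: 'm
    have wirts: "wirt (shift_z r i') (prolong k (base_expr c g)) (t, \<zeta>) = fact k *
        ((if b then 0 else coeff (E r i' i * u ^ j) k) + of_nat j * coeff (E r i' l * (X i b * u ^ (j - 1))) k)"
      "wirt_bar (shift_z r i') (prolong k (base_expr c g)) (t, \<zeta>) =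
        fact k * (if b then coeff (E r i' i * u ^ j) k else 0)" if "r \<le> k" for r i'
      unfolding u_def X_def E_def
      by (rule wirt_prolong_test_poly[where \<zeta> = \<zeta>, OF g(2,3) G _ _ that]; use g(5) \<zeta>(2) in blast)+
    \<comment> \<open>Only the directions of the i-th coordinate move the i-th component of the Taylor curve, and summed over r they produce \<open>B\<close>.\<close>
    have sum_E: "(\<Sum>r\<le>k. \<Sum>i'\<in>UNIV. \<theta> r i' * coeff (E r i' i * V) k) =
        coeff ((\<Sum>r\<le>k. smult (\<theta> r i) (monom (1 / fact r) r)) * V) k" for \<theta> V i
    proof -
      have "(\<Sum>i'\<in>UNIV. \<theta> r i' * coeff (E r i' i * V) k) = \<theta> r i * coeff (monom (1 / fact r) r * V) k" for r
      proof -
        have "(\<Sum>i'\<in>UNIV. \<theta> r i' * coeff (E r i' i * V) k) =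
            (\<Sum>i'\<in>UNIV. if i' = i then \<theta> r i * coeff (monom (1 / fact r) r * V) k else 0)"
          by (rule sum.cong) (auto simp: E_def)
        then show ?thesis by simp
      qed
      then show ?thesis by (simp add: sum_distrib_right coeff_sum)
    qed
    have term_eq: "\<beta> r i' * wirt (shift_z r i') (prolong k (base_expr c g)) (t, \<zeta>)
      + \<beta>' r i' * wirt_bar (shift_z r i') (prolong k (base_expr c g)) (t, \<zeta>) =
      fact k * ((if b then \<beta>' r i' else \<beta> r i') * coeff (E r i' i * u ^ j) k)
      + fact k * of_nat j * (\<beta> r i' * coeff (E r i' l * (X i b * u ^ (j - 1))) k)" if "r \<le> k" for r i'
      using wirts[OF that] by (simp add: algebra_simps)
    have "0 = (\<Sum>r\<le>k. \<Sum>i'\<in>UNIV.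
        fact k * ((if b then \<beta>' r i' else \<beta> r i') * coeff (E r i' i * u ^ j) k)
      + fact k * of_nat j * (\<beta> r i' * coeff (E r i' l * (X i b * u ^ (j - 1))) k))"
      using ann[OF g(1)] term_eq by (simp add: \<zeta>_def)
    also have "\<dots> = fact k * coeff (B i b * u ^ j) k + fact k * of_nat j * coeff (B l False * (X i b * u ^ (j - 1))) k"
      by (simp add: sum.distrib sum_distrib_left[symmetric] sum_E B_def)
    finally have "fact k * (coeff (B i b * u ^ j) k + of_nat j * coeff (B l False * (X i b * u ^ (j - 1))) k) = 0"
      by (simp add: algebra_simps)
    then show ?thesis by simp
  qed
  have u: "coeff u 0 = 0" "k = 0 \<or> coeff u 1 \<noteq> 0"
    using gen by (auto simp: u_def coeff_coord_poly conj_if_def \<zeta>_def)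
  have "B l False = 0"
  proof (rule poly_zero_if_moments_vanish[OF u])
    fix j
    \<comment> \<open>For the l-th coordinate itself the test function is \<open>u\<^sup>j\<^sup>+\<^sup>1\<close>, whence a total factor j+1.\<close>
    have "coeff (B l False * u ^ j) k + of_nat j * coeff (B l False * u ^ j) k = 0"
      using main[of l False j] by (cases j) (simp_all add: X_def u_def mult_ac)
    then have "of_nat (Suc j) * coeff (B l False * u ^ j) k = 0" by (simp add: algebra_simps)
    then show "coeff (B l False * u ^ j) k = 0" by (simp del: of_nat_Suc)
  qed (simp add: coeff_B)
  then have "B i b = 0" for i b
    using main[of i b] by (intro poly_zero_if_moments_vanish[OF u]) (simp_all add: coeff_B)
  then have "coeff (B i b) r = 0" for i b r by simp
  then have "r \<le> k \<Longrightarrow> (if b then \<beta>' r i else \<beta> r i) = 0" for b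
    unfolding coeff_B by (metis div_0 divide_eq_0_iff fact_nonzero)
  from this[of True] this[of False]
  show "r \<le> k \<Longrightarrow> \<beta> r i = 0" and "r \<le> k \<Longrightarrow> \<beta>' r i = 0" by auto
qed

text \<open>
  Jets with \<open>z\<^sup>1\<^sup>l \<noteq> 0\<close> are dense over each point of M: shifting \<open>z\<^sup>1\<^sup>l\<close> by a small real number leaves the
  base point fixed and makes the coordinate nonzero.
\<close>

lemma eq_by_density:
  assumes c: "c \<in> A" and J: "J \<in> chart_dom A k c" and e: "smooth_in_chart A k c e"
    and gen: "\<And>J'. J' \<in> chart_dom A k c \<Longrightarrow> coord c k J' 0 = coord c k J 0 \<Longrightarrow>
      k = 0 \<or> coord c k J' 1 $ l \<noteq> 0 \<Longrightarrow> e (t, J') = C"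
  shows "e (t, J) = C"
proof (cases "k = 0")
  case True
  then show ?thesis using gen[OF J] by simp
next
  case False
  let ?S = "UNIV \<times> coord c k ` chart_dom A k c" and ?p = "(t, coord c k J)"
  let ?q = "\<lambda>h. shift_z 1 l 1 h ?p"
  interpret shift_domain "k_shifts k" ?S by (rule shift_domain_coord[OF c])
  have \<sigma>: "shift_z 1 l 1 \<in> k_shifts k"
    using False by (intro insertI2 CollectI exI[of _ "1 :: nat"] exI[of _ l] exI[of _ "1 :: complex"]) auto
  have p: "?p \<in> ?S" using J by auto
  have ev: "\<forall>\<^sub>F h in at 0. ?q h \<in> ?S"
    using shift_stays[OF \<sigma> p] by (rule eventually_nhds_conv_at[THEN iffD1, THEN conjunct1])
  have "continuous_on ?S (local_expr A k c e)"
    using e unfolding smooth_in_chart_def by (rule smooth_along_continuous)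
  then have cont: "(local_expr A k c e \<longlongrightarrow> local_expr A k c e ?p) (at ?p within ?S)"
    using p unfolding continuous_on_def by (rule bspec)
  have qp: "(?q \<longlongrightarrow> ?p) (at 0)"
    using flow_tendsto[OF flow_shift_z, of "\<lambda>h. h" 0 "at 0" "\<lambda>_. ?p" ?p 1 l 1] shift_zero[OF \<sigma>, of ?p]
    by simp
  have qne: "?q h \<noteq> ?p" if "h \<noteq> 0" for h
  proof
    assume "?q h = ?p"
    then have "snd (?q h) 1 $ l = snd ?p 1 $ l" by simp
    then show False using that by (simp add: shift_vec_nth)
  qed
  have lim: "((\<lambda>h. local_expr A k c e (?q h)) \<longlongrightarrow> e (t, J)) (at 0)"
  proof -
    have "filterlim ?q (at ?p within ?S) (at 0)"
      unfolding filterlim_at using qp ev qne by (auto simp: eventually_at_filter elim!: eventually_mono)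
    from filterlim_compose[OF cont this] show ?thesis using local_expr_coord[OF c J] by simp
  qed
  have "\<forall>\<^sub>F h in at 0. local_expr A k c e (?q h) = C"
  proof -
    have "\<forall>\<^sub>F h in at 0. complex_of_real h \<noteq> - (coord c k J 1 $ l)"
    proof (cases "coord c k J 1 $ l = 0")
      case True
      then show ?thesis by (auto simp: eventually_at_filter)
    next
      case False
      have "((\<lambda>h. complex_of_real h) \<longlongrightarrow> 0) (at 0)" by (auto intro!: tendsto_eq_intros)
      then show ?thesis using False by (intro tendsto_imp_eventually_ne) auto
    qed
    with ev show ?thesis
    proof eventually_elim
      case (elim h)
      then obtain J' where J': "J' \<in> chart_dom A k c" "?q h = (t, coord c k J')"
        by (auto simp: shift_z_def)
      have "coord c k J' = snd (?q h)" using J'(2) by simp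
      then have "coord c k J' 0 = coord c k J 0" "coord c k J' 1 $ l = coord c k J 1 $ l + of_real h"
        by (simp_all add: shift_vec_nth)
      then have "e (t, J') = C"
        using elim(2) by (intro gen[OF J'(1)]) (auto simp: add_eq_0_iff)
      then show ?case unfolding J'(2) using local_expr_coord[OF c J'(1)] by simp
    qed
  qed
  then have "((\<lambda>h. local_expr A k c e (?q h)) \<longlongrightarrow> C) (at 0)" by (rule tendsto_eventually)
  then show ?thesis using lim tendsto_unique[OF at_neq_bot] by blast
qed

lemma vlift_iter_base:
  assumes c: "c \<in> A" and J: "J \<in> chart_dom A k c"
  shows "vlift_iter A k f (t, J) = f (t, point (chart_inv c (coord c k J 0)))"
proof -
  obtain \<gamma> where \<gamma>: "smooth_germ A \<gamma>" "J = jet A k \<gamma>" "\<gamma> 0 \<in> fst c" using J by (rule chart_domE)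
  then show ?thesis using c by (simp add: vlift_iter_jet coord_jet)
qed

text \<open>
  The first order operator of the claimed local form sends complete lifts to vertical lifts, since the
  derivatives of the lifted function by the coordinates of highest order are the derivatives of g.
\<close>

lemma vlift_of_local_form:
  assumes Z: "local_form A 0 Z (\<lambda>c i (t, p). Z0 c i p) (\<lambda>c i (t, p). Zbar0 c i p)"
    and f: "f = (\<lambda>(t, J). a * of_real t + g J)" "smooth_fun A 0 f"
    and c: "c \<in> A" and J: "J \<in> chart_dom A k c"
  shows "vlift_iter A k (Z f) (t, J) = d_t A k c (clift_iter A k f) (t, J)
    + (\<Sum>i\<in>UNIV. vlift_iter A k (\<lambda>(t, p). Z0 c i p) (t, J) * d_z A k c k i (clift_iter A k f) (t, J)
                + vlift_iter A k (\<lambda>(t, p). Zbar0 c i p) (t, J) * d_zbar A k c k i (clift_iter A k f) (t, J))"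
proof -
  obtain \<gamma> where \<gamma>: "smooth_germ A \<gamma>" "J = jet A k \<gamma>" "\<gamma> 0 \<in> fst c" using J by (rule chart_domE)
  let ?P = "point (\<gamma> 0)"
  have P: "?P \<in> chart_dom A 0 c" "coord c 0 ?P 0 = snd c (\<gamma> 0)"
    using \<gamma> c chart_dom_jet_iff[OF \<gamma>(1), of 0] coord_jet[OF \<gamma>(1) c \<gamma>(3), of 0] by (simp_all add: jet_0)
  have J0: "coord c k J 0 = snd c (\<gamma> 0)" using \<gamma> c by (simp add: coord_jet)
  have "Z f (t, ?P) = d_t A 0 c f (t, ?P)
    + (\<Sum>i\<in>UNIV. Z0 c i ?P * d_z A 0 c 0 i f (t, ?P) + Zbar0 c i ?P * d_zbar A 0 c 0 i f (t, ?P))"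
    using Z f(2) c P(1) unfolding local_form_def by auto
  also have "\<dots> = a + (\<Sum>i\<in>UNIV. Z0 c i ?P * wirt (shift_vec i) (base_expr c g) (snd c (\<gamma> 0))
      + Zbar0 c i ?P * wirt_bar (shift_vec i) (base_expr c g) (snd c (\<gamma> 0)))"
    using clift_iter_partials(1)[OF f c P(1)] clift_iter_top_partials[OF f c P(1)] by (simp add: P(2))
  finally show ?thesis
    using clift_iter_partials(1)[OF f c J] clift_iter_top_partials[OF f c J]
    by (simp add: \<gamma>(2)[symmetric] J0 vlift_iter_base[OF c J] \<gamma>(3) c)
qed

theorem affine_lift_iff_local_form:
  assumes Z: "local_form A 0 Z (\<lambda>c i (t, p). Z0 c i p) (\<lambda>c i (t, p). Zbar0 c i p)"
    and W: "vector_field A k W"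
  shows "vertical_lift_affine A k Z W \<longleftrightarrow>
    local_form A k W (\<lambda>c i. vlift_iter A k (\<lambda>(t, p). Z0 c i p)) (\<lambda>c i. vlift_iter A k (\<lambda>(t, p). Zbar0 c i p))"
    (is "_ \<longleftrightarrow> ?L")
proof
  assume L: ?L
  have "W (clift_iter A k f) (t, J) = vlift_iter A k (Z f) (t, J)"
    if f: "smooth_fun A 0 f" "f = (\<lambda>(t, J). a * of_real t + g J)" and J: "J \<in> ext A k" for f a g t J
  proof -
    obtain \<gamma> where \<gamma>: "smooth_germ A \<gamma>" "J = jet A k \<gamma>" using J by (rule extE)
    obtain c where c: "c \<in> A" "\<gamma> 0 \<in> fst c" by (rule chart_exists)
    have Jc: "J \<in> chart_dom A k c" using \<gamma> c(2) by (simp add: chart_dom_jet_iff)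
    show ?thesis
      unfolding vlift_of_local_form[OF Z f(2,1) c(1) Jc]
      using L clift_iter_smooth[OF f(2,1)] c(1) Jc unfolding local_form_def by blast
  qed
  then show "vertical_lift_affine A k Z W"
    using W unfolding vertical_lift_affine_def lifts_on_def by blast
next
  assume V: "vertical_lift_affine A k Z W"
  show ?L
    unfolding local_form_def
  proof (intro ballI allI impI)
    fix c F t J assume c: "c \<in> A" and F: "smooth_fun A k F" and J: "J \<in> chart_dom A k c"
    have "\<exists>a b b'. smooth_in_chart A k c a \<and>
        (\<forall>r\<le>k. \<forall>i. smooth_in_chart A k c (b r i) \<and> smooth_in_chart A k c (b' r i)) \<and>
        (\<forall>F. smooth_fun A k F \<longrightarrow> (\<forall>t. \<forall>J\<in>chart_dom A k c.
           W F (t, J) = a (t, J) * d_t A k c F (t, J)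
             + (\<Sum>r\<le>k. \<Sum>i\<in>UNIV. b r i (t, J) * d_z A k c r i F (t, J)
                              + b' r i (t, J) * d_zbar A k c r i F (t, J))))"
      using W c unfolding vector_field_def by (rule bspec)
    then obtain a b b' where ab: "smooth_in_chart A k c a"
        "\<And>r i. r \<le> k \<Longrightarrow> smooth_in_chart A k c (b r i)" "\<And>r i. r \<le> k \<Longrightarrow> smooth_in_chart A k c (b' r i)"
      and Wab: "\<And>F t J. smooth_fun A k F \<Longrightarrow> J \<in> chart_dom A k c \<Longrightarrow>
           W F (t, J) = a (t, J) * d_t A k c F (t, J)
             + (\<Sum>r\<le>k. \<Sum>i\<in>UNIV. b r i (t, J) * d_z A k c r i F (t, J)
                              + b' r i (t, J) * d_zbar A k c r i F (t, J))"
      by blast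
    define C where "C i = Z0 c i (point (chart_inv c (coord c k J 0)))" for i
    define C' where "C' i = Zbar0 c i (point (chart_inv c (coord c k J 0)))" for i
    have gen: "a (t, J') = 1 \<and> (\<forall>r\<le>k. \<forall>i. b r i (t, J') = (if r = k then C i else 0)
        \<and> b' r i (t, J') = (if r = k then C' i else 0))"
      if J': "J' \<in> chart_dom A k c" "coord c k J' 0 = coord c k J 0" "k = 0 \<or> coord c k J' 1 $ l \<noteq> 0" for J' l
    proof -
      have ann: "(a (t, J') - 1) * a' + (\<Sum>r\<le>k. \<Sum>i\<in>UNIV.
          (b r i (t, J') - (if r = k then C i else 0)) * wirt (shift_z r i) (prolong k (base_expr c g)) (t, coord c k J')
        + (b' r i (t, J') - (if r = k then C' i else 0)) * wirt_bar (shift_z r i) (prolong k (base_expr c g)) (t, coord c k J')) = 0"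
        if g: "smooth_fun A 0 (\<lambda>(t, J). a' * of_real t + g J)" for a' g
      proof -
        let ?f = "\<lambda>(t, J). a' * of_real t + g J"
        let ?w = "\<lambda>r i. wirt (shift_z r i) (prolong k (base_expr c g)) (t, coord c k J')"
        let ?w' = "\<lambda>r i. wirt_bar (shift_z r i) (prolong k (base_expr c g)) (t, coord c k J')"
        note part = clift_iter_partials[OF refl g c J'(1)]
        have "W (clift_iter A k ?f) (t, J') = vlift_iter A k (Z ?f) (t, J')"
          using V g J'(1) unfolding vertical_lift_affine_def lifts_on_def chart_dom_def by blast
        then have "a (t, J') * a' + (\<Sum>r\<le>k. \<Sum>i\<in>UNIV. b r i (t, J') * ?w r i + b' r i (t, J') * ?w' r i)
            = a' + (\<Sum>i\<in>UNIV. C i * ?w k i + C' i * ?w' k i)"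
          unfolding Wab[OF clift_iter_smooth[OF refl g] J'(1)] vlift_of_local_form[OF Z refl g c J'(1)]
          by (simp add: part vlift_iter_base[OF c J'(1)] J'(2) C_def C'_def)
        moreover have "(\<Sum>i\<in>UNIV. C i * ?w k i + C' i * ?w' k i) =
            (\<Sum>r\<le>k. if r = k then \<Sum>i\<in>UNIV. C i * ?w k i + C' i * ?w' k i else 0)" by simp
        moreover have "\<dots> = (\<Sum>r\<le>k. \<Sum>i\<in>UNIV. (if r = k then C i else 0) * ?w r i + (if r = k then C' i else 0) * ?w' r i)"
          by (rule sum.cong) auto
        ultimately show ?thesis
          by (simp add: algebra_simps sum.distrib sum_subtractf)
      qed
      from annihilator_trivial[OF c J'(1,3) ann] show ?thesis by fastforce
    qed
    have a: "a (t, J) = 1" by (rule eq_by_density[OF c J ab(1)]) (use gen in blast)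
    have b: "b r i (t, J) = (if r = k then C i else 0)" if "r \<le> k" for r i
      by (rule eq_by_density[OF c J ab(2)[OF that]]) (use gen that in blast)
    have b': "b' r i (t, J) = (if r = k then C' i else 0)" if "r \<le> k" for r i
      by (rule eq_by_density[OF c J ab(3)[OF that]]) (use gen that in blast)
    have "W F (t, J) = d_t A k c F (t, J) + (\<Sum>r\<le>k. if r = k then
        \<Sum>i\<in>UNIV. C i * d_z A k c k i F (t, J) + C' i * d_zbar A k c k i F (t, J) else 0)"
      unfolding Wab[OF F J] a mult_1
      by (intro arg_cong2[of _ _ _ _ "(+)"] refl sum.cong) (auto simp: b b')
    then show "W F (t, J) = d_t A k c F (t, J) +
        (\<Sum>i\<in>UNIV. vlift_iter A k (\<lambda>(t, p). Z0 c i p) (t, J) * d_z A k c k i F (t, J)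
           + vlift_iter A k (\<lambda>(t, p). Zbar0 c i p) (t, J) * d_zbar A k c k i F (t, J))"
      by (simp add: vlift_iter_base[OF c J] C_def C'_def)
  qed
qed

end

theorem proposition3p2p1:
  fixes A :: "('a::{t2_space, second_countable_topology}, 'm::finite) chart set"
    and k :: nat
    and Z W :: "(real \<times> 'a jet \<Rightarrow> complex) \<Rightarrow> real \<times> 'a jet \<Rightarrow> complex"
    and Z0 Zbar0 :: "('a, 'm) chart \<Rightarrow> 'm \<Rightarrow> 'a jet \<Rightarrow> complex"
  assumes "complex_atlas A"
    and "vector_field A 0 Z"
    and "\<And>c i. c \<in> A \<Longrightarrow> smooth_in_chart A 0 c (\<lambda>(t, p). Z0 c i p)"
    and "\<And>c i. c \<in> A \<Longrightarrow> smooth_in_chart A 0 c (\<lambda>(t, p). Zbar0 c i p)"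
    and "local_form A 0 Z (\<lambda>c i (t, p). Z0 c i p) (\<lambda>c i (t, p). Zbar0 c i p)"
    and "vector_field A k W"
  shows "(vertical_lift A k Z W \<longrightarrow>
           local_form A k W (\<lambda>c i. vlift_iter A k (\<lambda>(t, p). Z0 c i p))
                            (\<lambda>c i. vlift_iter A k (\<lambda>(t, p). Zbar0 c i p))) \<and>
         (vertical_lift_affine A k Z W \<longleftrightarrow>
           local_form A k W (\<lambda>c i. vlift_iter A k (\<lambda>(t, p). Z0 c i p))
                            (\<lambda>c i. vlift_iter A k (\<lambda>(t, p). Zbar0 c i p)))"
proof -
  interpret complex_manifold A by standard (rule assms(1))
  have "vertical_lift A k Z W \<Longrightarrow> vertical_lift_affine A k Z W"
    by (auto simp: vertical_lift_def vertical_lift_affine_def lifts_on_def)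
  then show ?thesis using affine_lift_iff_local_form[OF assms(5,6)] by blast
qed

end
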